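(* Let $r\in\mathbb{N}$ and $k\in\{1,2,\dots,r+1\}$. Let $\mathbf{m}=[\mathbf{m}_0,\mathbf{m}_1,\dots,\mathbf{m}_r,\mathbf{m}_{r+1}]$ be a vector with $\mathbf{m}_0=1$ and $\mathbf{m}_{r+1}=0$, let $\mathbf{p}=[\mathbf{p}_0,\dots,\mathbf{p}_{r+1}]$ with $1\ge \mathbf{p}_0\ge \mathbf{p}_1\ge\dots\ge \mathbf{p}_r\ge \mathbf{p}_{r+1}=0$, and let $\mathbf{q}=[\mathbf{q}_0,\dots,\mathbf{q}_{r+1}]$ with $1\ge \mathbf{q}_0\ge \mathbf{q}_1\ge\dots\ge \mathbf{q}_r\ge \mathbf{q}_{r+1}=0$. Let the set $\mathcal{X}=\{\mathbf{x}^{(1)},\dots,\mathbf{x}^{(l)}\}$ with $\mathbf{x}^{(i)}\in\mathbb{R}^n$, the set $\mathcal{Y}=\{\mathbf{y}^{(1)},\dots,\mathbf{y}^{(l)}\}$ with $\mathbf{y}^{(i)}\in\mathbb{R}^m$, and scalars $\beta\ge 0$ and $s\in\mathbb{R}$ be given. With the random objects and $Z$ as defined in the context, consider $$\psi(\mathcal{X},\mathcal{Y},\mathbf{p},\mathbf{q},\mathbf{m},\beta,s,t)=\mathbb{E}_{G,\mathcal{U}_{r+1}}\frac{1}{\beta|s|\sqrt{n}\,\mathbf{m}_r}\log\left(\mathbb{E}_{\mathcal{U}_r}\left(\dots\left(\mathbb{E}_{\mathcal{U}_2}\left(\left(\mathbb{E}_{\mathcal{U}_1}\left(Z^{\mathbf{m}_1}\right)\right)^{\frac{\mathbf{m}_2}{\mathbf{m}_1}}\right)\right)^{\frac{\mathbf{m}_3}{\mathbf{m}_2}}\dots\right)^{\frac{\mathbf{m}_r}{\mathbf{m}_{r-1}}}\right).$$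 With the measures $\gamma^{(r)}_{01},\gamma^{(r)}_{02},\gamma^{(r)}_{1},\dots,\gamma^{(r)}_{r+1}$ and the averages $\langle\cdot\rangle_\gamma$ as defined in the context, let, for $k_1\in\{1,\dots,r+1\}$, $$\phi_{k_1}^{(r)}=-s(\mathbf{m}_{k_1-1}-\mathbf{m}_{k_1})\,\mathbb{E}_{G,\mathcal{U}_{r+1}}\Big\langle \big(\mathbf{p}_{k_1-1}\|\mathbf{x}^{(i_1)}\|_2\|\mathbf{x}^{(p_1)}\|_2-(\mathbf{x}^{(p_1)})^T\mathbf{x}^{(i_1)}\big)\big(\mathbf{q}_{k_1-1}\|\mathbf{y}^{(i_2)}\|_2\|\mathbf{y}^{(p_2)}\|_2-(\mathbf{y}^{(p_2)})^T\mathbf{y}^{(i_2)}\big)\Big\rangle_{\gamma_{k_1}^{(r)}},$$ $$\phi_{01}^{(r)}=(1-\mathbf{p}_0)(1-\mathbf{q}_0)\,\mathbb{E}_{G,\mathcal{U}_{r+1}}\Big\langle\|\mathbf{x}^{(i_1)}\|_2^2\|\mathbf{y}^{(i_2)}\|_2^2\Big\rangle_{\gamma_{01}^{(r)}},$$ $$\phi_{02}^{(r)}=(s-1)(1-\mathbf{p}_0)\,\mathbb{E}_{G,\mathcal{U}_{r+1}}\Big\langle\|\mathbf{x}^{(i_1)}\|_2^2\big(\mathbf{q}_0\|\mathbf{y}^{(i_2)}\|_2\|\mathbf{y}^{(p_2)}\|_2-(\mathbf{y}^{(p_2)})^T\mathbf{y}^{(i_2)}\big)\Big\rangle_{\gamma_{02}^{(r)}}.$$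 Then $$\frac{d\psi(\mathcal{X},\mathcal{Y},\mathbf{p},\mathbf{q},\mathbf{m},\beta,s,t)}{dt}=\frac{\mathrm{sign}(s)\,\beta}{2\sqrt{n}}\left(\Big(\sum_{k_1=1}^{r+1}\phi_{k_1}^{(r)}\Big)+\phi_{01}^{(r)}+\phi_{02}^{(r)}\right).$$ In particular, choosing $\mathbf{p}_0=\mathbf{q}_0=1$, one also has $$\frac{d\psi(\mathcal{X},\mathcal{Y},\mathbf{p},\mathbf{q},\mathbf{m},\beta,s,t)}{dt}=\frac{\mathrm{sign}(s)\,\beta}{2\sqrt{n}}\sum_{k_1=1}^{r+1}\phi_{k_1}^{(r)}.$$
   Context: Randomness. $G\in\mathbb{R}^{m\times n}$, and, for $k\in\{1,\dots,r+1\}$, $u^{(4,k)}\in\mathbb{R}$, $\mathbf{u}^{(2,k)}\in\mathbb{R}^m$, $\mathbf{h}^{(k)}\in\mathbb{R}^n$ all have zero-mean independent normal components (independent also across the different objects); the variances of the components of $G$, $u^{(4,k)}$, $\mathbf{u}^{(2,k)}$, $\mathbf{h}^{(k)}$ are $1$, $\mathbf{p}_{k-1}\mathbf{q}_{k-1}-\mathbf{p}_k\mathbf{q}_k$, $\mathbf{p}_{k-1}-\mathbf{p}_k$, $\mathbf{q}_{k-1}-\mathbf{q}_k$, respectively. $\mathcal{U}_k=[u^{(4,k)},\mathbf{u}^{(2,k)},\mathbf{h}^{(k)}]$. $\mathbb{E}$ with a subscript denotes expectation with respect to the randomness specified in the subscript. Processes. With the interpolation parameter $t$ (so that $\sqrt{t}$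 and $\sqrt{1-t}$ are real) and $i_1,i_2\in\{1,\dots,l\}$, $$D_0^{(i_1,i_2)}=\sqrt{t}(\mathbf{y}^{(i_2)})^TG\mathbf{x}^{(i_1)}+\sqrt{1-t}\|\mathbf{x}^{(i_1)}\|_2(\mathbf{y}^{(i_2)})^T\Big(\sum_{k=1}^{r+1}\mathbf{u}^{(2,k)}\Big)+\sqrt{t}\|\mathbf{x}^{(i_1)}\|_2\|\mathbf{y}^{(i_2)}\|_2\Big(\sum_{k=1}^{r+1}u^{(4,k)}\Big)+\sqrt{1-t}\|\mathbf{y}^{(i_2)}\|_2\Big(\sum_{k=1}^{r+1}\mathbf{h}^{(k)}\Big)^T\mathbf{x}^{(i_1)},$$ $$A^{(i_1,i_2)}=e^{\beta D_0^{(i_1,i_2)}},\qquad C^{(i_1)}=\sum_{i_2=1}^{l}A^{(i_1,i_2)},\qquad Z=\sum_{i_1=1}^{l}\Big(\sum_{i_2=1}^{l}e^{\beta D_0^{(i_1,i_2)}}\Big)^s=\sum_{i_1=1}^{l}(C^{(i_1)})^s .$$ Operators and measures. Let $\zeta_0=Z$ and $\zeta_k=\mathbb{E}_{\mathcal{U}_k}\big(\zeta_{k-1}^{\mathbf{m}_k/\mathbf{m}_{k-1}}\big)$ for $1\le k\le r$ (so the argument of the logarithm in $\psi$ is $\zeta_r$). $\Phi_{\mathcal{U}_k}$ is the operator $$\Phi_{\mathcal{U}_k}=\mathbb{E}_{\mathcal{U}_k}\frac{\zeta_{k-1}^{\mathbf{m}_k/\mathbf{m}_{k-1}}}{\zeta_k},\quad\text{i.e.}\quad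 \Phi_{\mathcal{U}_k}f=\mathbb{E}_{\mathcal{U}_k}\Big(\frac{\zeta_{k-1}^{\mathbf{m}_k/\mathbf{m}_{k-1}}}{\zeta_k}f\Big).$$ Products $\prod_{k=b}^{a}\Phi_{\mathcal{U}_k}$ with $b\ge a$ run in decreasing index order, $\Phi_{\mathcal{U}_b}\cdots\Phi_{\mathcal{U}_a}$ (with $\Phi_{\mathcal{U}_a}$ applied first), and are the identity if $b<a$. Set $$\gamma_0(i_1,i_2)=\frac{(C^{(i_1)})^s}{Z}\frac{A^{(i_1,i_2)}}{C^{(i_1)}},$$ $$\gamma_{01}^{(r)}=\prod_{k=r}^{1}\Phi_{\mathcal{U}_k}\big(\gamma_0(i_1,i_2)\big),\qquad \gamma_{02}^{(r)}=\prod_{k=r}^{1}\Phi_{\mathcal{U}_k}\big(\gamma_0(i_1,i_2)\times\gamma_0(i_1,p_2)\big),$$ and for $k_1\in\{0,1,\dots,r\}$ $$\gamma_{k_1+1}^{(r)}=\prod_{k=r}^{k_1+1}\Phi_{\mathcal{U}_k}\Big(\prod_{k=k_1}^{1}\Phi_{\mathcal{U}_k}\gamma_0(i_1,i_2)\times\prod_{k=k_1}^{1}\Phi_{\mathcal{U}_k}\gamma_0(p_1,p_2)\Big).$$ All indices $i_1,i_2,p_1,p_2$ range over $\{1,\dots,l\}$, and $\langle\cdot\rangle_{\gamma}$ denotes the average with respect to $\gamma$ (the sum over the indices weighted by $\gamma$). All $\gamma$'s depend on $t$.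
   Formalization: The prefactor of φ_02 is corrected to −(s−1)(1−p_0), and in γ_02 the index i_1 is drawn once, so the factor (C^{(i_1)})^s/Z occurs once instead of squared; as printed the formula fails in general for p_0<1, s≠1. m_1,…,m_r are taken nonzero. *)

theory Defs
  imports "HOL-Probability.Probability"
begin

text \<open>
  The centred normal law with variance \<open>v \<ge> 0\<close>. Consecutive entries of the parameter vectors may
  coincide, so \<open>v = 0\<close> has to be covered as well (where \<^term>\<open>normal_density 0 0\<close> would be the
  zero function).
\<close>

definition centred_normal :: "real \<Rightarrow> real measure" where
  "centred_normal v = distr (density lborel std_normal_density) borel (\<lambda>z. sqrt v * z)"

lemma centred_normal_pos:
  assumes "v > 0"
  shows "centred_normal v = density lborel (normal_density 0 (sqrt v))"
proof -
  interpret prob_space "density lborel std_normal_density"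
    by (rule prob_space_normal_density) simp
  have "distributed (density lborel std_normal_density) lborel (\<lambda>z. z) (normal_density 0 1)"
    by (auto simp: distributed_def distr_id2 normal_density_nonneg)
  from normal_density_affine[OF this, of "sqrt v" 0] assms
  have "distributed (density lborel std_normal_density) lborel (\<lambda>z. sqrt v * z)
          (normal_density 0 (sqrt v))"
    by simp
  then show ?thesis
    unfolding centred_normal_def distributed_def by (metis distr_cong sets_lborel)
qed

lemma centred_normal_0: "centred_normal 0 = return borel 0"
proof -
  interpret prob_space "density lborel std_normal_density"
    by (rule prob_space_normal_density) simp
  show ?thesis
    by (simp add: centred_normal_def distr_const)
qed

definition normal_vec :: "real \<Rightarrow> (real^'d) measure" where
  "normal_vec v = distr (\<Pi>\<^sub>M i\<in>UNIV. centred_normal v) borel (\<lambda>f. \<chi> i. f i)"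

definition normal_mat :: "real \<Rightarrow> (real^'n^'m) measure" where
  "normal_mat v = distr (\<Pi>\<^sub>M ij\<in>UNIV. centred_normal v) borel (\<lambda>f. \<chi> i j. f (i, j))"

text \<open>
  A random quantity is a function of a realisation of \<open>G\<close> and of the family \<open>U\<close>, where
  \<open>U k = (u\<^sup>4, u\<^sup>2, h)\<close> is the realisation of the \<open>k\<close>-th block \<open>\<U>\<^sub>k\<close>.
\<close>

type_synonym ('n, 'm) block = "real \<times> (real^'m) \<times> (real^'n)"
type_synonym ('n, 'm) rv = "real^'n^'m \<Rightarrow> (nat \<Rightarrow> ('n, 'm) block) \<Rightarrow> real"

locale lifted =
  fixes r l :: nat
    and x :: "nat \<Rightarrow> real^'n" and y :: "nat \<Rightarrow> real^'m"
    and p q m :: "nat \<Rightarrow> real"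
    and \<beta> s :: real
begin

definition block_law :: "nat \<Rightarrow> ('n, 'm) block measure" where
  "block_law k =
     centred_normal (p (k - 1) * q (k - 1) - p k * q k)
     \<Otimes>\<^sub>M (normal_vec (p (k - 1) - p k) \<Otimes>\<^sub>M normal_vec (q (k - 1) - q k))"

text \<open>
  The partial expectation over the \<open>k\<close>-th block integrates that block out and leaves a function
  of \<open>G\<close> and of the remaining blocks.
\<close>

definition EU :: "nat \<Rightarrow> ('n, 'm) rv \<Rightarrow> ('n, 'm) rv" where
  "EU k f = (\<lambda>G U. \<integral>u. f G (U(k := u)) \<partial>block_law k)"

text \<open>
  The outermost expectation, over \<open>G\<close> and the last block. It is only applied to quantities in which
  the blocks \<open>1, \<dots>, r\<close> have been integrated out, so the values \<open>0\<close> filled in for them are irrelevant.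
\<close>

definition E_outer :: "('n, 'm) rv \<Rightarrow> real" where
  "E_outer f = (\<integral>(G, u). f G ((\<lambda>_. 0)(Suc r := u)) \<partial>(normal_mat 1 \<Otimes>\<^sub>M block_law (Suc r)))"

definition D0 :: "real \<Rightarrow> nat \<Rightarrow> nat \<Rightarrow> ('n, 'm) rv" where
  "D0 t i1 i2 = (\<lambda>G U.
     sqrt t * (y i2 \<bullet> (G *v x i1))
     + sqrt (1 - t) * norm (x i1) * (y i2 \<bullet> (\<Sum>k=1..r+1. fst (snd (U k))))
     + sqrt t * norm (x i1) * norm (y i2) * (\<Sum>k=1..r+1. fst (U k))
     + sqrt (1 - t) * norm (y i2) * ((\<Sum>k=1..r+1. snd (snd (U k))) \<bullet> x i1))"

definition A :: "real \<Rightarrow> nat \<Rightarrow> nat \<Rightarrow> ('n, 'm) rv" where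
  "A t i1 i2 = (\<lambda>G U. exp (\<beta> * D0 t i1 i2 G U))"

definition C :: "real \<Rightarrow> nat \<Rightarrow> ('n, 'm) rv" where
  "C t i1 = (\<lambda>G U. \<Sum>i2=1..l. A t i1 i2 G U)"

definition Z :: "real \<Rightarrow> ('n, 'm) rv" where
  "Z t = (\<lambda>G U. \<Sum>i1=1..l. C t i1 G U powr s)"

primrec \<zeta> :: "real \<Rightarrow> nat \<Rightarrow> ('n, 'm) rv" where
  "\<zeta> t 0 = Z t"
| "\<zeta> t (Suc k) = EU (Suc k) (\<lambda>G U. \<zeta> t k G U powr (m (Suc k) / m k))"

definition \<Phi> :: "real \<Rightarrow> nat \<Rightarrow> ('n, 'm) rv \<Rightarrow> ('n, 'm) rv" where
  "\<Phi> t k f = EU k (\<lambda>G U. \<zeta> t (k - 1) G U powr (m k / m (k - 1)) / \<zeta> t k G U * f G U)"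

text \<open>\<open>\<Phi>\<^sub>b \<cdots> \<Phi>\<^sub>a\<close>, with \<open>\<Phi>\<^sub>a\<close> applied first; the identity if \<open>b < a\<close>.\<close>

definition \<Phi>_prod :: "real \<Rightarrow> nat \<Rightarrow> nat \<Rightarrow> ('n, 'm) rv \<Rightarrow> ('n, 'm) rv" where
  "\<Phi>_prod t b a f = fold (\<Phi> t) [a..<Suc b] f"

definition \<gamma>0 :: "real \<Rightarrow> nat \<Rightarrow> nat \<Rightarrow> ('n, 'm) rv" where
  "\<gamma>0 t i1 i2 = (\<lambda>G U. C t i1 G U powr s / Z t G U * (A t i1 i2 G U / C t i1 G U))"

definition \<gamma>01 :: "real \<Rightarrow> nat \<Rightarrow> nat \<Rightarrow> ('n, 'm) rv" where
  "\<gamma>01 t i1 i2 = \<Phi>_prod t r 1 (\<gamma>0 t i1 i2)"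

text \<open>
  In \<open>\<gamma>\<^sub>0(i\<^sub>1,i\<^sub>2) \<times> \<gamma>\<^sub>0(i\<^sub>1,p\<^sub>2)\<close> the index \<open>i\<^sub>1\<close> is shared: it is drawn once, and \<open>i\<^sub>2\<close>, \<open>p\<^sub>2\<close> are
  drawn independently given \<open>i\<^sub>1\<close>. The factor \<open>C(i\<^sub>1)\<^sup>s / Z\<close> therefore occurs once, and the weights
  sum to 1. (The pointwise product of the two weights, with this factor squared, does not give a
  probability and would make the derivative formula false when \<open>p\<^sub>0 < 1\<close>.)
\<close>

definition \<gamma>02 :: "real \<Rightarrow> nat \<Rightarrow> nat \<Rightarrow> nat \<Rightarrow> ('n, 'm) rv" where
  "\<gamma>02 t i1 i2 p2 = \<Phi>_prod t r 1 (\<lambda>G U.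
     C t i1 G U powr s / Z t G U * (A t i1 i2 G U / C t i1 G U) * (A t i1 p2 G U / C t i1 G U))"

text \<open>Indexed from 1: \<open>\<gamma> t (k\<^sub>1 + 1)\<close> is \<open>\<gamma>\<close> with subscript \<open>k\<^sub>1 + 1\<close>, for \<open>0 \<le> k\<^sub>1 \<le> r\<close>.\<close>

definition \<gamma> :: "real \<Rightarrow> nat \<Rightarrow> nat \<Rightarrow> nat \<Rightarrow> nat \<Rightarrow> nat \<Rightarrow> ('n, 'm) rv" where
  "\<gamma> t k i1 i2 p1 p2 = \<Phi>_prod t r k (\<lambda>G U.
     \<Phi>_prod t (k - 1) 1 (\<gamma>0 t i1 i2) G U * \<Phi>_prod t (k - 1) 1 (\<gamma>0 t p1 p2) G U)"

definition \<psi> :: "real \<Rightarrow> real" where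
  "\<psi> t = E_outer (\<lambda>G U.
     1 / (\<beta> * \<bar>s\<bar> * sqrt (real CARD('n)) * m r) * ln (\<zeta> t r G U))"

definition \<phi> :: "real \<Rightarrow> nat \<Rightarrow> real" where
  "\<phi> t k = - s * (m (k - 1) - m k) * E_outer (\<lambda>G U.
     \<Sum>i1=1..l. \<Sum>i2=1..l. \<Sum>p1=1..l. \<Sum>p2=1..l. \<gamma> t k i1 i2 p1 p2 G U *
       ((p (k - 1) * norm (x i1) * norm (x p1) - x p1 \<bullet> x i1)
        * (q (k - 1) * norm (y i2) * norm (y p2) - y p2 \<bullet> y i2)))"

definition \<phi>01 :: "real \<Rightarrow> real" where
  "\<phi>01 t = (1 - p 0) * (1 - q 0) * E_outer (\<lambda>G U.
     \<Sum>i1=1..l. \<Sum>i2=1..l. \<gamma>01 t i1 i2 G U * ((norm (x i1))\<^sup>2 * (norm (y i2))\<^sup>2))"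

text \<open>
  The sign of \<open>\<phi>\<^sub>0\<^sub>2\<close>: for two equal \<open>x\<close>-indices the first factor of the summand in \<open>\<phi>\<^sub>1\<close> is
  \<open>(p\<^sub>0 - 1) \<parallel>x\<^sub>i\<parallel>\<^sup>2 = - (1 - p\<^sub>0) \<parallel>x\<^sub>i\<parallel>\<^sup>2\<close>. With \<open>+ (s - 1)\<close> the derivative formula fails in general for
  \<open>p\<^sub>0 < 1\<close>; for \<open>p\<^sub>0 = 1\<close> the term vanishes.
\<close>

definition \<phi>02 :: "real \<Rightarrow> real" where
  "\<phi>02 t = - (s - 1) * (1 - p 0) * E_outer (\<lambda>G U.
     \<Sum>i1=1..l. \<Sum>i2=1..l. \<Sum>p2=1..l. \<gamma>02 t i1 i2 p2 G U *
       ((norm (x i1))\<^sup>2 * (q 0 * norm (y i2) * norm (y p2) - y p2 \<bullet> y i2)))"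

end

end

theory Submission
  imports Defs "HOL-Real_Asymp.Real_Asymp"
begin

text \<open>
  Every block enters \<open>D\<^sub>0\<close> through a linear functional of \<open>w = T\<^sub>t(G, \<Sum>\<^sub>k U\<^sub>k)\<close>, where \<open>T\<^sub>t\<close> scales the
  coordinates of \<open>G\<close> and \<open>u\<^sup>4\<close> by \<open>sqrt t\<close> and those of \<open>u\<^sup>2\<close> and \<open>h\<close> by \<open>sqrt (1 - t)\<close>. Integrating out
  one block is a Gaussian average of a function \<open>f(t, w)\<close>, and by Gaussian integration by parts this
  average adds \<open>1/2 \<Sum>\<^sub>b \<plusminus>c\<^sub>b \<partial>\<^sub>b\<partial>\<^sub>b f\<close> to the \<open>t\<close>-derivative, with the sign \<open>+\<close> or \<open>-\<close> according to the
  scaling of the coordinate \<open>b\<close> and \<open>c\<^sub>b\<close> its variance. For \<open>L\<^sub>k = ln \<zeta>\<^sub>k / m\<^sub>k\<close> one step reads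
  \<open>L\<^sub>k = ln E exp (m\<^sub>k L\<^sub>k\<^sub>-\<^sub>1) / m\<^sub>k\<close>; it sends \<open>\<partial>\<^sub>b L\<close> to \<open>\<Phi>\<^sub>k \<partial>\<^sub>b L\<close>, and \<open>Q\<^sub>k = \<partial>\<^sub>b\<partial>\<^sub>b L\<^sub>k + m\<^sub>k (\<partial>\<^sub>b L\<^sub>k)\<^sup>2\<close>
  satisfies \<open>Q\<^sub>k = \<Phi>\<^sub>k (Q\<^sub>k\<^sub>-\<^sub>1 - (m\<^sub>k\<^sub>-\<^sub>1 - m\<^sub>k) (\<partial>\<^sub>b L\<^sub>k\<^sub>-\<^sub>1)\<^sup>2)\<close>. The signed variances of step \<open>k\<close> telescope,
  \<open>\<plusminus>c\<^sub>b = V\<^sub>k\<^sub>-\<^sub>1(b) - V\<^sub>k(b)\<close>, so that \<open>S\<^sub>k = \<partial>\<^sub>t L\<^sub>k + 1/2 \<Sum>\<^sub>b V\<^sub>k(b) Q\<^sub>k(b)\<close> obeys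
  \<open>S\<^sub>k = \<Phi>\<^sub>k (S\<^sub>k\<^sub>-\<^sub>1 - 1/2 (m\<^sub>k\<^sub>-\<^sub>1 - m\<^sub>k) \<Sum>\<^sub>b V\<^sub>k\<^sub>-\<^sub>1(b) (\<partial>\<^sub>b L\<^sub>k\<^sub>-\<^sub>1)\<^sup>2)\<close>. Unfolding this recursion gives one \<open>\<phi>\<close> per
  step, and \<open>\<phi>\<^sub>0\<^sub>1\<close>, \<open>\<phi>\<^sub>0\<^sub>2\<close> come from \<open>S\<^sub>0\<close>. The endpoints \<open>t = 0, 1\<close>, where the square roots are not
  differentiable, follow from the continuity of the resulting derivative.
\<close>

subsection \<open>Gaussian integration by parts\<close>

text \<open>One constant \<open>K\<close> serves both as factor and as rate;
  \<open>exp_boundedI\<close> admits two different ones.\<close>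

definition exp_bounded :: "('a::real_normed_vector \<Rightarrow> real) \<Rightarrow> bool" where
  "exp_bounded g \<longleftrightarrow> (\<exists>K. \<forall>u. \<bar>g u\<bar> \<le> K * exp (K * norm u))"

text \<open>The test pairs for integration by parts along \<open>b\<close>: \<open>g'\<close> is the
  derivative of \<open>g\<close> in the single direction \<open>b\<close>, and continuity and growth
  give integrability against every law considered below.\<close>

definition deriv_pair ::
    "'a::euclidean_space \<Rightarrow> ('a \<Rightarrow> real) \<Rightarrow> ('a \<Rightarrow> real) \<Rightarrow> bool" where
  "deriv_pair b g g' \<longleftrightarrow> continuous_on UNIV g \<and> continuous_on UNIV g' \<and> exp_bounded g \<and> exp_bounded g' \<and>
     (\<forall>u. ((\<lambda>h. g (u + h *\<^sub>R b)) has_real_derivative g' u) (at 0))"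

text \<open>
  A centred Gaussian law with independent coordinates of variances \<open>c b\<close> enters only through its
  exponential moments and the integration by parts formula; in this form \<open>c b = 0\<close> needs no separate case.
\<close>

definition gaussian :: "'a::euclidean_space measure \<Rightarrow> ('a \<Rightarrow> real) \<Rightarrow> bool" where
  "gaussian \<mu> c \<longleftrightarrow> prob_space \<mu> \<and> sets \<mu> = sets borel \<and> (\<forall>K. integrable \<mu> (\<lambda>u. exp (K * norm u))) \<and>
     (\<forall>b\<in>Basis. \<forall>g g'. deriv_pair b g g' \<longrightarrow> (\<integral>u. (u \<bullet> b) * g u \<partial>\<mu>) = c b * (\<integral>u. g' u \<partial>\<mu>))"

lemma exp_boundedE:
  assumes "exp_bounded g"
  obtains K where "K > 0" "\<And>u. \<bar>g u\<bar> \<le> K * exp (K * norm u)"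
proof -
  from assms obtain K where K: "\<And>u. \<bar>g u\<bar> \<le> K * exp (K * norm u)" by (auto simp: exp_bounded_def)
  have "\<bar>g u\<bar> \<le> (\<bar>K\<bar>+1) * exp ((\<bar>K\<bar>+1) * norm u)" for u
    by (rule order_trans[OF K]) (intro mult_mono, auto intro!: mult_right_mono)
  then show thesis by (intro that[of "\<bar>K\<bar>+1"]) auto
qed

lemma exp_boundedI:
  fixes g :: "'a::real_normed_vector \<Rightarrow> real"
  assumes "\<And>u. \<bar>g u\<bar> \<le> A * exp (B * norm u)"
  shows "exp_bounded g"
  unfolding exp_bounded_def
proof (intro exI allI)
  fix u :: 'a
  have "A * exp (B * norm u) \<le> max \<bar>A\<bar> \<bar>B\<bar> * exp (max \<bar>A\<bar> \<bar>B\<bar> * norm u)"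
    by (intro mult_mono) (auto intro!: mult_right_mono)
  then show "\<bar>g u\<bar> \<le> max \<bar>A\<bar> \<bar>B\<bar> * exp (max \<bar>A\<bar> \<bar>B\<bar> * norm u)" using assms[of u] by linarith
qed

lemma deriv_pair_shift:
  assumes "deriv_pair b g g'"
  shows "((\<lambda>h. g (u + h *\<^sub>R b)) has_real_derivative g' (u + h0 *\<^sub>R b)) (at h0)"
proof -
  have "((\<lambda>h. g ((u + h0 *\<^sub>R b) + h *\<^sub>R b)) has_real_derivative g' (u + h0 *\<^sub>R b)) (at 0)"
    using assms by (auto simp: deriv_pair_def)
  then have "((\<lambda>h. g (u + (h + h0) *\<^sub>R b)) has_real_derivative g' (u + h0 *\<^sub>R b)) (at 0)"
    by (simp add: algebra_simps)
  then show ?thesis using DERIV_shift[of "\<lambda>h. g (u + h *\<^sub>R b)" _ 0 h0] by (simp add: algebra_simps)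
qed

lemma exp_abs_le: "exp (K * \<bar>z::real\<bar>) \<le> exp (K * z) + exp ((-K) * z)"
  by (cases "z \<ge> 0") (auto)

text \<open>Completing the square turns the density times \<open>exp (K * z)\<close> into
  \<open>exp (K\<^sup>2/2)\<close> times the normal density of mean \<open>K\<close>. The absolute
  value is split into the cases \<open>K\<close> and \<open>-K\<close>.\<close>

lemma integrable_exp_std_normal:
  "integrable lborel (\<lambda>z. std_normal_density z * exp (K * \<bar>z\<bar>))"
proof -
  have e: "std_normal_density z * exp (K * z) = exp (K\<^sup>2/2) * normal_density K 1 z" for K z
    by (simp add: normal_density_def exp_add[symmetric] mult_exp_exp power2_eq_square field_simps)
  have "integrable lborel (\<lambda>z. std_normal_density z * exp (K * z))" for K
    unfolding e by (intro integrable_mult_right) simp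
  from Bochner_Integration.integrable_add[OF this[of K] this[of "-K"]]
  show ?thesis
    by (rule Bochner_Integration.integrable_bound)
       (auto simp: abs_mult distrib_left[symmetric] intro!: AE_I2 mult_left_mono order_trans[OF exp_abs_le[of K]])
qed

lemma tendsto_exp_std_normal:
  assumes "K > 0"
  shows "((\<lambda>z. K * exp (K * \<bar>z\<bar>) * std_normal_density z) \<longlongrightarrow> 0) at_top"
  "((\<lambda>z. K * exp (K * \<bar>z\<bar>) * std_normal_density z) \<longlongrightarrow> 0) at_bot"
proof -
  have "((\<lambda>z. K * exp (K * z) * (1 / sqrt (2 * pi) * exp (- (z - 0)\<^sup>2 / 2))) \<longlongrightarrow> 0) at_top"
    using assms by real_asymp
  moreover have "\<forall>\<^sub>F z in at_top. K * exp (K * z) * (1 / sqrt (2 * pi) * exp (- (z - 0)\<^sup>2 / 2)) = K * exp (K * \<bar>z\<bar>) * std_normal_density z"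
    using eventually_ge_at_top[of 0] by eventually_elim (simp add: normal_density_def)
  ultimately show "((\<lambda>z. K * exp (K * \<bar>z\<bar>) * std_normal_density z) \<longlongrightarrow> 0) at_top"
    by (rule Lim_transform_eventually)
  \<comment> \<open>The function is even, so reflection carries the limit at plus infinity to minus
    infinity.\<close>
  then show "((\<lambda>z. K * exp (K * \<bar>z\<bar>) * std_normal_density z) \<longlongrightarrow> 0) at_bot"
    unfolding at_bot_mirror filterlim_filtermap by (simp add: normal_density_def)
qed

text \<open>Stein's identity. The standard density solves \<phi>' = - z \<phi>, so g \<phi> has
  derivative \<phi> g' - z g \<phi>; the integral of this over the line is the difference of the
  limits of g \<phi> at the two ends, and both vanish because g grows at most exponentially.\<close>

lemma gaussian_std_normal: "gaussian (density lborel std_normal_density) (\<lambda>_. 1)"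
  unfolding gaussian_def
proof (intro conjI allI ballI impI)
  show "prob_space (density lborel std_normal_density)" by (rule prob_space_normal_density) simp
  show "integrable (density lborel std_normal_density) (\<lambda>u. exp (K * norm u))" for K
    using integrable_exp_std_normal[of K]
    by (subst integrable_density) (auto intro!: normal_density_nonneg)
  fix b :: real and g g' assume b: "b \<in> Basis" and dp: "deriv_pair b g g'"
  then have b1: "b = 1" by simp
  have cont: "continuous_on UNIV g" "continuous_on UNIV g'" using dp by (auto simp: deriv_pair_def)
  then have [measurable]: "g \<in> borel_measurable borel" "g' \<in> borel_measurable borel"
    by (auto intro: borel_measurable_continuous_onI)
  have D: "(g has_real_derivative g' z) (at z)" for z
    using deriv_pair_shift[OF dp, of 0 z] by (simp add: b1)
  obtain K where K: "K > 0" "\<And>u. \<bar>g u\<bar> \<le> K * exp (K * norm u)"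
    using dp by (auto simp: deriv_pair_def elim: exp_boundedE)
  obtain K' where K': "K' > 0" "\<And>u. \<bar>g' u\<bar> \<le> K' * exp (K' * norm u)"
    using dp by (auto simp: deriv_pair_def elim: exp_boundedE)
  let ?\<phi> = std_normal_density
  have i1: "integrable lborel (\<lambda>z. ?\<phi> z * g' z)"
    by (rule Bochner_Integration.integrable_bound[OF integrable_mult_right[OF integrable_exp_std_normal[of K'], of K']])
       (use K' in \<open>auto simp: abs_mult mult.left_commute[of K'] intro!: AE_I2 mult_left_mono\<close>)
  have i2: "integrable lborel (\<lambda>z. ?\<phi> z * (z * g z))"
  proof (rule Bochner_Integration.integrable_bound[OF integrable_mult_right[OF integrable_exp_std_normal[of "K+1"], of K]])
    have "\<bar>z * g z\<bar> \<le> K * exp ((K+1) * \<bar>z\<bar>)" for z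
    proof -
      have "\<bar>z\<bar> \<le> exp \<bar>z\<bar>" using exp_ge_add_one_self[of "\<bar>z\<bar>"] by linarith
      then have "\<bar>z * g z\<bar> \<le> exp \<bar>z\<bar> * (K * exp (K * norm z))"
        unfolding abs_mult by (intro mult_mono K) auto
      then show ?thesis by (simp add: exp_add[symmetric] distrib_right mult_exp_exp algebra_simps)
    qed
    then show "AE z in lborel. norm (?\<phi> z * (z * g z)) \<le> norm (K * (?\<phi> z * exp ((K+1) * \<bar>z\<bar>)))"
      using K(1) by (auto simp: abs_mult mult.left_commute[of K] mult.left_commute[of "\<bar>_\<bar>" "std_normal_density _"]
          simp del: mult.left_commute intro!: AE_I2 mult_left_mono)
  qed measurable
  define F where "F = (\<lambda>z. g z * ?\<phi> z)"
  define c where "c = 1 / sqrt (2 * pi)"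
  have \<phi>_eq: "?\<phi> = (\<lambda>z. c * exp (- (z\<^sup>2) / 2))"
    by (auto simp: normal_density_def c_def)
  have D\<phi>: "(?\<phi> has_real_derivative - z * ?\<phi> z) (at z)" for z
    unfolding \<phi>_eq by (auto intro!: derivative_eq_intros)
  have DF: "(F has_real_derivative ?\<phi> z * g' z - ?\<phi> z * (z * g z)) (at z)" for z
    unfolding F_def by (rule derivative_eq_intros D D\<phi> | simp add: algebra_simps)+
  have cphi: "continuous_on UNIV ?\<phi>"
    unfolding normal_density_def by (intro continuous_intros) auto
  have lim: "(F \<longlongrightarrow> 0) at_top" "(F \<longlongrightarrow> 0) at_bot"
    by (rule Lim_null_comparison[OF _ tendsto_exp_std_normal(1)[OF K(1)]] Lim_null_comparison[OF _ tendsto_exp_std_normal(2)[OF K(1)]],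
        use K in \<open>auto simp: F_def abs_mult intro!: always_eventually mult_right_mono\<close>)+
  have "(LBINT z=-\<infinity>..\<infinity>. ?\<phi> z * g' z - ?\<phi> z * (z * g z)) = 0 - 0"
  proof (rule interval_integral_FTC_integrable[where F=F])
    show "(F has_vector_derivative ?\<phi> z * g' z - ?\<phi> z * (z * g z)) (at z)" for z
      using DF by (simp add: has_real_derivative_iff_has_vector_derivative)
    show "isCont (\<lambda>z. ?\<phi> z * g' z - ?\<phi> z * (z * g z)) z" for z
      using cont cphi by (intro continuous_intros) (auto simp: continuous_on_eq_continuous_at)
    show "set_integrable lborel (einterval (- \<infinity>) \<infinity>) (\<lambda>z. ?\<phi> z * g' z - ?\<phi> z * (z * g z))"
      using i1 i2 by (auto simp: set_integrable_def einterval_eq_UNIV)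
    show "((F \<circ> real_of_ereal) \<longlongrightarrow> 0) (at_right (- \<infinity>))" "((F \<circ> real_of_ereal) \<longlongrightarrow> 0) (at_left \<infinity>)"
      using lim by (simp_all add: ereal_tendsto_simps)
  qed simp
  then have "(\<integral>z. ?\<phi> z * g' z - ?\<phi> z * (z * g z) \<partial>lborel) = 0"
    by (simp add: interval_lebesgue_integral_def einterval_eq_UNIV set_lebesgue_integral_def)
  then have "(\<integral>z. ?\<phi> z * g' z \<partial>lborel) = (\<integral>z. ?\<phi> z * (z * g z) \<partial>lborel)"
    using i1 i2 by simp
  then show "(\<integral>u. (u \<bullet> b) * g u \<partial>density lborel ?\<phi>) = 1 * (\<integral>u. g' u \<partial>density lborel ?\<phi>)"
    by (simp add: b1 integral_real_density)
qed simp

section \<open>Scaled, product and degenerate Gaussian laws\<close>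

lemma gaussian_centred_normal:
  assumes "v \<ge> 0"
  shows "gaussian (centred_normal v) (\<lambda>_. v)"
  unfolding gaussian_def centred_normal_def
proof (intro conjI allI ballI impI)
  let ?N = "density lborel std_normal_density"
  have N: "gaussian ?N (\<lambda>_. 1)" by (rule gaussian_std_normal)
  interpret prob_space ?N using N by (simp add: gaussian_def)
  show "prob_space (distr ?N borel (\<lambda>z. sqrt v * z))" by (rule prob_space_distr) simp
  show "integrable (distr ?N borel (\<lambda>z. sqrt v * z)) (\<lambda>u. exp (K * norm u))" for K
  proof -
    have "integrable ?N (\<lambda>u. exp ((K * sqrt v) * norm u))" using N by (simp add: gaussian_def)
    then show ?thesis using assms by (subst integrable_distr_eq) (auto simp: abs_mult mult.assoc)
  qed
  fix b :: real and g g' assume b: "b \<in> Basis" and dp: "deriv_pair b g g'"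
  then have b1: "b = 1" by simp
  have cont: "continuous_on UNIV g" "continuous_on UNIV g'" using dp by (auto simp: deriv_pair_def)
  then have [measurable]: "g \<in> borel_measurable borel" "g' \<in> borel_measurable borel"
    by (auto intro: borel_measurable_continuous_onI)
  have D: "(g has_real_derivative g' z) (at z)" for z
    using deriv_pair_shift[OF dp, of 0 z] by (simp add: b1)
  obtain K where K: "K > 0" "\<And>u. \<bar>g u\<bar> \<le> K * exp (K * norm u)"
    using dp by (auto simp: deriv_pair_def elim: exp_boundedE)
  obtain K' where K': "K' > 0" "\<And>u. \<bar>g' u\<bar> \<le> K' * exp (K' * norm u)"
    using dp by (auto simp: deriv_pair_def elim: exp_boundedE)
  \<comment> \<open>Stein's identity is applied to the rescaled function. One \<open>sqrt v\<close>
    comes from the variable in front, the other from the chain rule; for \<open>v = 0\<close> both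
    sides are 0.\<close>
  have "deriv_pair b (\<lambda>z. sqrt v * g (sqrt v * z)) (\<lambda>z. v * g' (sqrt v * z))"
    unfolding deriv_pair_def
  proof (intro conjI allI)
    show "continuous_on UNIV (\<lambda>z. sqrt v * g (sqrt v * z))"
      by (intro continuous_intros continuous_on_compose2[OF cont(1)]) auto
    show "continuous_on UNIV (\<lambda>z. v * g' (sqrt v * z))"
      by (intro continuous_intros continuous_on_compose2[OF cont(2)]) auto
    show "exp_bounded (\<lambda>z. sqrt v * g (sqrt v * z))"
    proof (rule exp_boundedI[where A="sqrt v * K" and B="K * sqrt v"])
      fix z
      show "\<bar>sqrt v * g (sqrt v * z)\<bar> \<le> sqrt v * K * exp (K * sqrt v * norm z)"
        using mult_left_mono[OF K(2)[of "sqrt v * z"], of "sqrt v"] assms by (simp add: abs_mult mult.assoc)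
    qed
    show "exp_bounded (\<lambda>z. v * g' (sqrt v * z))"
    proof (rule exp_boundedI[where A="v * K'" and B="K' * sqrt v"])
      fix z
      show "\<bar>v * g' (sqrt v * z)\<bar> \<le> v * K' * exp (K' * sqrt v * norm z)"
        using mult_left_mono[OF K'(2)[of "sqrt v * z"], of "v"] assms by (simp add: abs_mult mult.assoc)
    qed
    fix u
    show "((\<lambda>h. sqrt v * g (sqrt v * (u + h *\<^sub>R b))) has_real_derivative v * g' (sqrt v * u)) (at 0)"
      using assms
      by (auto intro!: derivative_eq_intros DERIV_chain2[OF D] simp: b1 algebra_simps)
  qed
  with N b have "(\<integral>u. (u \<bullet> b) * (sqrt v * g (sqrt v * u)) \<partial>?N) = 1 * (\<integral>z. v * g' (sqrt v * z) \<partial>?N)"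
    unfolding gaussian_def by blast
  then show "(\<integral>u. (u \<bullet> b) * g u \<partial>distr ?N borel (\<lambda>z. sqrt v * z)) = v * (\<integral>u. g' u \<partial>distr ?N borel (\<lambda>z. sqrt v * z))"
    by (simp add: integral_distr b1 algebra_simps)
qed simp

lemma sets_centred_normal [simp, measurable_cong]: "sets (centred_normal v) = sets borel"
  by (simp add: centred_normal_def)

lemma prob_space_centred_normal: "prob_space (centred_normal v)"
  unfolding centred_normal_def
  by (intro prob_space.prob_space_distr prob_space_normal_density) simp_all

lemma exp_bounded_integrable:
  assumes "sets \<mu> = sets borel" "\<And>K. integrable \<mu> (\<lambda>u. exp (K * norm u))" "exp_bounded g"
    and "g \<in> borel_measurable borel"
  shows "integrable \<mu> g"
proof -
  obtain K where K: "K > 0" "\<And>u. \<bar>g u\<bar> \<le> K * exp (K * norm u)" using exp_boundedE[OF assms(3)] by blast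
  have [measurable]: "g \<in> borel_measurable \<mu>"
    using assms(4) measurable_cong_sets[OF assms(1) refl] by auto
  show ?thesis
    by (rule Bochner_Integration.integrable_bound[OF integrable_mult_right[OF assms(2)[of K], of K]])
       (use K in \<open>auto intro!: AE_I2\<close>)
qed

lemma gaussian_integrable:
  assumes "gaussian \<mu> c" "continuous_on UNIV g" "exp_bounded g"
  shows "integrable \<mu> g"
proof (rule exp_bounded_integrable)
  show "sets \<mu> = sets borel" using assms(1) by (simp add: gaussian_def)
  show "integrable \<mu> (\<lambda>u. exp (K * norm u))" for K using assms(1) unfolding gaussian_def by blast
qed (use assms in \<open>auto intro: borel_measurable_continuous_onI\<close>)

lemma gaussian_ibp:
  assumes "gaussian \<mu> c" "b \<in> Basis" "deriv_pair b g g'"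
  shows "(\<integral>u. (u \<bullet> b) * g u \<partial>\<mu>) = c b * (\<integral>u. g' u \<partial>\<mu>)"
  using assms by (auto simp: gaussian_def)

lemma exp_bounded_inner_mult:
  assumes "exp_bounded g" "b \<in> Basis"
  shows "exp_bounded (\<lambda>u. (u \<bullet> b) * g u)"
proof -
  obtain K where K: "K > 0" "\<And>u. \<bar>g u\<bar> \<le> K * exp (K * norm u)" using exp_boundedE[OF assms(1)] by blast
  have "\<bar>(u \<bullet> b) * g u\<bar> \<le> K * exp ((K+1) * norm u)" for u
  proof -
    have "\<bar>u \<bullet> b\<bar> \<le> norm u" by (rule Basis_le_norm[OF assms(2)])
    also have "\<dots> \<le> exp (norm u)" using exp_ge_add_one_self[of "norm u"] by linarith
    finally have "\<bar>u \<bullet> b\<bar> \<le> exp (norm u)" .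
    then have "\<bar>(u \<bullet> b) * g u\<bar> \<le> exp (norm u) * (K * exp (K * norm u))"
      unfolding abs_mult by (intro mult_mono K) auto
    then show ?thesis by (simp add: exp_add[symmetric] distrib_right mult_exp_exp algebra_simps)
  qed
  then show ?thesis by (rule exp_boundedI)
qed

lemma exp_bounded_affine:
  assumes "exp_bounded g" "\<And>u. norm (h u) \<le> norm u + C"
  shows "exp_bounded (\<lambda>u. g (h u))"
proof -
  obtain K where K: "K > 0" "\<And>u. \<bar>g u\<bar> \<le> K * exp (K * norm u)" using exp_boundedE[OF assms(1)] by blast
  have "\<bar>g (h u)\<bar> \<le> (K * exp (K * C)) * exp (K * norm u)" for u
  proof -
    have "K * exp (K * norm (h u)) \<le> K * exp (K * (norm u + C))"
      using K(1) assms(2)[of u] by auto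
    also have "\<dots> = (K * exp (K * C)) * exp (K * norm u)"
      by (simp only: distrib_left exp_add ac_simps)
    finally show ?thesis using K(2)[of "h u"] by linarith
  qed
  then show ?thesis by (rule exp_boundedI)
qed

text \<open>Serves to freeze coordinates: \<open>h\<close> embeds one factor into the whole space at
  a fixed value of the others, which shifts the norm by at most a constant.\<close>

lemma deriv_pair_affine:
  fixes g :: "'b::euclidean_space \<Rightarrow> real" and h :: "'a::euclidean_space \<Rightarrow> 'b"
  assumes "deriv_pair b g g'" "\<And>u. norm (h u) \<le> norm u + C" "continuous_on UNIV h"
    and "\<And>u t. h (u + t *\<^sub>R b') = h u + t *\<^sub>R b"
  shows "deriv_pair b' (\<lambda>u. g (h u)) (\<lambda>u. g' (h u))"
proof -
  have g: "continuous_on UNIV g" "continuous_on UNIV g'" "exp_bounded g" "exp_bounded g'"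
    "\<And>u. ((\<lambda>h. g (u + h *\<^sub>R b)) has_real_derivative g' u) (at 0)"
    using assms(1) by (auto simp: deriv_pair_def)
  show ?thesis
    unfolding deriv_pair_def
  proof (intro conjI allI)
    show "continuous_on UNIV (\<lambda>u. g (h u))" "continuous_on UNIV (\<lambda>u. g' (h u))"
      using g by (auto intro: continuous_on_compose2[OF _ assms(3)])
    show "exp_bounded (\<lambda>u. g (h u))" "exp_bounded (\<lambda>u. g' (h u))"
      using g assms(2) by (metis exp_bounded_affine)+
    show "((\<lambda>t. g (h (u + t *\<^sub>R b'))) has_real_derivative g' (h u)) (at 0)" for u
      using g(5)[of "h u"] by (simp add: assms(4))
  qed
qed

text \<open>A basis vector of the product lies in one factor, and the test \<open>b = 0\<close>
  tells which. By Fubini the other factor is frozen and the formula of the factor at hand is applied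
  inside. Exponential moments exist because the norm of a pair is at most the sum of the
  norms.\<close>

lemma gaussian_pair:
  fixes \<mu> :: "'a::euclidean_space measure" and \<nu> :: "'b::euclidean_space measure"
  assumes \<mu>: "gaussian \<mu> c" and \<nu>: "gaussian \<nu> d"
  shows "gaussian (\<mu> \<Otimes>\<^sub>M \<nu>) (\<lambda>(a, b). if b = 0 then c a else d b)"
proof -
  have sets[measurable_cong]: "sets \<mu> = sets borel" "sets \<nu> = sets borel" using assms by (auto simp: gaussian_def)
  interpret M: prob_space \<mu> using \<mu> by (simp add: gaussian_def)
  interpret N: prob_space \<nu> using \<nu> by (simp add: gaussian_def)
  interpret P: pair_sigma_finite \<mu> \<nu> ..
  interpret Phi_chain: pair_prob_space \<mu> \<nu> ..
  have sP: "sets (\<mu> \<Otimes>\<^sub>M \<nu>) = sets borel"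
    using sets_pair_measure_cong[OF sets] by (simp only: borel_prod)
  have e: "integrable (\<mu> \<Otimes>\<^sub>M \<nu>) (\<lambda>u. exp (K * norm u))" for K
  proof -
    have i: "integrable (\<mu> \<Otimes>\<^sub>M \<nu>) (\<lambda>u. exp (\<bar>K\<bar> * norm (fst u)) * exp (\<bar>K\<bar> * norm (snd u)))"
      using \<mu> \<nu> by (intro P.Fubini_integrable) (auto simp: gaussian_def)
    show ?thesis
    proof (rule Bochner_Integration.integrable_bound[OF i])
      have "K * norm u \<le> \<bar>K\<bar> * norm (fst u) + \<bar>K\<bar> * norm (snd u)" for u :: "'a \<times> 'b"
      proof -
        have "K * norm u \<le> \<bar>K\<bar> * norm u" by (intro mult_right_mono) auto
        also have "\<dots> \<le> \<bar>K\<bar> * (norm (fst u) + norm (snd u))"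
          by (intro mult_left_mono) (metis norm_Pair_le prod.collapse, simp)
        finally show ?thesis by (simp add: distrib_left)
      qed
      then show "AE u in \<mu> \<Otimes>\<^sub>M \<nu>. norm (exp (K * norm u)) \<le> norm (exp (\<bar>K\<bar> * norm (fst u)) * exp (\<bar>K\<bar> * norm (snd u)))"
        by (intro AE_I2) (simp add: exp_add[symmetric])
    next
      have "(\<lambda>u::'a \<times> 'b. exp (K * norm u)) \<in> borel_measurable borel" by measurable
      then show "(\<lambda>u. exp (K * norm u)) \<in> borel_measurable (\<mu> \<Otimes>\<^sub>M \<nu>)"
        using measurable_cong_sets[OF sP refl] by blast
    qed
  qed
  have ibp: "(\<integral>u. (u \<bullet> b) * g u \<partial>(\<mu> \<Otimes>\<^sub>M \<nu>)) = (case b of (a, b) \<Rightarrow> if b = 0 then c a else d b) * (\<integral>u. g' u \<partial>(\<mu> \<Otimes>\<^sub>M \<nu>))"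
    if b: "b \<in> Basis" and dp: "deriv_pair b g g'" for b g g'
  proof -
    have m: "g \<in> borel_measurable borel" "g' \<in> borel_measurable borel"
      using dp by (auto simp: deriv_pair_def intro: borel_measurable_continuous_onI)
    have i1: "integrable (\<mu> \<Otimes>\<^sub>M \<nu>) (\<lambda>u. (u \<bullet> b) * g u)"
      using dp b m by (intro exp_bounded_integrable[OF sP e] exp_bounded_inner_mult) (auto simp: deriv_pair_def)
    have i2: "integrable (\<mu> \<Otimes>\<^sub>M \<nu>) g'"
      using dp b m by (intro exp_bounded_integrable[OF sP e]) (auto simp: deriv_pair_def)
    have fub: "(\<integral>u. F u \<partial>(\<mu> \<Otimes>\<^sub>M \<nu>)) = (\<integral>y. (\<integral>x. F (x, y) \<partial>\<mu>) \<partial>\<nu>)"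
      "(\<integral>u. F u \<partial>(\<mu> \<Otimes>\<^sub>M \<nu>)) = (\<integral>x. (\<integral>y. F (x, y) \<partial>\<nu>) \<partial>\<mu>)"
      if "integrable (\<mu> \<Otimes>\<^sub>M \<nu>) F" for F :: "_ \<Rightarrow> real"
      using that P.integral_snd[of "\<lambda>x y. F (x, y)"] P.integral_fst[of "\<lambda>x y. F (x, y)"] by simp_all
    have n: "norm (x, y) \<le> norm x + norm y" for x :: 'a and y :: 'b by (rule norm_Pair_le)
    from b consider a where "b = (a, 0)" "a \<in> Basis" | a where "b = (0, a)" "a \<in> Basis" "a \<noteq> 0"
      using nonzero_Basis by (fastforce simp: Basis_prod_def)
    then show ?thesis
    proof cases
      case 1
      have "deriv_pair a (\<lambda>x. g (x, y)) (\<lambda>x. g' (x, y))" for y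
        by (rule deriv_pair_affine[OF dp, where C="norm y"]) (auto intro!: n continuous_intros simp: 1)
      then have *: "(\<integral>x. (x \<bullet> a) * g (x, y) \<partial>\<mu>) = c a * (\<integral>x. g' (x, y) \<partial>\<mu>)" for y
        using \<mu> 1 by (auto simp: gaussian_def)
      have "(\<integral>u. (u \<bullet> b) * g u \<partial>(\<mu> \<Otimes>\<^sub>M \<nu>)) = (\<integral>y. (\<integral>x. (x \<bullet> a) * g (x, y) \<partial>\<mu>) \<partial>\<nu>)"
        using fub(1)[OF i1] by (simp add: 1)
      also have "\<dots> = c a * (\<integral>y. (\<integral>x. g' (x, y) \<partial>\<mu>) \<partial>\<nu>)" unfolding * by simp
      also have "\<dots> = c a * (\<integral>u. g' u \<partial>(\<mu> \<Otimes>\<^sub>M \<nu>))"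
        using fub(1)[OF i2] by simp
      finally show ?thesis by (simp add: 1)
    next
      case 2
      have "deriv_pair a (\<lambda>y. g (x, y)) (\<lambda>y. g' (x, y))" for x
        by (rule deriv_pair_affine[OF dp, where C="norm x"]) (auto intro!: order_trans[OF n] continuous_intros simp: 2)
      then have *: "(\<integral>y. (y \<bullet> a) * g (x, y) \<partial>\<nu>) = d a * (\<integral>y. g' (x, y) \<partial>\<nu>)" for x
        using \<nu> 2 by (auto simp: gaussian_def)
      have "(\<integral>u. (u \<bullet> b) * g u \<partial>(\<mu> \<Otimes>\<^sub>M \<nu>)) = (\<integral>x. (\<integral>y. (y \<bullet> a) * g (x, y) \<partial>\<nu>) \<partial>\<mu>)"
        using fub(2)[OF i1] by (simp add: 2)
      also have "\<dots> = d a * (\<integral>x. (\<integral>y. g' (x, y) \<partial>\<nu>) \<partial>\<mu>)" unfolding * by simp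
      also have "\<dots> = d a * (\<integral>u. g' u \<partial>(\<mu> \<Otimes>\<^sub>M \<nu>))"
        using fub(2)[OF i2] by simp
      finally show ?thesis using 2 by simp
    qed
  qed
  show ?thesis
    unfolding gaussian_def using e ibp Phi_chain.prob_space_axioms sP by blast
qed

text \<open>The enumeration \<open>e\<close> of the basis turns independent scalar coordinates into
  a random vector; vectors and matrices are both instances. For the direction \<open>e i\<close> the
  coordinate \<open>i\<close> is integrated innermost, with the other coordinates collected in a
  fixed vector.\<close>

lemma gaussian_PiM:
  fixes e :: "'i::finite \<Rightarrow> 'a::euclidean_space"
  assumes e: "bij_betw e UNIV Basis" and v: "v \<ge> 0"
  shows "gaussian (distr (\<Pi>\<^sub>M i\<in>UNIV. centred_normal v) borel (\<lambda>f. \<Sum>i\<in>UNIV. f i *\<^sub>R e i)) (\<lambda>_. v)"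
proof -
  let ?P = "\<lambda>I. (\<Pi>\<^sub>M i\<in>I. centred_normal v) :: ('i \<Rightarrow> real) measure"
  let ?S = "\<lambda>f. \<Sum>i\<in>UNIV. f i *\<^sub>R e i"
  have nv: "gaussian (centred_normal v) (\<lambda>_. v)" by (rule gaussian_centred_normal[OF v])
  interpret N: prob_space "centred_normal v" by (rule prob_space_centred_normal)
  interpret product_prob_space "\<lambda>i::'i. centred_normal v" UNIV ..
  interpret P: prob_space "?P UNIV" by (rule prob_space_PiM) (rule prob_space_centred_normal)
  have eB: "e i \<in> Basis" for i using e by (auto simp: bij_betw_def)
  have inn: "e i \<bullet> e j = (if i = j then 1 else 0)" for i j
    using e inner_Basis[OF eB eB, of i j] by (metis bij_betw_imp_inj_on injD)
  have Sm[measurable]: "?S \<in> ?P UNIV \<rightarrow>\<^sub>M borel" by measurable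
  have nS: "norm (?S f) \<le> (\<Sum>i\<in>UNIV. \<bar>f i\<bar>)" for f
    by (rule order_trans[OF norm_sum]) (simp add: norm_Basis[OF eB])
  have ex: "integrable (distr (?P UNIV) borel ?S) (\<lambda>u. exp (K * norm u))" for K
  proof -
    have i: "integrable (?P UNIV) (\<lambda>f. \<Prod>i\<in>UNIV. exp (\<bar>K\<bar> * norm (f i)))"
      using nv by (intro product_integrable_prod) (auto simp: gaussian_def)
    have "integrable (?P UNIV) (\<lambda>f. exp (K * norm (?S f)))"
    proof (rule Bochner_Integration.integrable_bound[OF i])
      have "K * norm (?S f) \<le> (\<Sum>i\<in>UNIV. \<bar>K\<bar> * norm (f i))" for f
      proof -
        have "K * norm (?S f) \<le> \<bar>K\<bar> * norm (?S f)" by (intro mult_right_mono) auto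
        also have "\<dots> \<le> \<bar>K\<bar> * (\<Sum>i\<in>UNIV. \<bar>f i\<bar>)" by (intro mult_left_mono nS) auto
        finally show ?thesis by (simp add: sum_distrib_left)
      qed
      then show "AE f in ?P UNIV. norm (exp (K * norm (?S f))) \<le> norm (\<Prod>i\<in>UNIV. exp (\<bar>K\<bar> * norm (f i)))"
        by (intro AE_I2) (simp add: exp_sum[symmetric])
    qed simp
    then show ?thesis by (subst integrable_distr_eq) auto
  qed
  have ibp: "(\<integral>u. (u \<bullet> b) * g u \<partial>distr (?P UNIV) borel ?S) = v * (\<integral>u. g' u \<partial>distr (?P UNIV) borel ?S)"
    if b: "b \<in> Basis" and dp: "deriv_pair b g g'" for b g g'
  proof -
    obtain i where i: "b = e i" using e b by (auto simp: bij_betw_def)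
    have m[measurable]: "g \<in> borel_measurable borel" "g' \<in> borel_measurable borel"
      using dp by (auto simp: deriv_pair_def intro: borel_measurable_continuous_onI)
    have i1: "integrable (distr (?P UNIV) borel ?S) (\<lambda>u. (u \<bullet> b) * g u)"
      by (rule exp_bounded_integrable[OF _ ex exp_bounded_inner_mult[OF _ b]])
         (use dp in \<open>simp_all add: deriv_pair_def\<close>)
    have i2: "integrable (distr (?P UNIV) borel ?S) g'"
      by (rule exp_bounded_integrable[OF _ ex])
         (use dp in \<open>simp_all add: deriv_pair_def\<close>)
    let ?w = "\<lambda>f. \<Sum>j\<in>UNIV-{i}. f j *\<^sub>R e j"
    have S: "?S (f(i := y)) = ?w f + y *\<^sub>R e i" for f y
    proof -
      have "?S (f(i := y)) = (f(i := y)) i *\<^sub>R e i + (\<Sum>j\<in>UNIV-{i}. (f(i := y)) j *\<^sub>R e j)"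
        by (rule sum.remove) auto
      also have "(\<Sum>j\<in>UNIV-{i}. (f(i := y)) j *\<^sub>R e j) = ?w f"
        by (rule sum.cong) auto
      finally show ?thesis by simp
    qed
    have Si: "?S f \<bullet> b = f i" for f
      by (simp add: inner_sum_left i inn if_distrib[of "\<lambda>x. _ * x"] cong: if_cong)
    have dp1: "deriv_pair 1 (\<lambda>y. g (w + y *\<^sub>R e i)) (\<lambda>y. g' (w + y *\<^sub>R e i))" for w
    proof (rule deriv_pair_affine[OF dp, where C="norm w"])
      show "norm (w + y *\<^sub>R e i) \<le> norm y + norm w" for y
        using norm_triangle_ineq[of w "y *\<^sub>R e i"] norm_Basis[OF eB[of i]] by simp
      show "continuous_on UNIV (\<lambda>y. w + y *\<^sub>R e i)" by (intro continuous_intros)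
      show "w + (u + t *\<^sub>R 1) *\<^sub>R e i = w + u *\<^sub>R e i + t *\<^sub>R b" for u t
        by (simp add: i scaleR_left_distrib)
    qed
    have *: "(\<integral>y. y * g (w + y *\<^sub>R e i) \<partial>centred_normal v) = v * (\<integral>y. g' (w + y *\<^sub>R e i) \<partial>centred_normal v)" for w
      using gaussian_ibp[OF nv _ dp1[of w]] by simp
    have U: "insert i (UNIV - {i}) = UNIV" by auto
    have j1: "integrable (?P (insert i (UNIV-{i}))) (\<lambda>f. (?S f \<bullet> b) * g (?S f))"
      unfolding U by (rule integrable_distr[OF Sm i1])
    have j2: "integrable (?P (insert i (UNIV-{i}))) (\<lambda>f. g' (?S f))"
      unfolding U by (rule integrable_distr[OF Sm i2])
    have "(\<integral>u. (u \<bullet> b) * g u \<partial>distr (?P UNIV) borel ?S) = (\<integral>f. (?S f \<bullet> b) * g (?S f) \<partial>?P (insert i (UNIV-{i})))"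
      unfolding U by (rule integral_distr[OF Sm]) measurable
    also have "\<dots> = (\<integral>f. (\<integral>y. (?S (f(i:=y)) \<bullet> b) * g (?S (f(i:=y))) \<partial>centred_normal v) \<partial>?P (UNIV-{i}))"
      by (rule product_integral_insert[OF _ _ j1]) auto
    also have "\<dots> = (\<integral>f. (\<integral>y. y * g (?w f + y *\<^sub>R e i) \<partial>centred_normal v) \<partial>?P (UNIV-{i}))"
      unfolding Si unfolding S by simp
    also have "\<dots> = v * (\<integral>f. (\<integral>y. g' (?w f + y *\<^sub>R e i) \<partial>centred_normal v) \<partial>?P (UNIV-{i}))"
      unfolding * by simp
    also have "\<dots> = v * (\<integral>f. (\<integral>y. g' (?S (f(i:=y))) \<partial>centred_normal v) \<partial>?P (UNIV-{i}))"
      unfolding S ..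
    also have "\<dots> = v * (\<integral>f. g' (?S f) \<partial>?P (insert i (UNIV-{i})))"
      by (subst product_integral_insert[OF _ _ j2]) auto
    also have "\<dots> = v * (\<integral>u. g' u \<partial>distr (?P UNIV) borel ?S)"
      unfolding U by (subst integral_distr[OF Sm]) auto
    finally show ?thesis .
  qed
  have "prob_space (distr (?P UNIV) borel ?S)" by (rule P.prob_space_distr) simp
  then show ?thesis unfolding gaussian_def using ex ibp by auto
qed

lemma gaussian_normal_vec:
  assumes "v \<ge> 0"
  shows "gaussian (normal_vec v :: (real^'d) measure) (\<lambda>_. v)"
proof -
  have e: "bij_betw (\<lambda>i. axis i (1::real)) (UNIV::'d set) Basis"
    by (auto simp: bij_betw_def inj_on_def axis_eq_axis Basis_vec_def)
  have "(\<lambda>f. \<chi> i. f i) = (\<lambda>f. \<Sum>i\<in>UNIV. f i *\<^sub>R axis i (1::real) :: real^'d)"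
    by (auto simp: fun_eq_iff vec_eq_iff axis_def if_distrib[of "\<lambda>x. _ * x"] cong: if_cong)
  then show ?thesis using gaussian_PiM[OF e assms] by (simp add: normal_vec_def)
qed

lemma gaussian_normal_mat:
  assumes "v \<ge> 0"
  shows "gaussian (normal_mat v :: (real^'n^'m) measure) (\<lambda>_. v)"
proof -
  have e: "bij_betw (\<lambda>(i, j). axis i (axis j (1::real))) (UNIV::('m \<times> 'n) set) Basis"
    by (auto simp: bij_betw_def inj_on_def axis_eq_axis Basis_vec_def image_def)
  have "(\<lambda>f. \<chi> i j. f (i, j)) = (\<lambda>f. \<Sum>ij\<in>UNIV. f ij *\<^sub>R (case ij of (i, j) \<Rightarrow> axis i (axis j (1::real))) :: real^'n^'m)"
  proof (intro ext, simp add: vec_eq_iff, intro allI)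
    fix f :: "'m \<times> 'n \<Rightarrow> real" and i j
    have "(\<Sum>ij\<in>UNIV. f ij * (case ij of (i', j') \<Rightarrow> axis i' (axis j' (1::real))) $ i $ j)
        = (\<Sum>ij\<in>UNIV. if ij = (i,j) then f ij else 0)"
      by (intro sum.cong) (auto simp: axis_def split: if_splits)
    then show "f (i, j) = (\<Sum>ij\<in>UNIV. f ij * (case ij of (i', j') \<Rightarrow> axis i' (axis j' (1::real))) $ i $ j)"
      by simp
  qed
  then show ?thesis using gaussian_PiM[OF e assms] by (simp add: normal_mat_def)
qed

text \<open>The point mass at 0 is a Gaussian law of variance 0. It lets the steps that keep G fixed
  be laws on the same space as the step that averages over G.\<close>

lemma gaussian_return_0: "gaussian (return borel 0) (\<lambda>_. 0)"
  unfolding gaussian_def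
proof (intro conjI allI ballI impI)
  show "integrable (return borel 0) (\<lambda>u::'a. exp (K * norm u))" for K
    by (simp add: integrable_iff_bounded nn_integral_return)
  fix b :: 'a and g g' assume "deriv_pair b g g'"
  then have "g \<in> borel_measurable borel"
    by (auto simp: deriv_pair_def intro: borel_measurable_continuous_onI)
  then show "(\<integral>u. (u \<bullet> b) * g u \<partial>return borel 0) = 0 * (\<integral>u. g' u \<partial>return borel 0)"
    by (subst integral_return) auto
qed (auto intro: prob_space_return)

subsection \<open>Functions of exponential growth and Gaussian averages\<close>

text \<open>Continuity is joint and includes the endpoints, and the bound is uniform in
  \<open>t\<close>. Gaussian averages therefore stay in the class, and derivatives found for
  \<open>0 < t < 1\<close> can be extended to \<open>t = 0, 1\<close>.\<close>

definition exp_growth :: "(real \<Rightarrow> 'a::euclidean_space \<Rightarrow> real) \<Rightarrow> bool" where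
  "exp_growth g \<longleftrightarrow> continuous_on ({0..1} \<times> UNIV) (\<lambda>(t, w). g t w) \<and>
     (\<exists>K. \<forall>t\<in>{0..1}. \<forall>w. \<bar>g t w\<bar> \<le> K * exp (K * norm w))"

lemma exp_growthI:
  fixes g :: "real \<Rightarrow> 'a::euclidean_space \<Rightarrow> real"
  assumes "continuous_on ({0..1} \<times> UNIV) (\<lambda>(t, w). g t w)"
    and "\<And>t w. t \<in> {0..1} \<Longrightarrow> \<bar>g t w\<bar> \<le> A * exp (B * norm w)"
  shows "exp_growth g"
  unfolding exp_growth_def
proof (intro exI allI ballI conjI)
  fix w :: 'a and t :: real assume "t \<in> {0..1}"
  have "A * exp (B * norm w) \<le> max \<bar>A\<bar> \<bar>B\<bar> * exp (max \<bar>A\<bar> \<bar>B\<bar> * norm w)"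
    by (intro mult_mono) (auto intro!: mult_right_mono)
  then show "\<bar>g t w\<bar> \<le> max \<bar>A\<bar> \<bar>B\<bar> * exp (max \<bar>A\<bar> \<bar>B\<bar> * norm w)" using assms(2)[OF \<open>t \<in> {0..1}\<close>, of w] by linarith
qed (rule assms)

lemma exp_growthE:
  assumes "exp_growth g"
  obtains K where "K > 0" "\<And>t w. t \<in> {0..1} \<Longrightarrow> \<bar>g t w\<bar> \<le> K * exp (K * norm w)"
proof -
  from assms obtain K where "\<forall>t\<in>{0..1}. \<forall>w. \<bar>g t w\<bar> \<le> K * exp (K * norm w)" by (auto simp: exp_growth_def)
  then have K: "\<And>t w. t \<in> {0..1} \<Longrightarrow> \<bar>g t w\<bar> \<le> K * exp (K * norm w)" by blast
  have "\<bar>g t w\<bar> \<le> (\<bar>K\<bar>+1) * exp ((\<bar>K\<bar>+1) * norm w)" if "t \<in> {0..1}" for t w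
    by (rule order_trans[OF K[OF that]]) (intro mult_mono, auto intro!: mult_right_mono)
  then show thesis by (intro that[of "\<bar>K\<bar>+1"]) auto
qed

lemma exp_growth_continuous: "exp_growth g \<Longrightarrow> continuous_on ({0..1} \<times> UNIV) (\<lambda>(t, w). g t w)"
  by (simp add: exp_growth_def)

lemma exp_growth_cong:
  assumes "exp_growth g" "\<And>t w. t \<in> {0..1} \<Longrightarrow> g t w = h t w"
  shows "exp_growth h"
proof -
  have "continuous_on ({0..1} \<times> UNIV) (\<lambda>(t, w). h t w)"
    using exp_growth_continuous[OF assms(1)] by (rule continuous_on_eq) (use assms(2) in auto)
  then show ?thesis using assms by (auto simp: exp_growth_def)
qed

lemma exp_growth_bounded:
  assumes "continuous_on ({0..1} \<times> UNIV) (\<lambda>(t, w). g t w)" "\<And>t w. t \<in> {0..1} \<Longrightarrow> \<bar>g t w\<bar> \<le> A"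
  shows "exp_growth g"
  by (rule exp_growthI[where A=A and B=0]) (use assms in auto)

lemma exp_growth_const: "exp_growth (\<lambda>t w. c)"
  by (rule exp_growth_bounded[where A="\<bar>c\<bar>"]) (auto intro: continuous_intros simp: case_prod_unfold)

lemma exp_growth_add:
  assumes "exp_growth f" "exp_growth g"
  shows "exp_growth (\<lambda>t w. f t w + g t w)"
proof -
  obtain K where K: "K > 0" "\<And>t w. t \<in> {0..1} \<Longrightarrow> \<bar>f t w\<bar> \<le> K * exp (K * norm w)" using exp_growthE[OF assms(1)] by blast
  obtain L where L: "L > 0" "\<And>t w. t \<in> {0..1} \<Longrightarrow> \<bar>g t w\<bar> \<le> L * exp (L * norm w)" using exp_growthE[OF assms(2)] by blast
  show ?thesis
  proof (rule exp_growthI[where A="K+L" and B="K+L"])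
    show "continuous_on ({0..1} \<times> UNIV) (\<lambda>(t, w). f t w + g t w)"
      using continuous_on_add[OF exp_growth_continuous[OF assms(1)] exp_growth_continuous[OF assms(2)]]
      by (simp add: case_prod_unfold)
    fix t :: real and w :: 'a assume t: "t \<in> {0..1}"
    have "K * exp (K * norm w) \<le> K * exp ((K+L) * norm w)" "L * exp (L * norm w) \<le> L * exp ((K+L) * norm w)"
      using K L by (auto intro!: mult_left_mono mult_right_mono)
    then show "\<bar>f t w + g t w\<bar> \<le> (K + L) * exp ((K + L) * norm w)"
      using K(2)[OF t, of w] L(2)[OF t, of w] unfolding distrib_right[of K L "exp _"] by linarith
  qed
qed

lemma exp_growth_mult:
  assumes "exp_growth f" "exp_growth g"
  shows "exp_growth (\<lambda>t w. f t w * g t w)"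
proof -
  obtain K where K: "K > 0" "\<And>t w. t \<in> {0..1} \<Longrightarrow> \<bar>f t w\<bar> \<le> K * exp (K * norm w)" using exp_growthE[OF assms(1)] by blast
  obtain L where L: "L > 0" "\<And>t w. t \<in> {0..1} \<Longrightarrow> \<bar>g t w\<bar> \<le> L * exp (L * norm w)" using exp_growthE[OF assms(2)] by blast
  show ?thesis
  proof (rule exp_growthI[where A="K*L" and B="K+L"])
    show "continuous_on ({0..1} \<times> UNIV) (\<lambda>(t, w). f t w * g t w)"
      using continuous_on_mult[OF exp_growth_continuous[OF assms(1)] exp_growth_continuous[OF assms(2)]]
      by (simp add: case_prod_unfold)
    fix t :: real and w :: 'a assume t: "t \<in> {0..1}"
    have "\<bar>f t w * g t w\<bar> \<le> (K * exp (K * norm w)) * (L * exp (L * norm w))"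
      unfolding abs_mult using K L t by (intro mult_mono) auto
    also have "\<dots> = K * L * exp ((K + L) * norm w)" by (simp add: distrib_right exp_add)
    finally show "\<bar>f t w * g t w\<bar> \<le> K * L * exp ((K + L) * norm w)" .
  qed
qed

lemma exp_growth_cmult: "exp_growth f \<Longrightarrow> exp_growth (\<lambda>t w. c * f t w)"
  by (rule exp_growth_mult[OF exp_growth_const])

lemma exp_growth_uminus: "exp_growth f \<Longrightarrow> exp_growth (\<lambda>t w. - f t w)"
  using exp_growth_cmult[of f "-1"] by simp

lemma exp_growth_diff: "exp_growth f \<Longrightarrow> exp_growth g \<Longrightarrow> exp_growth (\<lambda>t w. f t w - g t w)"
  using exp_growth_add[OF _ exp_growth_uminus, of f g] by simp

lemma exp_growth_power2: "exp_growth f \<Longrightarrow> exp_growth (\<lambda>t w. (f t w)\<^sup>2)"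
  using exp_growth_mult[of f f] by (simp add: power2_eq_square)

lemma exp_growth_abs:
  assumes "exp_growth f" shows "exp_growth (\<lambda>t w. \<bar>f t w\<bar>)"
proof -
  have "continuous_on ({0..1} \<times> UNIV) (\<lambda>(t, w). \<bar>f t w\<bar>)"
    using continuous_on_rabs[OF exp_growth_continuous[OF assms]] by (simp add: case_prod_unfold)
  then show ?thesis using assms by (simp add: exp_growth_def)
qed

lemma exp_growth_sum: "(\<And>i. i \<in> I \<Longrightarrow> exp_growth (f i)) \<Longrightarrow> exp_growth (\<lambda>t w. \<Sum>i\<in>I. f i t w)"
  by (induction I rule: infinite_finite_induct) (auto intro: exp_growth_const exp_growth_add)

lemmas exp_growth_intros = exp_growth_const exp_growth_add exp_growth_mult exp_growth_diff exp_growth_power2 exp_growth_sum exp_growth_uminus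

text \<open>The scaling map of the overview: directions in \<open>P\<close> carry
  \<open>sqrt t\<close>, all others \<open>sqrt (1 - t)\<close>.\<close>

definition interp :: "'a::euclidean_space set \<Rightarrow> real \<Rightarrow> 'a \<Rightarrow> 'a" where
  "interp P t u = (\<Sum>b\<in>Basis. ((if b \<in> P then sqrt t else sqrt (1 - t)) * (u \<bullet> b)) *\<^sub>R b)"

definition gauss_avg :: "'a::euclidean_space set \<Rightarrow> 'a measure \<Rightarrow> (real \<Rightarrow> 'a \<Rightarrow> real) \<Rightarrow> real \<Rightarrow> 'a \<Rightarrow> real" where
  "gauss_avg P \<mu> g t w = (\<integral>u. g t (w + interp P t u) \<partial>\<mu>)"

lemma interp_inner: "b \<in> Basis \<Longrightarrow> interp P t u \<bullet> b = (if b \<in> P then sqrt t else sqrt (1 - t)) * (u \<bullet> b)"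
  by (simp add: interp_def inner_sum_left_Basis)

lemma interp_add: "interp P t (u + v) = interp P t u + interp P t v"
  by (rule euclidean_eqI) (simp add: interp_inner inner_add_left distrib_left)

lemma interp_scaleR_Basis:
  "b \<in> Basis \<Longrightarrow> interp P t (h *\<^sub>R b) = (h * (if b \<in> P then sqrt t else sqrt (1 - t))) *\<^sub>R b"
  by (rule euclidean_eqI) (auto simp: interp_inner inner_Basis)

lemma norm_interp_le:
  assumes "t \<in> {0..1}" shows "norm (interp P t u) \<le> norm u"
  by (rule norm_le_componentwise)
     (use assms in \<open>auto simp: interp_inner abs_mult intro!: mult_left_le_one_le\<close>)

lemma continuous_interp: "continuous_on UNIV (\<lambda>(t, u). interp P t u)"
proof -
  have "continuous_on UNIV (\<lambda>x::real \<times> 'a. if b \<in> P then sqrt (fst x) else sqrt (1 - fst x))" for b :: 'a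
    by (cases "b \<in> P") (auto intro!: continuous_intros)
  then show ?thesis unfolding interp_def case_prod_unfold by (intro continuous_intros) auto
qed

lemma continuous_on_exp_growth_compose:
  assumes "exp_growth g" "continuous_on S p" "continuous_on S q" "\<And>x. x \<in> S \<Longrightarrow> p x \<in> {0..1}"
  shows "continuous_on S (\<lambda>x. g (p x) (q x))"
proof -
  have "(\<lambda>x. (p x, q x)) ` S \<subseteq> {0..1} \<times> UNIV" using assms(4) by blast
  from continuous_on_compose2[OF exp_growth_continuous[OF assms(1)] continuous_on_Pair[OF assms(2,3)] this]
  show ?thesis by simp
qed

lemma continuous_on_interp_compose:
  assumes "continuous_on S p" "continuous_on S q"
  shows "continuous_on S (\<lambda>x. interp P (p x) (q x))"
  using continuous_on_compose2[OF continuous_interp[of P] continuous_on_Pair[OF assms]] by auto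

lemma exp_growth_shift:
  assumes "exp_growth g" "t \<in> {0..1}"
  shows "continuous_on UNIV (\<lambda>u. g t (w + interp P t u))" "exp_bounded (\<lambda>u. g t (w + interp P t u))"
proof -
  show "continuous_on UNIV (\<lambda>u. g t (w + interp P t u))"
    using assms by (intro continuous_on_exp_growth_compose[OF assms(1)] continuous_intros continuous_on_interp_compose) auto
  have "exp_bounded (g t)" using assms unfolding exp_growth_def exp_bounded_def by blast
  then show "exp_bounded (\<lambda>u. g t (w + interp P t u))"
  proof (rule exp_bounded_affine[where C="norm w"])
    show "norm (w + interp P t u) \<le> norm u + norm w" for u
      using norm_triangle_ineq[of w "interp P t u"] norm_interp_le[OF assms(2), of P u] by linarith
  qed
qed

lemma gauss_avg_integrable:
  "gaussian \<mu> c \<Longrightarrow> exp_growth g \<Longrightarrow> t \<in> {0..1} \<Longrightarrow> integrable \<mu> (\<lambda>u. g t (w + interp P t u))"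
  by (intro gaussian_integrable exp_growth_shift)

lemma gaussian_exp_integrable: "gaussian \<mu> c \<Longrightarrow> integrable \<mu> (\<lambda>u. exp (K * norm u))"
  by (simp add: gaussian_def)

text \<open>An integrable majorant in \<open>u\<close> that depends neither on \<open>t\<close> nor
  on \<open>w\<close> within a ball; this is what every application of dominated convergence below
  uses.\<close>

lemma exp_growth_shift_bound:
  assumes "K > 0" "\<And>w. \<bar>g t w\<bar> \<le> K * exp (K * norm w)" "t \<in> {0..1}" "norm w \<le> B"
  shows "\<bar>g t (w + interp P t u)\<bar> \<le> K * exp (K * B) * exp (K * norm u)"
proof -
  have "norm (w + interp P t u) \<le> B + norm u"
    using norm_triangle_ineq[of w "interp P t u"] norm_interp_le[OF assms(3), of P u] assms(4) by linarith
  then have "K * exp (K * norm (w + interp P t u)) \<le> K * exp (K * (B + norm u))"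
    using assms(1) by auto
  then show ?thesis using assms(2)[of "w + interp P t u"] by (simp add: distrib_left exp_add mult.assoc)
qed

text \<open>Continuity is checked along sequences: a convergent sequence of points \<open>w\<close>
  stays in a ball, so dominated convergence applies. The growth bound is the same majorant
  integrated.\<close>

lemma exp_growth_gauss_avg:
  assumes \<mu>: "gaussian \<mu> c" and g: "exp_growth g"
  shows "exp_growth (gauss_avg P \<mu> g)"
proof -
  obtain K where K: "K > 0" "\<And>t w. t \<in> {0..1} \<Longrightarrow> \<bar>g t w\<bar> \<le> K * exp (K * norm w)" using exp_growthE[OF g] by blast
  have meas[measurable]: "(\<lambda>u. g t (w + interp P t u)) \<in> borel_measurable \<mu>" if "t \<in> {0..1}" for t w
    using gauss_avg_integrable[OF \<mu> g that] by auto
  show ?thesis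
  proof (rule exp_growthI)
    show "continuous_on ({0..1} \<times> UNIV) (\<lambda>(t, w). gauss_avg P \<mu> g t w)"
      unfolding continuous_on_sequentially
    proof (safe)
      fix X :: "nat \<Rightarrow> real \<times> 'a" and t :: real and w :: 'a
      assume t: "t \<in> {0..1}" and X: "\<forall>n. X n \<in> {0..1} \<times> UNIV" and lim: "X \<longlonglongrightarrow> (t, w)"
      have l1: "(\<lambda>n. fst (X n)) \<longlonglongrightarrow> t" and l2: "(\<lambda>n. snd (X n)) \<longlonglongrightarrow> w"
        using tendsto_fst[OF lim] tendsto_snd[OF lim] by auto
      have X1: "fst (X n) \<in> {0..1}" for n using X by (metis mem_Times_iff)
      obtain B where B: "\<And>n. norm (snd (X n)) \<le> B"
        using Bseq_def convergent_imp_Bseq[OF convergentI[OF l2]] by metis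
      have "(\<lambda>n. \<integral>u. g (fst (X n)) (snd (X n) + interp P (fst (X n)) u) \<partial>\<mu>) \<longlonglongrightarrow> (\<integral>u. g t (w + interp P t u) \<partial>\<mu>)"
      proof (rule integral_dominated_convergence[where w="\<lambda>u. K * exp (K * B) * exp (K * norm u)"])
        show "integrable \<mu> (\<lambda>u. K * exp (K * B) * exp (K * norm u))"
          using gaussian_exp_integrable[OF \<mu>] by simp
        show "AE u in \<mu>. (\<lambda>n. g (fst (X n)) (snd (X n) + interp P (fst (X n)) u)) \<longlonglongrightarrow> g t (w + interp P t u)"
        proof (rule AE_I2)
          fix u
          have "continuous_on ({0..1} \<times> UNIV) (\<lambda>x. g (fst x) (snd x + interp P (fst x) u))"
            by (intro continuous_on_exp_growth_compose[OF g] continuous_intros continuous_on_interp_compose) auto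
          from this[unfolded continuous_on_sequentially, rule_format, OF _ conjI, OF _ _ lim] X t
          show "(\<lambda>n. g (fst (X n)) (snd (X n) + interp P (fst (X n)) u)) \<longlonglongrightarrow> g t (w + interp P t u)"
            by (auto simp: o_def)
        qed
        show "AE u in \<mu>. norm (g (fst (X n)) (snd (X n) + interp P (fst (X n)) u)) \<le> K * exp (K * B) * exp (K * norm u)" for n
          using exp_growth_shift_bound[OF K(1), where g=g, OF K(2)[OF X1] X1 B] by (intro AE_I2) simp
      qed (use X1 t in auto)
      then show "((\<lambda>(t, w). gauss_avg P \<mu> g t w) \<circ> X) \<longlonglongrightarrow> gauss_avg P \<mu> g t w"
        by (simp add: gauss_avg_def o_def case_prod_unfold)
    qed
    fix t :: real and w :: 'a assume t: "t \<in> {0..1}"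
    have "\<bar>gauss_avg P \<mu> g t w\<bar> \<le> (\<integral>u. K * exp (K * norm w) * exp (K * norm u) \<partial>\<mu>)"
      unfolding gauss_avg_def
      using exp_growth_shift_bound[OF K(1), where g=g, OF K(2)[OF t] t order_refl]
      by (intro order_trans[OF integral_abs_bound] integral_mono integrable_abs gauss_avg_integrable[OF \<mu> g t])
         (use gaussian_exp_integrable[OF \<mu>] in auto)
    then show "\<bar>gauss_avg P \<mu> g t w\<bar> \<le> (K * (\<integral>u. exp (K * norm u) \<partial>\<mu>)) * exp (K * norm w)"
      by (simp add: mult.commute mult.left_commute)
  qed
qed

section \<open>Differentiation under the integral, at endpoints and along curves\<close>

lemma has_real_derivative_integral:
  fixes f :: "real \<Rightarrow> 'u \<Rightarrow> real"
  assumes x0: "x0 \<in> {a<..<b}"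
    and int: "\<And>x. x \<in> {a<..<b} \<Longrightarrow> integrable M (f x)"
    and der: "\<And>x u. x \<in> {a<..<b} \<Longrightarrow> ((\<lambda>x. f x u) has_real_derivative f' x u) (at x)"
    and bound: "\<And>x u. x \<in> {a<..<b} \<Longrightarrow> \<bar>f' x u\<bar> \<le> g u"
    and g: "integrable M g" and meas: "f' x0 \<in> borel_measurable M"
  shows "((\<lambda>x. \<integral>u. f x u \<partial>M) has_real_derivative (\<integral>u. f' x0 u \<partial>M)) (at x0)"
proof -
  have "((\<lambda>y. ((\<integral>u. f y u \<partial>M) - (\<integral>u. f x0 u \<partial>M)) / (y - x0)) \<longlongrightarrow> (\<integral>u. f' x0 u \<partial>M)) (at x0 within {a<..<b})"
    unfolding tendsto_at_iff_sequentially
  proof (safe)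
    fix X :: "nat \<Rightarrow> real" assume X: "\<forall>i. X i \<in> {a<..<b} - {x0}" and lim: "X \<longlonglongrightarrow> x0"
    have "(\<lambda>i. \<integral>u. (f (X i) u - f x0 u) / (X i - x0) \<partial>M) \<longlonglongrightarrow> (\<integral>u. f' x0 u \<partial>M)"
    proof (rule integral_dominated_convergence[where w=g])
      show "AE u in M. (\<lambda>i. (f (X i) u - f x0 u) / (X i - x0)) \<longlonglongrightarrow> f' x0 u"
      proof (rule AE_I2)
        fix u
        have "((\<lambda>y. (f y u - f x0 u) / (y - x0)) \<longlongrightarrow> f' x0 u) (at x0)"
          using der[OF x0, of u] by (simp add: has_field_derivative_iff)
        from this[unfolded tendsto_at_iff_sequentially, rule_format, of X] X lim
        show "(\<lambda>i. (f (X i) u - f x0 u) / (X i - x0)) \<longlonglongrightarrow> f' x0 u" by (auto simp: o_def)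
      qed
      show "AE u in M. norm ((f (X i) u - f x0 u) / (X i - x0)) \<le> g u" for i
      proof (rule AE_I2)
        fix u
        \<comment> \<open>The mean value inequality bounds the difference quotients by
          \<open>g\<close>, so dominated convergence applies to them.\<close>
        have "norm (f (X i) u - f x0 u) \<le> g u * norm (X i - x0)"
          by (rule field_differentiable_bound[where S="{a<..<b}" and f'="\<lambda>x. f' x u"])
             (use X x0 bound der in \<open>auto intro: has_field_derivative_at_within\<close>)
        then show "norm ((f (X i) u - f x0 u) / (X i - x0)) \<le> g u"
          using X by (simp add: field_simps norm_divide)
      qed
      show "(\<lambda>u. (f (X i) u - f x0 u) / (X i - x0)) \<in> borel_measurable M" for i
        using X x0 by (intro borel_measurable_divide borel_measurable_diff borel_measurable_integrable[OF int]) auto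
    qed (use g meas in auto)
    moreover have "(\<integral>u. (f (X i) u - f x0 u) / (X i - x0) \<partial>M) = ((\<integral>u. f (X i) u \<partial>M) - (\<integral>u. f x0 u \<partial>M)) / (X i - x0)" for i
      using Bochner_Integration.integral_diff[OF int int, of "X i" x0] X x0 by auto
    ultimately show "((\<lambda>y. ((\<integral>u. f y u \<partial>M) - (\<integral>u. f x0 u \<partial>M)) / (y - x0)) \<circ> X) \<longlonglongrightarrow> (\<integral>u. f' x0 u \<partial>M)"
      by (simp only: o_def)
  qed
  moreover have "at x0 within {a<..<b} = at x0" using x0 by (intro at_within_open) auto
  ultimately show ?thesis by (simp add: has_field_derivative_iff)
qed

text \<open>The fundamental theorem of calculus needs the derivative only in the interior, so
  \<open>F\<close> is a constant plus the integral of \<open>f\<close>. The integral of a continuous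
  function has the right one-sided derivative at the ends.\<close>

lemma has_real_derivative_at_endpoints:
  fixes F f :: "real \<Rightarrow> real"
  assumes F: "continuous_on {0..1} F" and f: "continuous_on {0..1} f"
    and D: "\<And>t. t \<in> {0<..<1} \<Longrightarrow> (F has_real_derivative f t) (at t)" and t: "t \<in> {0..1}"
  shows "(F has_real_derivative f t) (at t within {0..1})"
proof -
  have "(f has_integral F x - F 0) {0..x}" if "x \<in> {0..1}" for x
    using that by (intro fundamental_theorem_of_calculus_interior continuous_on_subset[OF F])
      (auto simp: has_real_derivative_iff_has_vector_derivative[symmetric] intro: D)
  then have eq: "integral {0..x} f + F 0 = F x" if "x \<in> {0..1}" for x
    using that by (force dest: integral_unique)
  have "((\<lambda>x. integral {0..x} f) has_real_derivative f t) (at t within {0..1})"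
    using integral_has_vector_derivative[OF f t] by (simp add: has_real_derivative_iff_has_vector_derivative)
  then have "((\<lambda>x. integral {0..x} f + F 0) has_real_derivative f t) (at t within {0..1})"
    by (auto intro!: derivative_eq_intros)
  then show ?thesis
    by (rule has_field_derivative_transform_within[where d=1]) (use t eq in auto)
qed

text \<open>A chain rule with weak premises: joint differentiability at a point follows from the
  derivative in \<open>t\<close> at that point and a derivative in \<open>h\<close> that is
  continuous there.\<close>

lemma has_real_derivative_diagonal:
  fixes \<phi> :: "real \<Rightarrow> real \<Rightarrow> real"
  assumes X: "open X" "t0 \<in> X"
    and D1: "((\<lambda>t. \<phi> t (\<alpha> t0)) has_real_derivative p) (at t0)"
    and D2: "\<And>t h. t \<in> X \<Longrightarrow> (\<phi> t has_real_derivative q t h) (at h)"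
    and cont: "isCont (\<lambda>(t, h). q t h) (t0, \<alpha> t0)"
    and D\<alpha>: "(\<alpha> has_real_derivative a') (at t0)"
  shows "((\<lambda>t. \<phi> t (\<alpha> t)) has_real_derivative p + a' * q t0 (\<alpha> t0)) (at t0)"
proof -
  have "((\<lambda>(t, h). \<phi> t h) has_derivative (\<lambda>(tx, ty). tx * p + blinfun_scaleR_left (q t0 (\<alpha> t0)) ty)) (at (t0, \<alpha> t0) within X \<times> UNIV)"
  proof (rule has_derivative_partialsI)
    show "((\<lambda>t. \<phi> t (\<alpha> t0)) has_derivative (\<lambda>tx. tx * p)) (at t0 within X)"
      using D1 by (auto simp: has_field_derivative_def mult.commute[of _ p] intro: has_derivative_at_withinI)
    show "(\<phi> t has_derivative blinfun_scaleR_left (q t h)) (at h within UNIV)" if "t \<in> X" for t h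
      using D2[OF that, of h]
      by (rule has_field_derivative_imp_has_derivative[THEN has_derivative_eq_rhs]) (simp add: fun_eq_iff mult.commute)
    show "continuous (at (t0, \<alpha> t0) within X \<times> UNIV) (\<lambda>(t, h). blinfun_scaleR_left (q t h) :: real \<Rightarrow>\<^sub>L real)"
      using bounded_linear.continuous[OF bounded_linear_blinfun_scaleR_left continuous_at_imp_continuous_at_within[OF cont]]
      by (simp add: case_prod_unfold)
  qed auto
  then have "((\<lambda>(t, h). \<phi> t h) has_derivative (\<lambda>(tx, ty). tx * p + ty * q t0 (\<alpha> t0))) (at (t0, \<alpha> t0))"
    using X at_within_open[of "(t0, \<alpha> t0)" "X \<times> UNIV"] by (simp add: open_Times)
  from has_derivative_compose[OF has_derivative_Pair[OF has_derivative_ident D\<alpha>[unfolded has_field_derivative_def]] this]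
  have "((\<lambda>t. \<phi> t (\<alpha> t)) has_derivative (\<lambda>x. x * p + a' * x * q t0 (\<alpha> t0))) (at t0)" by simp
  then show ?thesis
    unfolding has_field_derivative_def by (rule has_derivative_eq_rhs) (auto simp: fun_eq_iff algebra_simps)
qed

subsection \<open>The heat equation for Gaussian averages\<close>

text \<open>
  \<open>ft\<close> is the \<open>t\<close>-derivative of \<open>f\<close>, one-sided at \<open>t = 0, 1\<close>; \<open>f1 b\<close> and \<open>f2 b\<close> are its first two
  derivatives in the direction \<open>b\<close>. Mixed second derivatives are never needed.
\<close>

definition heat_class :: "(real \<Rightarrow> 'a::euclidean_space \<Rightarrow> real) \<Rightarrow> (real \<Rightarrow> 'a \<Rightarrow> real) \<Rightarrow>
    ('a \<Rightarrow> real \<Rightarrow> 'a \<Rightarrow> real) \<Rightarrow> ('a \<Rightarrow> real \<Rightarrow> 'a \<Rightarrow> real) \<Rightarrow> bool" where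
  "heat_class f ft f1 f2 \<longleftrightarrow> exp_growth f \<and> exp_growth ft \<and>
     (\<forall>t\<in>{0..1}. \<forall>w. ((\<lambda>t. f t w) has_real_derivative ft t w) (at t within {0..1})) \<and>
     (\<forall>b\<in>Basis. exp_growth (f1 b) \<and> exp_growth (f2 b) \<and> (\<forall>t\<in>{0..1}. \<forall>w.
        ((\<lambda>h. f t (w + h *\<^sub>R b)) has_real_derivative f1 b t w) (at 0) \<and>
        ((\<lambda>h. f1 b t (w + h *\<^sub>R b)) has_real_derivative f2 b t w) (at 0)))"

lemma heat_classD:
  assumes "heat_class f ft f1 f2"
  shows "exp_growth f" "exp_growth ft" "b \<in> Basis \<Longrightarrow> exp_growth (f1 b)" "b \<in> Basis \<Longrightarrow> exp_growth (f2 b)"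
    "t \<in> {0..1} \<Longrightarrow> ((\<lambda>t. f t w) has_real_derivative ft t w) (at t within {0..1})"
    "b \<in> Basis \<Longrightarrow> t \<in> {0..1} \<Longrightarrow> ((\<lambda>h. f t (w + h *\<^sub>R b)) has_real_derivative f1 b t w) (at 0)"
    "b \<in> Basis \<Longrightarrow> t \<in> {0..1} \<Longrightarrow> ((\<lambda>h. f1 b t (w + h *\<^sub>R b)) has_real_derivative f2 b t w) (at 0)"
  using assms unfolding heat_class_def by blast+

lemma directional_shift:
  fixes g :: "'a::real_vector \<Rightarrow> real"
  assumes "\<And>w. ((\<lambda>h. g (w + h *\<^sub>R b)) has_real_derivative g' w) (at 0)"
  shows "((\<lambda>h. g (w + h *\<^sub>R b)) has_real_derivative g' (w + h0 *\<^sub>R b)) (at h0)"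
proof -
  have "((\<lambda>h. g (w + (h + h0) *\<^sub>R b)) has_real_derivative g' (w + h0 *\<^sub>R b)) (at 0)"
    using assms[of "w + h0 *\<^sub>R b"] by (simp add: algebra_simps)
  then show ?thesis using DERIV_shift[of "\<lambda>h. g (w + h *\<^sub>R b)" _ 0 h0] by (simp add: algebra_simps)
qed

text \<open>The shift of \<open>w\<close> commutes with the average, so the derivative passes under
  the integral. For \<open>h\<close> between -1 and 1 the shifted points stay within
  \<open>norm w + norm b\<close>, which gives a common majorant.\<close>

lemma directional_gauss_avg:
  assumes \<mu>: "gaussian \<mu> c" and g: "exp_growth g" "exp_growth g'" and t: "t \<in> {0..1}"
    and D: "\<And>w. ((\<lambda>h. g t (w + h *\<^sub>R b)) has_real_derivative g' t w) (at 0)"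
  shows "((\<lambda>h. gauss_avg P \<mu> g t (w + h *\<^sub>R b)) has_real_derivative gauss_avg P \<mu> g' t w) (at 0)"
proof -
  obtain K where K: "K > 0" "\<And>t w. t \<in> {0..1} \<Longrightarrow> \<bar>g' t w\<bar> \<le> K * exp (K * norm w)" using exp_growthE[OF g(2)] by blast
  let ?B = "norm w + norm b"
  have "((\<lambda>h. \<integral>u. g t (w + h *\<^sub>R b + interp P t u) \<partial>\<mu>) has_real_derivative
      (\<integral>u. g' t (w + 0 *\<^sub>R b + interp P t u) \<partial>\<mu>)) (at 0)"
  proof (rule has_real_derivative_integral[where a="-1" and b=1 and g="\<lambda>u. K * exp (K * ?B) * exp (K * norm u)"])
    show "integrable \<mu> (\<lambda>u. g t (w + h *\<^sub>R b + interp P t u))" for h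
      by (rule gauss_avg_integrable[OF \<mu> g(1) t])
    show "((\<lambda>h. g t (w + h *\<^sub>R b + interp P t u)) has_real_derivative g' t (w + h *\<^sub>R b + interp P t u)) (at h)" for h u
      using directional_shift[of "g t" b "g' t" "w + interp P t u" h, OF D] by (simp add: algebra_simps)
    show "\<bar>g' t (w + h *\<^sub>R b + interp P t u)\<bar> \<le> K * exp (K * ?B) * exp (K * norm u)" if "h \<in> {-1<..<1}" for h u
    proof (rule exp_growth_shift_bound[OF K(1) _ t])
      show "\<bar>g' t w\<bar> \<le> K * exp (K * norm w)" for w by (rule K(2)[OF t])
      have "\<bar>h\<bar> * norm b \<le> norm b" using that by (intro mult_left_le_one_le) auto
      then show "norm (w + h *\<^sub>R b) \<le> ?B" using norm_triangle_ineq[of w "h *\<^sub>R b"] by simp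
    qed
    show "integrable \<mu> (\<lambda>u. K * exp (K * ?B) * exp (K * norm u))"
      using gaussian_exp_integrable[OF \<mu>] by simp
    show "(\<lambda>u. g' t (w + 0 *\<^sub>R b + interp P t u)) \<in> borel_measurable \<mu>"
      using gauss_avg_integrable[OF \<mu> g(2) t] by auto
  qed auto
  then show ?thesis by (simp add: gauss_avg_def)
qed

lemma heat_class_path_derivative:
  assumes f: "heat_class f ft f1 f2" and t0: "t0 \<in> {0<..<1}"
    and \<alpha>: "\<And>b. b \<in> Basis \<Longrightarrow> (\<alpha> b has_real_derivative \<alpha>' b) (at t0)"
    and B: "finite B" "B \<subseteq> Basis"
  shows "((\<lambda>t. f t (w + (\<Sum>b\<in>B. \<alpha> b t *\<^sub>R b))) has_real_derivative
      ft t0 (w + (\<Sum>b\<in>B. \<alpha> b t0 *\<^sub>R b)) + (\<Sum>b\<in>B. \<alpha>' b * f1 b t0 (w + (\<Sum>b\<in>B. \<alpha> b t0 *\<^sub>R b)))) (at t0)"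
  using B
proof (induction B arbitrary: w rule: finite_induct)
  case empty
  have "at t0 within {0..1} = at t0" using t0 by (intro at_within_interior) auto
  with heat_classD(5)[OF f, of t0 w] t0 show ?case by simp
next
  case (insert b B)
  define q where "q t = (\<Sum>b\<in>B. \<alpha> b t *\<^sub>R b)" for t
  have b: "b \<in> Basis" and B: "B \<subseteq> Basis" using insert by auto
  have "((\<lambda>t. f t (w + \<alpha> b t *\<^sub>R b + q t)) has_real_derivative
      (ft t0 (w + \<alpha> b t0 *\<^sub>R b + q t0) + (\<Sum>b'\<in>B. \<alpha>' b' * f1 b' t0 (w + \<alpha> b t0 *\<^sub>R b + q t0)))
      + \<alpha>' b * f1 b t0 (w + \<alpha> b t0 *\<^sub>R b + q t0)) (at t0)"
  proof (rule has_real_derivative_diagonal[where X="{0<..<1}" and \<phi>="\<lambda>t h. f t (w + h *\<^sub>R b + q t)"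
        and q="\<lambda>t h. f1 b t (w + h *\<^sub>R b + q t)"])
    show "((\<lambda>t. f t (w + \<alpha> b t0 *\<^sub>R b + q t)) has_real_derivative
      ft t0 (w + \<alpha> b t0 *\<^sub>R b + q t0) + (\<Sum>b'\<in>B. \<alpha>' b' * f1 b' t0 (w + \<alpha> b t0 *\<^sub>R b + q t0))) (at t0)"
      using insert.IH[OF B, of "w + \<alpha> b t0 *\<^sub>R b"] by (simp add: q_def)
    show "((\<lambda>h. f t (w + h *\<^sub>R b + q t)) has_real_derivative f1 b t (w + h *\<^sub>R b + q t)) (at h)"
      if "t \<in> {0<..<1}" for t h
      using directional_shift[of "f t" b "f1 b t" "w + q t" h] heat_classD(6)[OF f b] that by (simp add: algebra_simps)
    have "isCont (\<lambda>(t, w). f1 b t w) (t0, w + \<alpha> b t0 *\<^sub>R b + q t0)"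
      using exp_growth_continuous[OF heat_classD(3)[OF f b]] t0
      by (intro continuous_on_interior) (auto simp: interior_Times)
    moreover have "isCont (\<lambda>(t, h). (t, w + h *\<^sub>R b + q t)) (t0, \<alpha> b t0)"
    proof -
      have "isCont (\<alpha> b') t0" if "b' \<in> B" for b' using \<alpha> that B by (blast intro: DERIV_isCont)
      then have "isCont q t0" unfolding q_def by (intro continuous_intros) auto
      then have q: "isCont (\<lambda>x. q (fst x)) (t0, \<alpha> b t0)"
        using isCont_o2[where f=fst and a="(t0, \<alpha> b t0)" and g=q, OF continuous_fst[OF continuous_ident]] by simp
      show ?thesis unfolding case_prod_unfold
        by (intro continuous_Pair continuous_add continuous_scaleR continuous_fst continuous_snd continuous_ident continuous_const q)
    qed
    ultimately show "isCont (\<lambda>(t, h). f1 b t (w + h *\<^sub>R b + q t)) (t0, \<alpha> b t0)"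
      using isCont_o2[of "(t0, \<alpha> b t0)" "\<lambda>(t, h). (t, w + h *\<^sub>R b + q t)" "\<lambda>(t, w). f1 b t w"]
      by (simp add: case_prod_unfold)
  qed (use t0 \<alpha>[OF b] in auto)
  then show ?case using insert(1,2) by (simp add: q_def ac_simps)
qed

text \<open>Differentiating the scaling yields terms \<open>a' b t * (u \<bullet> b)\<close> times a
  first derivative of \<open>f\<close>. Integration by parts replaces the factor
  \<open>u \<bullet> b\<close> by \<open>c b\<close> and one more derivative, whose chain rule
  factor is \<open>a b t\<close>. The product \<open>a b t * a' b t\<close> is 1/2 or -1/2, so the
  singular square roots cancel.\<close>

lemma gaussian_derivative_interp:
  assumes f: "heat_class f ft f1 f2" and \<mu>: "gaussian \<mu> c" and t0: "t0 \<in> {0<..<1}"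
  shows "((\<lambda>t. gauss_avg P \<mu> f t w) has_real_derivative
     gauss_avg P \<mu> (\<lambda>t w. ft t w + (\<Sum>b\<in>Basis. (if b \<in> P then c b else - c b) / 2 * f2 b t w)) t0 w) (at t0)"
proof -
  define a where "a b t = (if b \<in> P then sqrt t else sqrt (1 - t))" for b t
  define a' where "a' b t = (if b \<in> P then 1 / (2 * sqrt t) else - (1 / (2 * sqrt (1 - t))))" for b t
  have Da: "(a b has_real_derivative a' b t) (at t)" if "t \<in> {0<..<1}" for b t
  proof (cases "b \<in> P")
    case True
    then show ?thesis unfolding a_def a'_def using that
      by (auto intro!: derivative_eq_intros simp: field_simps)
  next
    case False
    then show ?thesis unfolding a_def a'_def using that
      by (auto intro!: derivative_eq_intros simp: field_simps)
  qed
  have aa': "a b t * a' b t = (if b \<in> P then 1 else - 1) / 2" if "t \<in> {0<..<1}" for b t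
    using that by (simp add: a_def a'_def)
  have interp_eq: "interp P t u = (\<Sum>b\<in>Basis. (a b t * (u \<bullet> b)) *\<^sub>R b)" for t u
    by (simp add: interp_def a_def)
  have t01: "t0 \<in> {0..1}" using t0 by auto
  \<comment> \<open>An interval around \<open>t0\<close> away from 0 and 1, where the derivatives of
    the square roots blow up; \<open>M\<close> bounds them on it.\<close>
  define l where "l = t0 / 2" define r where "r = (1 + t0) / 2"
  have lr: "t0 \<in> {l<..<r}" "0 < l" "r < 1" and sub: "{l<..<r} \<subseteq> {0<..<1}" using t0 by (auto simp: l_def r_def)
  define M where "M = max (1 / (2 * sqrt l)) (1 / (2 * sqrt (1 - r)))"
  have M: "\<bar>a' b t\<bar> \<le> M" if "t \<in> {l<..<r}" for b t
  proof (cases "b \<in> P")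
    case True
    then have "\<bar>a' b t\<bar> \<le> 1 / (2 * sqrt l)" using that lr(2) by (auto simp: a'_def intro!: divide_left_mono)
    then show ?thesis by (simp add: M_def)
  next
    case False
    then have "\<bar>a' b t\<bar> \<le> 1 / (2 * sqrt (1 - r))" using that lr(3) by (auto simp: a'_def intro!: divide_left_mono)
    then show ?thesis by (simp add: M_def)
  qed
  have M0: "M \<ge> 0" using M[OF lr(1), of undefined] by linarith
  \<comment> \<open>A single constant \<open>K\<close> for the time derivative and all directional
    derivatives, taken from the sum of their absolute values.\<close>
  have "exp_growth (\<lambda>t w. \<bar>ft t w\<bar> + (\<Sum>b\<in>Basis. \<bar>f1 b t w\<bar>))"
    by (intro exp_growth_intros exp_growth_abs heat_classD[OF f])
  then obtain K where K: "K > 0" and K': "\<And>t w. t \<in> {0..1} \<Longrightarrow> \<bar>\<bar>ft t w\<bar> + (\<Sum>b\<in>Basis. \<bar>f1 b t w\<bar>)\<bar> \<le> K * exp (K * norm w)"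
    using exp_growthE by blast
  let ?W = "\<lambda>t u. w + interp P t u"
  let ?d = "\<lambda>t u. ft t (?W t u) + (\<Sum>b\<in>Basis. (a' b t * (u \<bullet> b)) * f1 b t (?W t u))"
  have dmeas: "integrable \<mu> (\<lambda>u. ft t0 (?W t0 u))" "\<And>b. b \<in> Basis \<Longrightarrow> integrable \<mu> (\<lambda>u. (a' b t0 * (u \<bullet> b)) * f1 b t0 (?W t0 u))"
  proof -
    show "integrable \<mu> (\<lambda>u. ft t0 (?W t0 u))" by (rule gauss_avg_integrable[OF \<mu> heat_classD(2)[OF f] t01])
    fix b :: 'a assume b: "b \<in> Basis"
    have "integrable \<mu> (\<lambda>u. (u \<bullet> b) * f1 b t0 (?W t0 u))"
      by (intro gaussian_integrable[OF \<mu>] exp_bounded_inner_mult continuous_intros exp_growth_shift heat_classD(3)[OF f] b t01)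
    then have "integrable \<mu> (\<lambda>u. a' b t0 * ((u \<bullet> b) * f1 b t0 (?W t0 u)))" by (rule integrable_mult_right)
    then show "integrable \<mu> (\<lambda>u. (a' b t0 * (u \<bullet> b)) * f1 b t0 (?W t0 u))" by (simp add: mult.assoc)
  qed
  have "((\<lambda>t. \<integral>u. f t (?W t u) \<partial>\<mu>) has_real_derivative (\<integral>u. ?d t0 u \<partial>\<mu>)) (at t0)"
  proof (rule has_real_derivative_integral[OF lr(1), where g="\<lambda>u. (1 + M) * (K * exp (K * norm w)) * exp ((K+1) * norm u)"])
    show "integrable \<mu> (\<lambda>u. f t (?W t u))" if "t \<in> {l<..<r}" for t
      by (rule gauss_avg_integrable[OF \<mu> heat_classD(1)[OF f]]) (use that sub in auto)
    show "((\<lambda>t. f t (?W t u)) has_real_derivative ?d t u) (at t)" if "t \<in> {l<..<r}" for t u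
      unfolding interp_eq
    proof (rule heat_class_path_derivative[OF f, where \<alpha>="\<lambda>b t. a b t * (u \<bullet> b)"])
      show "((\<lambda>t. a b t * (u \<bullet> b)) has_real_derivative a' b t * (u \<bullet> b)) (at t)" for b
        using Da[of t b] that sub by (auto intro!: derivative_eq_intros)
    qed (use that sub in auto)
    show "\<bar>?d t u\<bar> \<le> (1 + M) * (K * exp (K * norm w)) * exp ((K+1) * norm u)" if "t \<in> {l<..<r}" for t u
    proof -
      have t: "t \<in> {0..1}" using that sub by auto
      have e1: "1 \<le> exp (norm u)" "norm u \<le> exp (norm u)"
        using exp_ge_add_one_self[of "norm u"] norm_ge_zero[of u] by linarith+
      have "\<bar>?d t u\<bar> \<le> \<bar>ft t (?W t u)\<bar> + \<bar>\<Sum>b\<in>Basis. (a' b t * (u \<bullet> b)) * f1 b t (?W t u)\<bar>" by (rule abs_triangle_ineq)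
      also have "\<dots> \<le> \<bar>ft t (?W t u)\<bar> + (\<Sum>b\<in>Basis. (M * norm u) * \<bar>f1 b t (?W t u)\<bar>)"
        by (rule add_left_mono, rule order_trans[OF sum_abs])
           (auto intro!: sum_mono mult_mono M[OF that] Basis_le_norm M0 mult_nonneg_nonneg[OF M0 norm_ge_zero] simp: abs_mult)
      also have "\<dots> \<le> (1 + M * norm u) * (\<bar>ft t (?W t u)\<bar> + (\<Sum>b\<in>Basis. \<bar>f1 b t (?W t u)\<bar>))"
      proof -
        have "0 \<le> (\<Sum>b\<in>Basis. \<bar>f1 b t (?W t u)\<bar>)" "0 \<le> M * norm u * \<bar>ft t (?W t u)\<bar>"
          using M0 by (auto intro: sum_nonneg)
        then show ?thesis unfolding sum_distrib_left[symmetric] distrib_right distrib_left by simp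
      qed
      also have "\<dots> \<le> ((1 + M) * exp (norm u)) * (K * exp (K * norm w) * exp (K * norm u))"
      proof (rule mult_mono)
        show "1 + M * norm u \<le> (1 + M) * exp (norm u)"
          using e1(1) mult_left_mono[OF e1(2) M0] unfolding distrib_right mult_1 by linarith
        show "\<bar>ft t (?W t u)\<bar> + (\<Sum>b\<in>Basis. \<bar>f1 b t (?W t u)\<bar>) \<le> K * exp (K * norm w) * exp (K * norm u)"
          using exp_growth_shift_bound[where g="\<lambda>t w. \<bar>ft t w\<bar> + (\<Sum>b\<in>Basis. \<bar>f1 b t w\<bar>)", OF K K'[OF t] t order_refl, of w P u]
          by linarith
      qed (use M0 in \<open>auto intro!: add_nonneg_nonneg sum_nonneg\<close>)
      also have "\<dots> = (1 + M) * (K * exp (K * norm w)) * exp ((K+1) * norm u)"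
        by (simp add: distrib_right exp_add)
      finally show ?thesis .
    qed
    show "integrable \<mu> (\<lambda>u. (1 + M) * (K * exp (K * norm w)) * exp ((K+1) * norm u))"
      using gaussian_exp_integrable[OF \<mu>] by simp
    show "?d t0 \<in> borel_measurable \<mu>"
      using dmeas by (intro borel_measurable_add borel_measurable_sum borel_measurable_integrable) auto
  qed
  moreover have "(\<integral>u. ?d t0 u \<partial>\<mu>) = gauss_avg P \<mu> (\<lambda>t w. ft t w + (\<Sum>b\<in>Basis. (if b \<in> P then c b else - c b) / 2 * f2 b t w)) t0 w"
  proof -
    have ibp: "(\<integral>u. (a' b t0 * (u \<bullet> b)) * f1 b t0 (?W t0 u) \<partial>\<mu>) = (\<integral>u. (if b \<in> P then c b else - c b) / 2 * f2 b t0 (?W t0 u) \<partial>\<mu>)"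
      if b: "b \<in> Basis" for b
    proof -
      have i2: "exp_growth (\<lambda>t w. a b t0 * f2 b t w)" by (intro exp_growth_cmult heat_classD[OF f] b)
      have "deriv_pair b (\<lambda>u. f1 b t0 (?W t0 u)) (\<lambda>u. a b t0 * f2 b t0 (?W t0 u))"
        unfolding deriv_pair_def
      proof (intro conjI allI exp_growth_shift[OF heat_classD(3)[OF f b] t01] exp_growth_shift[OF i2 t01])
        fix u
        have "((\<lambda>h. f1 b t0 (?W t0 u + h *\<^sub>R b)) has_real_derivative f2 b t0 (?W t0 u)) (at (0 * a b t0))"
          using heat_classD(7)[OF f b t01] by simp
        then have "((\<lambda>h. f1 b t0 (?W t0 u + (h * a b t0) *\<^sub>R b)) has_real_derivative f2 b t0 (?W t0 u) * a b t0) (at 0)"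
          by (rule DERIV_chain2) (auto intro!: derivative_eq_intros)
        then show "((\<lambda>h. f1 b t0 (?W t0 (u + h *\<^sub>R b))) has_real_derivative a b t0 * f2 b t0 (?W t0 u)) (at 0)"
          by (simp add: interp_add interp_scaleR_Basis[OF b] a_def add.assoc mult.commute)
      qed
      from gaussian_ibp[OF \<mu> b this]
      have "a' b t0 * (\<integral>u. (u \<bullet> b) * f1 b t0 (?W t0 u) \<partial>\<mu>) = a' b t0 * (c b * (a b t0 * (\<integral>u. f2 b t0 (?W t0 u) \<partial>\<mu>)))"
        by simp
      also have "\<dots> = (a b t0 * a' b t0) * c b * (\<integral>u. f2 b t0 (?W t0 u) \<partial>\<mu>)" by simp
      finally show ?thesis unfolding aa'[OF t0] by (simp add: mult.assoc)
    qed
    have i2: "integrable \<mu> (\<lambda>u. (if b \<in> P then c b else - c b) / 2 * f2 b t0 (?W t0 u))" if "b \<in> Basis" for b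
      by (rule integrable_mult_right[OF gauss_avg_integrable[OF \<mu> heat_classD(4)[OF f that] t01]])
    have "(\<integral>u. ?d t0 u \<partial>\<mu>) = (\<integral>u. ft t0 (?W t0 u) \<partial>\<mu>) + (\<Sum>b\<in>Basis. \<integral>u. (a' b t0 * (u \<bullet> b)) * f1 b t0 (?W t0 u) \<partial>\<mu>)"
      using dmeas by (subst Bochner_Integration.integral_add) auto
    also have "\<dots> = (\<integral>u. ft t0 (?W t0 u) \<partial>\<mu>) + (\<Sum>b\<in>Basis. \<integral>u. (if b \<in> P then c b else - c b) / 2 * f2 b t0 (?W t0 u) \<partial>\<mu>)"
      by (simp only: ibp cong: sum.cong)
    also have "\<dots> = (\<integral>u. ft t0 (?W t0 u) + (\<Sum>b\<in>Basis. (if b \<in> P then c b else - c b) / 2 * f2 b t0 (?W t0 u)) \<partial>\<mu>)"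
      using dmeas(1) i2 by (subst Bochner_Integration.integral_add) auto
    finally show ?thesis by (simp add: gauss_avg_def)
  qed
  ultimately show ?thesis by (simp add: gauss_avg_def)
qed

text \<open>The class is stable under averaging: directional derivatives commute with the average,
  and the time derivative, known in the interior, extends to the endpoints by continuity.\<close>

lemma heat_class_gauss_avg:
  assumes \<mu>: "gaussian \<mu> c" and f: "heat_class f ft f1 f2"
  shows "heat_class (gauss_avg P \<mu> f)
     (gauss_avg P \<mu> (\<lambda>t w. ft t w + (\<Sum>b\<in>Basis. (if b \<in> P then c b else - c b) / 2 * f2 b t w)))
     (\<lambda>b. gauss_avg P \<mu> (f1 b)) (\<lambda>b. gauss_avg P \<mu> (f2 b))"
proof -
  have e: "exp_growth (gauss_avg P \<mu> f)"
    "exp_growth (gauss_avg P \<mu> (\<lambda>t w. ft t w + (\<Sum>b\<in>Basis. (if b \<in> P then c b else - c b) / 2 * f2 b t w)))"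
    (is "exp_growth ?F")
    by (intro exp_growth_gauss_avg[OF \<mu>] exp_growth_intros heat_classD[OF f] | assumption)+
  have slice: "continuous_on {0..1} (\<lambda>t. g t w)" if "exp_growth g" for g and w :: 'a
    by (rule continuous_on_exp_growth_compose[OF that]) (auto intro: continuous_intros)
  have "((\<lambda>t. gauss_avg P \<mu> f t w) has_real_derivative ?F t w) (at t within {0..1})" if "t \<in> {0..1}" for t w
    by (rule has_real_derivative_at_endpoints[OF slice[OF e(1)] slice[OF e(2)] gaussian_derivative_interp[OF f \<mu>] that])
  then show ?thesis
    unfolding heat_class_def
    using e heat_classD[OF f] by (auto intro!: exp_growth_gauss_avg[OF \<mu>] directional_gauss_avg[OF \<mu>])
qed

subsection \<open>The logarithm of an exponential average\<close>

text \<open>The growth suited to logarithms: it makes \<open>exp (m * L)\<close> of exponential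
  growth for every real \<open>m\<close>, also for negative \<open>m\<close>, and it is reproduced
  by the next logarithm.\<close>

definition lin_growth :: "(real \<Rightarrow> 'a::euclidean_space \<Rightarrow> real) \<Rightarrow> bool" where
  "lin_growth L \<longleftrightarrow> (\<exists>K. \<forall>t\<in>{0..1}. \<forall>w. \<bar>L t w\<bar> \<le> K * (1 + norm w))"

lemma lin_growthE:
  assumes "lin_growth L"
  obtains K where "K > 0" "\<And>t w. t \<in> {0..1} \<Longrightarrow> \<bar>L t w\<bar> \<le> K * (1 + norm w)"
proof -
  from assms obtain K where K: "\<forall>t\<in>{0..1}. \<forall>w. \<bar>L t w\<bar> \<le> K * (1 + norm w)" by (auto simp: lin_growth_def)
  have "\<bar>L t w\<bar> \<le> (\<bar>K\<bar>+1) * (1 + norm w)" if t: "t \<in> {0..1}" for t w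
  proof -
    have "K * (1 + norm w) \<le> (\<bar>K\<bar>+1) * (1 + norm w)" by (intro mult_right_mono) auto
    moreover have "\<bar>L t w\<bar> \<le> K * (1 + norm w)" using K t by blast
    ultimately show ?thesis by linarith
  qed
  then show thesis by (intro that[of "\<bar>K\<bar>+1"]) auto
qed

lemma exp_growth_lin_growth:
  assumes "continuous_on ({0..1} \<times> UNIV) (\<lambda>(t, w). L t w)" "lin_growth L"
  shows "exp_growth L"
proof -
  obtain K where K: "K > 0" "\<And>t w. t \<in> {0..1} \<Longrightarrow> \<bar>L t w\<bar> \<le> K * (1 + norm w)" using lin_growthE[OF assms(2)] by blast
  show ?thesis
  proof (rule exp_growthI[OF assms(1), where A=K and B=1])
    show "\<bar>L t w\<bar> \<le> K * exp (1 * norm w)" if "t \<in> {0..1}" for t w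
      unfolding mult_1
      by (rule order_trans[OF K(2)[OF that]], rule mult_left_mono[OF exp_ge_add_one_self less_imp_le[OF K(1)]])
  qed
qed

lemma exp_growth_exp:
  assumes L: "exp_growth L" "lin_growth L"
  shows "exp_growth (\<lambda>t w. exp (m * L t w))"
proof -
  obtain K where K: "K > 0" "\<And>t w. t \<in> {0..1} \<Longrightarrow> \<bar>L t w\<bar> \<le> K * (1 + norm w)" using lin_growthE[OF L(2)] by blast
  show ?thesis
  proof (rule exp_growthI[where A="exp (\<bar>m\<bar> * K)" and B="\<bar>m\<bar> * K"])
    show "continuous_on ({0..1} \<times> UNIV) (\<lambda>(t, w). exp (m * L t w))"
      using exp_growth_continuous[OF L(1)] unfolding case_prod_unfold by (intro continuous_intros)
    show "\<bar>exp (m * L t w)\<bar> \<le> exp (\<bar>m\<bar> * K) * exp (\<bar>m\<bar> * K * norm w)" if t: "t \<in> {0..1}" for t w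
    proof -
      have "m * L t w \<le> \<bar>m\<bar> * (K * (1 + norm w))"
        by (rule order_trans[OF abs_ge_self]) (auto simp: abs_mult intro!: mult_left_mono K(2)[OF t])
      then show ?thesis by (simp add: exp_add[symmetric] algebra_simps)
    qed
  qed
qed

text \<open>Expectation under the law reweighted by \<open>exp (m * L)\<close>. The normaliser is
  evaluated at the same \<open>w\<close> and depends only on what has not been averaged out.\<close>

definition tilted_avg :: "'a::euclidean_space set \<Rightarrow> 'a measure \<Rightarrow> real \<Rightarrow> (real \<Rightarrow> 'a \<Rightarrow> real) \<Rightarrow>
    (real \<Rightarrow> 'a \<Rightarrow> real) \<Rightarrow> real \<Rightarrow> 'a \<Rightarrow> real" where
  "tilted_avg P \<mu> m L g t w = gauss_avg P \<mu> (\<lambda>t w. exp (m * L t w) * g t w) t w / gauss_avg P \<mu> (\<lambda>t w. exp (m * L t w)) t w"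

text \<open>The exponent lies within \<open>C * (1 + norm w) + C * norm u\<close> of 0. Integrating
  over \<open>u\<close> traps the average between \<open>exp (- (C * (1 + norm w))) * J (-C)\<close>
  and \<open>exp (C * (1 + norm w)) * J C\<close>; taking logarithms gives linear growth.\<close>

lemma gauss_avg_exp_bounds:
  assumes \<mu>: "gaussian \<mu> c" and L: "exp_growth L" "lin_growth L"
  shows "t \<in> {0..1} \<Longrightarrow> 0 < gauss_avg P \<mu> (\<lambda>t w. exp (m * L t w)) t w"
    and "lin_growth (\<lambda>t w. ln (gauss_avg P \<mu> (\<lambda>t w. exp (m * L t w)) t w))"
proof -
  interpret prob_space \<mu> using \<mu> by (simp add: gaussian_def)
  let ?F = "gauss_avg P \<mu> (\<lambda>t w. exp (m * L t w))"
  obtain K where K: "K > 0" "\<And>t w. t \<in> {0..1} \<Longrightarrow> \<bar>L t w\<bar> \<le> K * (1 + norm w)" using lin_growthE[OF L(2)] by blast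
  define C where "C = \<bar>m\<bar> * K"
  have C0: "C \<ge> 0" using K by (simp add: C_def)
  define J where "J a = (\<integral>u. exp (a * norm u) \<partial>\<mu>)" for a
  have i: "integrable \<mu> (\<lambda>u. exp (a * norm u))" for a by (rule gaussian_exp_integrable[OF \<mu>])
  have J: "J a > 0" for a
    unfolding J_def using integral_less_AE_space[of "\<lambda>_. 0" "\<lambda>u. exp (a * norm u)"] i[of a] emeasure_space_1 by simp
  have bnd: "\<bar>m * L t (w + interp P t u)\<bar> \<le> C * (1 + norm w) + C * norm u" if t: "t \<in> {0..1}" for t w u
  proof -
    have "norm (w + interp P t u) \<le> norm w + norm u"
      using norm_triangle_ineq[of w "interp P t u"] norm_interp_le[OF t, of P u] by linarith
    then have "\<bar>L t (w + interp P t u)\<bar> \<le> K * (1 + norm w + norm u)"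
      using K(2)[OF t, of "w + interp P t u"] K(1) by (smt (verit) mult_left_mono)
    then have "\<bar>m\<bar> * \<bar>L t (w + interp P t u)\<bar> \<le> \<bar>m\<bar> * (K * (1 + norm w + norm u))" by (intro mult_left_mono) auto
    then show ?thesis by (simp add: C_def abs_mult algebra_simps)
  qed
  have gi: "integrable \<mu> (\<lambda>u. exp (m * L t (w + interp P t u)))" if "t \<in> {0..1}" for t w
    using gauss_avg_integrable[OF \<mu> exp_growth_exp[OF L] that] .
  have up: "?F t w \<le> exp (C * (1 + norm w)) * J C" if t: "t \<in> {0..1}" for t w
  proof -
    have "?F t w \<le> (\<integral>u. exp (C * (1 + norm w)) * exp (C * norm u) \<partial>\<mu>)"
      unfolding gauss_avg_def using bnd[OF t, of w]
      by (intro integral_mono gi[OF t] integrable_mult_right i) (auto simp: exp_add[symmetric] abs_le_iff)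
    then show ?thesis by (simp add: J_def)
  qed
  have low: "exp (- (C * (1 + norm w))) * J (-C) \<le> ?F t w" if t: "t \<in> {0..1}" for t w
  proof -
    have "exp (- (C * (1 + norm w))) * exp ((-C) * norm u) \<le> exp (m * L t (w + interp P t u))" for u
      using bnd[OF t, of w u] unfolding exp_add[symmetric] exp_le_cancel_iff by linarith
    then have "(\<integral>u. exp (- (C * (1 + norm w))) * exp ((-C) * norm u) \<partial>\<mu>) \<le> ?F t w"
      unfolding gauss_avg_def by (intro integral_mono gi[OF t] integrable_mult_right i)
    then show ?thesis by (simp add: J_def)
  qed
  show pos: "0 < ?F t w" if t: "t \<in> {0..1}" for t w
    using low[OF t, of w] J[of "-C"] by (smt (verit) exp_gt_zero mult_pos_pos)
  show "lin_growth (\<lambda>t w. ln (?F t w))"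
    unfolding lin_growth_def
  proof (intro exI ballI allI)
    fix t :: real and w :: 'a assume t: "t \<in> {0..1}"
    let ?M = "\<bar>ln (J C)\<bar> + \<bar>ln (J (-C))\<bar>"
    have "ln (?F t w) \<le> ln (exp (C * (1 + norm w)) * J C)"
      using up[OF t, of w] pos[OF t, of w] J by (subst ln_le_cancel_iff) auto
    then have 1: "ln (?F t w) \<le> C * (1 + norm w) + ln (J C)" using J[of C] by (simp add: ln_mult)
    have "ln (exp (- (C * (1 + norm w))) * J (-C)) \<le> ln (?F t w)"
      using low[OF t, of w] pos[OF t, of w] J by (subst ln_le_cancel_iff) auto
    then have 2: "- (C * (1 + norm w)) + ln (J (-C)) \<le> ln (?F t w)" using J[of "-C"] by (simp add: ln_mult)
    have "\<bar>ln (?F t w)\<bar> \<le> C * (1 + norm w) + ?M" using 1 2 by linarith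
    also have "\<dots> \<le> C * (1 + norm w) + ?M * (1 + norm w)"
      using mult_left_mono[of 1 "1 + norm w" ?M] by simp
    finally show "\<bar>ln (?F t w)\<bar> \<le> (C + ?M) * (1 + norm w)" by (simp add: distrib_right)
  qed
qed

lemma exp_growth_ln_gauss_avg:
  assumes \<mu>: "gaussian \<mu> c" and L: "exp_growth L" "lin_growth L"
  shows "exp_growth (\<lambda>t w. ln (gauss_avg P \<mu> (\<lambda>t w. exp (m * L t w)) t w))"
proof (rule exp_growth_lin_growth[OF _ gauss_avg_exp_bounds(2)[OF assms]])
  let ?F = "gauss_avg P \<mu> (\<lambda>t w. exp (m * L t w))"
  have "?F (fst x) (snd x) \<noteq> 0" if "x \<in> {0..1} \<times> UNIV" for x
    using gauss_avg_exp_bounds(1)[OF assms, of "fst x" P m "snd x"] that by auto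
  moreover have "exp_growth ?F" by (intro exp_growth_gauss_avg[OF \<mu>] exp_growth_exp L)
  from exp_growth_continuous[OF this] calculation
  show "continuous_on ({0..1} \<times> UNIV) (\<lambda>(t, w). ln (?F t w))"
    unfolding case_prod_unfold by (intro continuous_intros) auto
qed

text \<open>The inverse is \<open>exp\<close> of minus a logarithm of linear growth, so the
  exponential bound for \<open>exp\<close> applies with factor -1.\<close>

lemma exp_growth_inverse_gauss_avg:
  assumes \<mu>: "gaussian \<mu> c" and L: "exp_growth L" "lin_growth L"
  shows "exp_growth (\<lambda>t w. inverse (gauss_avg P \<mu> (\<lambda>t w. exp (m * L t w)) t w))"
  by (rule exp_growth_cong[OF exp_growth_exp[OF exp_growth_ln_gauss_avg[OF assms] gauss_avg_exp_bounds(2)[OF assms], of "-1"]])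
     (use gauss_avg_exp_bounds(1)[OF assms] in \<open>simp add: exp_minus\<close>)

lemma exp_growth_tilted_avg:
  assumes \<mu>: "gaussian \<mu> c" and L: "exp_growth L" "lin_growth L" and g: "exp_growth g"
  shows "exp_growth (tilted_avg P \<mu> m L g)"
proof -
  have "exp_growth (\<lambda>t w. gauss_avg P \<mu> (\<lambda>t w. exp (m * L t w) * g t w) t w * inverse (gauss_avg P \<mu> (\<lambda>t w. exp (m * L t w)) t w))"
    by (intro exp_growth_mult exp_growth_gauss_avg[OF \<mu>] exp_growth_inverse_gauss_avg[OF \<mu>] exp_growth_exp L g)
  then show ?thesis unfolding tilted_avg_def[abs_def] divide_inverse .
qed

lemma gauss_avg_cmult: "gauss_avg P \<mu> (\<lambda>t w. a * g t w) t w = a * gauss_avg P \<mu> g t w"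
  by (simp add: gauss_avg_def)

lemma gauss_avg_sum:
  assumes \<mu>: "gaussian \<mu> c" "t \<in> {0..1}" "\<And>i. i \<in> I \<Longrightarrow> exp_growth (g i)"
  shows "gauss_avg P \<mu> (\<lambda>t w. \<Sum>i\<in>I. g i t w) t w = (\<Sum>i\<in>I. gauss_avg P \<mu> (g i) t w)"
  unfolding gauss_avg_def using assms by (intro Bochner_Integration.integral_sum gauss_avg_integrable)

lemma gauss_avg_diff:
  assumes \<mu>: "gaussian \<mu> c" "t \<in> {0..1}" "exp_growth f" "exp_growth g"
  shows "gauss_avg P \<mu> (\<lambda>t w. f t w - g t w) t w = gauss_avg P \<mu> f t w - gauss_avg P \<mu> g t w"
  unfolding gauss_avg_def using assms by (intro Bochner_Integration.integral_diff gauss_avg_integrable)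

lemma tilted_avg_cmult: "tilted_avg P \<mu> m L (\<lambda>t w. a * g t w) t w = a * tilted_avg P \<mu> m L g t w"
  by (simp add: tilted_avg_def mult.left_commute[of _ a] gauss_avg_cmult)

lemma tilted_avg_sum:
  assumes \<mu>: "gaussian \<mu> c" and L: "exp_growth L" "lin_growth L" and "t \<in> {0..1}" "\<And>i. i \<in> I \<Longrightarrow> exp_growth (g i)"
  shows "tilted_avg P \<mu> m L (\<lambda>t w. \<Sum>i\<in>I. g i t w) t w = (\<Sum>i\<in>I. tilted_avg P \<mu> m L (g i) t w)"
  using assms by (simp add: tilted_avg_def sum_distrib_left gauss_avg_sum[OF \<mu>] exp_growth_mult exp_growth_exp sum_divide_distrib)

lemma tilted_avg_diff:
  assumes \<mu>: "gaussian \<mu> c" and L: "exp_growth L" "lin_growth L" and "t \<in> {0..1}" "exp_growth f" "exp_growth g"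
  shows "tilted_avg P \<mu> m L (\<lambda>t w. f t w - g t w) t w = tilted_avg P \<mu> m L f t w - tilted_avg P \<mu> m L g t w"
  using assms by (simp add: tilted_avg_def right_diff_distrib gauss_avg_diff[OF \<mu>] exp_growth_mult exp_growth_exp diff_divide_distrib)

lemma heat_class_exp:
  assumes L: "heat_class L Lt L1 L2" "lin_growth L"
  shows "heat_class (\<lambda>t w. exp (m * L t w)) (\<lambda>t w. m * (exp (m * L t w) * Lt t w))
     (\<lambda>b t w. m * (exp (m * L t w) * L1 b t w))
     (\<lambda>b t w. m * (exp (m * L t w) * (L2 b t w + m * (L1 b t w)\<^sup>2)))"
  unfolding heat_class_def
proof (intro conjI ballI allI)
  note N = heat_classD[OF L(1)]
  have e: "exp_growth (\<lambda>t w. exp (m * L t w))" by (rule exp_growth_exp[OF N(1) L(2)])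
  show "exp_growth (\<lambda>t w. exp (m * L t w))" "exp_growth (\<lambda>t w. m * (exp (m * L t w) * Lt t w))"
    by (intro exp_growth_intros e N)+
  fix t :: real and w :: 'a assume t: "t \<in> {0..1}"
  show "((\<lambda>t. exp (m * L t w)) has_real_derivative m * (exp (m * L t w) * Lt t w)) (at t within {0..1})"
    by (rule derivative_eq_intros N(5)[OF t] | simp)+
next
  note N = heat_classD[OF L(1)]
  have e: "exp_growth (\<lambda>t w. exp (m * L t w))" by (rule exp_growth_exp[OF N(1) L(2)])
  fix b :: 'a assume b: "b \<in> Basis"
  show "exp_growth (\<lambda>t w. m * (exp (m * L t w) * L1 b t w))"
    "exp_growth (\<lambda>t w. m * (exp (m * L t w) * (L2 b t w + m * (L1 b t w)\<^sup>2)))"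
    by (intro exp_growth_intros e N b)+
  fix t :: real and w :: 'a assume t: "t \<in> {0..1}"
  show "((\<lambda>h. exp (m * L t (w + h *\<^sub>R b))) has_real_derivative m * (exp (m * L t w) * L1 b t w)) (at 0)"
    by (rule derivative_eq_intros N(6)[OF b t] | simp)+
  show "((\<lambda>h. m * (exp (m * L t (w + h *\<^sub>R b)) * L1 b t (w + h *\<^sub>R b))) has_real_derivative
     m * (exp (m * L t w) * (L2 b t w + m * (L1 b t w)\<^sup>2))) (at 0)"
    by (rule derivative_eq_intros N(6)[OF b t] N(7)[OF b t] | simp add: algebra_simps power2_eq_square)+
qed

text \<open>The growth of the inverse and of the logarithm are premises, since positivity of
  \<open>F\<close> alone would bound neither.\<close>

lemma heat_class_ln:
  assumes F: "heat_class F Ft F1 F2" and pos: "\<And>t w. t \<in> {0..1} \<Longrightarrow> F t w > 0"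
    and inv: "exp_growth (\<lambda>t w. inverse (F t w))" and ln: "exp_growth (\<lambda>t w. ln (F t w))"
  shows "heat_class (\<lambda>t w. ln (F t w) / m) (\<lambda>t w. Ft t w / F t w / m) (\<lambda>b t w. F1 b t w / F t w / m)
     (\<lambda>b t w. (F2 b t w / F t w - (F1 b t w / F t w)\<^sup>2) / m)"
  unfolding heat_class_def
proof (intro conjI ballI allI)
  note N = heat_classD[OF F]
  have dm: "exp_growth (\<lambda>t w. g t w / m)" if "exp_growth g" for g :: "real \<Rightarrow> 'a \<Rightarrow> real"
    using exp_growth_cmult[OF that, of "1/m"] by simp
  have dF: "exp_growth (\<lambda>t w. g t w / F t w)" if "exp_growth g" for g :: "real \<Rightarrow> 'a \<Rightarrow> real"
    using exp_growth_mult[OF that inv] by (simp add: divide_inverse)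
  show "exp_growth (\<lambda>t w. ln (F t w) / m)" "exp_growth (\<lambda>t w. Ft t w / F t w / m)"
    by (intro dm dF N ln)+
  fix t :: real and w :: 'a assume t: "t \<in> {0..1}"
  show "((\<lambda>t. ln (F t w) / m) has_real_derivative Ft t w / F t w / m) (at t within {0..1})"
    by (rule DERIV_cdivide) (rule derivative_eq_intros N(5)[OF t] pos[OF t] | simp)+
next
  note N = heat_classD[OF F]
  have dm: "exp_growth (\<lambda>t w. g t w / m)" if "exp_growth g" for g :: "real \<Rightarrow> 'a \<Rightarrow> real"
    using exp_growth_cmult[OF that, of "1/m"] by simp
  have dF: "exp_growth (\<lambda>t w. g t w / F t w)" if "exp_growth g" for g :: "real \<Rightarrow> 'a \<Rightarrow> real"
    using exp_growth_mult[OF that inv] by (simp add: divide_inverse)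
  fix b :: 'a assume b: "b \<in> Basis"
  show "exp_growth (\<lambda>t w. F1 b t w / F t w / m)"
    "exp_growth (\<lambda>t w. (F2 b t w / F t w - (F1 b t w / F t w)\<^sup>2) / m)"
    by (intro dm exp_growth_diff exp_growth_power2 dF N b)+
  fix t :: real and w :: 'a assume t: "t \<in> {0..1}"
  have p: "F t (w + 0 *\<^sub>R b) > 0" using pos[OF t] .
  then have p0: "F t (w + 0 *\<^sub>R b) \<noteq> 0" by simp
  show "((\<lambda>h. ln (F t (w + h *\<^sub>R b)) / m) has_real_derivative F1 b t w / F t w / m) (at 0)"
    by (rule DERIV_cdivide) (rule derivative_eq_intros N(6)[OF b t] p | simp)+
  have "((\<lambda>h. F1 b t (w + h *\<^sub>R b) / F t (w + h *\<^sub>R b)) has_real_derivative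
      (F2 b t w * F t (w + 0 *\<^sub>R b) - F1 b t (w + 0 *\<^sub>R b) * F1 b t w) / (F t (w + 0 *\<^sub>R b) * F t (w + 0 *\<^sub>R b))) (at 0)"
    by (rule DERIV_divide[OF N(7)[OF b t] N(6)[OF b t] p0])
  then have "((\<lambda>h. F1 b t (w + h *\<^sub>R b) / F t (w + h *\<^sub>R b) / m) has_real_derivative
      ((F2 b t w * F t w - F1 b t w * F1 b t w) / (F t w * F t w)) / m) (at 0)"
    by (intro DERIV_cdivide) simp
  moreover have "(F2 b t w * F t w - F1 b t w * F1 b t w) / (F t w * F t w) = F2 b t w / F t w - (F1 b t w / F t w)\<^sup>2"
    using pos[OF t, of w] by (simp add: diff_divide_distrib power2_eq_square)
  ultimately show "((\<lambda>h. F1 b t (w + h *\<^sub>R b) / F t (w + h *\<^sub>R b) / m) has_real_derivative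
      (F2 b t w / F t w - (F1 b t w / F t w)\<^sup>2) / m) (at 0)" by simp
qed

text \<open>One step of the hierarchy: exponentiate, average, take the logarithm. Derivatives of
  \<open>exp (m * L)\<close> carry the factor \<open>m * exp (m * L)\<close>; after division by the
  average and by \<open>m\<close> they become tilted averages. The combination
  \<open>L2 + m * L1\<^sup>2\<close> is averaged linearly, and the square of the averaged gradient
  is what the logarithm subtracts.\<close>

lemma heat_class_tilted_avg:
  assumes \<mu>: "gaussian \<mu> c" and L: "heat_class L Lt L1 L2" "lin_growth L" and m: "m \<noteq> 0"
  shows "heat_class (\<lambda>t w. ln (gauss_avg P \<mu> (\<lambda>t w. exp (m * L t w)) t w) / m)
     (tilted_avg P \<mu> m L (\<lambda>t w. Lt t w + (\<Sum>b\<in>Basis. (if b \<in> P then c b else - c b) / 2 * (L2 b t w + m * (L1 b t w)\<^sup>2))))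
     (\<lambda>b. tilted_avg P \<mu> m L (L1 b))
     (\<lambda>b t w. tilted_avg P \<mu> m L (\<lambda>t w. L2 b t w + m * (L1 b t w)\<^sup>2) t w - m * (tilted_avg P \<mu> m L (L1 b) t w)\<^sup>2)"
    and "lin_growth (\<lambda>t w. ln (gauss_avg P \<mu> (\<lambda>t w. exp (m * L t w)) t w) / m)"
proof -
  note N = heat_classD[OF L(1)]
  let ?M = "\<lambda>t w. exp (m * L t w)"
  let ?F = "gauss_avg P \<mu> ?M"
  have eq: "m * (?M t w * Lt t w) + (\<Sum>b\<in>Basis. (if b \<in> P then c b else - c b) / 2 * (m * (?M t w * (L2 b t w + m * (L1 b t w)\<^sup>2))))
      = m * (?M t w * (Lt t w + (\<Sum>b\<in>Basis. (if b \<in> P then c b else - c b) / 2 * (L2 b t w + m * (L1 b t w)\<^sup>2))))" for t w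
    by (simp add: distrib_left sum_distrib_left mult.left_commute)
  have 1: "m * x / F / m = x / F" for x F :: real using m by simp
  have 2: "(m * x / F - (m * y / F)\<^sup>2) / m = x / F - m * (y / F)\<^sup>2" for x y F :: real
    using m by (simp add: diff_divide_distrib power2_eq_square)
  have "heat_class (\<lambda>t w. ln (?F t w) / m)
     (\<lambda>t w. gauss_avg P \<mu> (\<lambda>t w. m * (?M t w * Lt t w) + (\<Sum>b\<in>Basis. (if b \<in> P then c b else - c b) / 2 * (m * (?M t w * (L2 b t w + m * (L1 b t w)\<^sup>2))))) t w / ?F t w / m)
     (\<lambda>b t w. gauss_avg P \<mu> (\<lambda>t w. m * (?M t w * L1 b t w)) t w / ?F t w / m)
     (\<lambda>b t w. (gauss_avg P \<mu> (\<lambda>t w. m * (?M t w * (L2 b t w + m * (L1 b t w)\<^sup>2))) t w / ?F t w - (gauss_avg P \<mu> (\<lambda>t w. m * (?M t w * L1 b t w)) t w / ?F t w)\<^sup>2) / m)"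
    by (rule heat_class_ln[OF heat_class_gauss_avg[OF \<mu> heat_class_exp[OF L]] gauss_avg_exp_bounds(1)[OF \<mu> N(1) L(2)]
          exp_growth_inverse_gauss_avg[OF \<mu> N(1) L(2)] exp_growth_ln_gauss_avg[OF \<mu> N(1) L(2)]])
  then show "heat_class (\<lambda>t w. ln (?F t w) / m)
     (tilted_avg P \<mu> m L (\<lambda>t w. Lt t w + (\<Sum>b\<in>Basis. (if b \<in> P then c b else - c b) / 2 * (L2 b t w + m * (L1 b t w)\<^sup>2))))
     (\<lambda>b. tilted_avg P \<mu> m L (L1 b))
     (\<lambda>b t w. tilted_avg P \<mu> m L (\<lambda>t w. L2 b t w + m * (L1 b t w)\<^sup>2) t w - m * (tilted_avg P \<mu> m L (L1 b) t w)\<^sup>2)"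
    unfolding eq gauss_avg_cmult tilted_avg_def[abs_def] 1 2 .
  obtain K where K: "\<And>t w. t \<in> {0..1} \<Longrightarrow> \<bar>ln (?F t w)\<bar> \<le> K * (1 + norm w)"
    using lin_growthE[OF gauss_avg_exp_bounds(2)[OF \<mu> N(1) L(2)]] by blast
  show "lin_growth (\<lambda>t w. ln (?F t w) / m)"
    unfolding lin_growth_def
  proof (intro exI ballI allI)
    fix t :: real and w :: 'a assume "t \<in> {0..1}"
    from divide_right_mono[OF K[OF this, of w], of "\<bar>m\<bar>"]
    show "\<bar>ln (?F t w) / m\<bar> \<le> (K / \<bar>m\<bar>) * (1 + norm w)" by (simp add: abs_divide)
  qed
qed

subsection \<open>The Gibbs weights\<close>

lemma sum_Basis_prod:
  fixes f :: "'a::euclidean_space \<times> 'b::euclidean_space \<Rightarrow> real"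
  shows "(\<Sum>b\<in>Basis. f b) = (\<Sum>a\<in>Basis. f (a, 0)) + (\<Sum>b\<in>Basis. f (0, b))"
proof -
  have "inj_on (\<lambda>u. (u::'a, 0::'b)) Basis" "inj_on (\<lambda>u. (0::'a, u::'b)) Basis"
    by (auto intro!: inj_onI Pair_inject)
  then show ?thesis
    unfolding Basis_prod_def by (subst sum.union_disjoint) (auto simp: sum.reindex)
qed

lemma heat_class_cong:
  assumes "heat_class f ft f1 f2" "\<And>t w. t \<in> {0..1} \<Longrightarrow> ft t w = ft' t w"
  shows "heat_class f ft' f1 f2"
  using assms exp_growth_cong[of ft ft'] unfolding heat_class_def by auto

text \<open>The average evaluates its argument at the single time \<open>t\<close>, so agreement at
  that time for all \<open>w\<close> is enough.\<close>

lemma tilted_avg_cong: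
  "(\<And>w. g t w = g' t w) \<Longrightarrow> tilted_avg P \<mu> m L g t w = tilted_avg P \<mu> m L g' t w"
  by (simp add: tilted_avg_def gauss_avg_def)

text \<open>Fubini with the point mass integrated innermost, where it evaluates at
  \<open>z\<close>.\<close>

lemma integral_return_pair:
  fixes F :: "'a::euclidean_space \<times> 'b::euclidean_space \<Rightarrow> real"
  assumes "prob_space M" "integrable (return borel z \<Otimes>\<^sub>M M) F" "continuous_on UNIV F"
  shows "(\<integral>w. F w \<partial>(return borel z \<Otimes>\<^sub>M M)) = (\<integral>u. F (z, u) \<partial>M)"
proof -
  interpret M: prob_space M by fact
  interpret N: prob_space "return borel z" by (rule prob_space_return) simp
  interpret P: pair_sigma_finite "return borel z" M ..
  have "continuous_on UNIV (\<lambda>a. F (a, u))" for u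
    by (rule continuous_on_compose2[OF assms(3)]) (auto intro!: continuous_intros)
  then have "(\<integral>a. F (a, u) \<partial>return borel z) = F (z, u)" for u
    by (intro integral_return) (auto intro: borel_measurable_continuous_onI)
  then show ?thesis using P.integral_snd[of "\<lambda>a u. F (a, u)"] assms(2) by simp
qed

text \<open>All terms lie between \<open>exp (- B)\<close> and \<open>exp B\<close>, so the sum lies
  between the same bounds times the number of terms.\<close>

lemma abs_ln_sum_le:
  fixes f :: "'i \<Rightarrow> real"
  assumes "finite I" "I \<noteq> {}" "\<And>i. i \<in> I \<Longrightarrow> f i > 0" "\<And>i. i \<in> I \<Longrightarrow> \<bar>ln (f i)\<bar> \<le> B"
  shows "\<bar>ln (\<Sum>i\<in>I. f i)\<bar> \<le> ln (card I) + B"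
proof -
  have c: "real (card I) \<ge> 1" using assms(1,2) by (simp add: Suc_leI card_gt_0_iff)
  have pos: "(\<Sum>i\<in>I. f i) > 0" using assms by (intro sum_pos) auto
  have b: "exp (- B) \<le> f i" "f i \<le> exp B" if "i \<in> I" for i
    using assms(3,4)[OF that] exp_le_cancel_iff[of "- B" "ln (f i)"] exp_le_cancel_iff[of "ln (f i)" B]
    by (auto simp: abs_le_iff)
  have "(\<Sum>i\<in>I. f i) \<le> card I * exp B" using sum_mono[OF b(2), of I "\<lambda>i. i"] by simp
  then have "ln (\<Sum>i\<in>I. f i) \<le> ln (card I * exp B)" using pos c by (subst ln_le_cancel_iff) auto
  also have "\<dots> = ln (card I) + B" using c by (simp add: ln_mult)
  finally have 1: "ln (\<Sum>i\<in>I. f i) \<le> ln (card I) + B" .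
  have "card I * exp (- B) \<le> (\<Sum>i\<in>I. f i)" using sum_mono[OF b(1), of I "\<lambda>i. i"] by simp
  then have "ln (card I * exp (- B)) \<le> ln (\<Sum>i\<in>I. f i)" using pos c by (subst ln_le_cancel_iff) auto
  moreover have "ln (card I * exp (- B)) = ln (card I) - B" using c by (simp add: ln_mult)
  moreover have "ln (card I) \<ge> 0" using c by simp
  ultimately show ?thesis using 1 by linarith
qed

text \<open>The bilinear form in G is the inner product of G with a rank-one matrix. Together with
  \<open>inner_outer\<close> this makes the G part of the covariance a product of two inner
  products.\<close>

lemma inner_matrix_vector: "v \<bullet> (G *v w) = G \<bullet> (\<chi> i j. v $ i * w $ j)"
  for G :: "real^'n^'m"
  by (simp add: inner_vec_def matrix_vector_mult_def sum_distrib_left ac_simps)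

lemma inner_outer: "(\<chi> i j. v $ i * w $ j) \<bullet> (\<chi> i j. v' $ i * w' $ j) = (v \<bullet> v') * (w \<bullet> w')"
  for w w' :: "real^'n" and v v' :: "real^'m"
  by (simp add: inner_vec_def sum_product ac_simps)

text \<open>With \<open>l > 0\<close> all partition sums are positive and their logarithms proper.
  The monotonicity of \<open>p\<close> and \<open>q\<close> makes the variances of all blocks
  nonnegative.\<close>

locale lifted_assms = lifted r l x y p q m \<beta> s
  for r l :: nat and x :: "nat \<Rightarrow> real^'n" and y :: "nat \<Rightarrow> real^'m"
    and p q m :: "nat \<Rightarrow> real" and \<beta> s :: real +
  assumes l_pos: "l > 0"
    and m_0: "m 0 = 1" and m_last: "m (r + 1) = 0" and m_nz: "\<And>k. k \<in> {1..r} \<Longrightarrow> m k \<noteq> 0"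
    and p_decr: "\<And>k. k \<le> r \<Longrightarrow> p (k + 1) \<le> p k" and p_last: "p (r + 1) = 0"
    and q_decr: "\<And>k. k \<le> r \<Longrightarrow> q (k + 1) \<le> q k" and q_last: "q (r + 1) = 0"
begin

text \<open>The exponent \<open>D0\<close> with its time factors stripped: they are supplied by
  evaluating this linear functional at a point scaled by \<open>interp\<close>.\<close>

definition ell :: "nat \<Rightarrow> nat \<Rightarrow> (real^'n^'m) \<times> ('n, 'm) block \<Rightarrow> real" where
  "ell i j w = y j \<bullet> (fst w *v x i) + norm (x i) * (y j \<bullet> fst (snd (snd w)))
     + norm (x i) * norm (y j) * fst (snd w) + norm (y j) * (snd (snd (snd w)) \<bullet> x i)"

definition Cw :: "nat \<Rightarrow> (real^'n^'m) \<times> ('n, 'm) block \<Rightarrow> real" where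
  "Cw i w = (\<Sum>j=1..l. exp (\<beta> * ell i j w))"

definition Zw :: "(real^'n^'m) \<times> ('n, 'm) block \<Rightarrow> real" where
  "Zw w = (\<Sum>i=1..l. Cw i w powr s)"

text \<open>Time enters the weights only through the point \<open>w\<close>; the argument
  \<open>t\<close> gives them the type on which \<open>gauss_avg\<close> acts.\<close>

definition g0 :: "nat \<Rightarrow> nat \<Rightarrow> real \<Rightarrow> (real^'n^'m) \<times> ('n, 'm) block \<Rightarrow> real" where
  "g0 i j t w = Cw i w powr s / Zw w * (exp (\<beta> * ell i j w) / Cw i w)"

definition g02 :: "nat \<Rightarrow> nat \<Rightarrow> nat \<Rightarrow> real \<Rightarrow> (real^'n^'m) \<times> ('n, 'm) block \<Rightarrow> real" where
  "g02 i j j' t w = Cw i w powr s / Zw w * (exp (\<beta> * ell i j w) / Cw i w) * (exp (\<beta> * ell i j' w) / Cw i w)"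

lemma linear_ell: "linear (ell i j)"
  by (rule linearI)
     (simp_all add: ell_def inner_add_right inner_add_left matrix_vector_mult_add_rdistrib scaleR_matrix_vector_assoc[symmetric] algebra_simps)

lemma ell_line: "ell i j (w + h *\<^sub>R b) = ell i j w + h * ell i j b"
  using linear_ell[of i j] by (simp add: linear_add linear_scale)

lemma continuous_ell [continuous_intros]:
  "continuous_on S f \<Longrightarrow> continuous_on S (\<lambda>z. ell i j (f z))"
  using continuous_on_compose2[OF linear_continuous_on[OF linear_ell[unfolded linear_conv_bounded_linear]], of S f UNIV]
  by simp

lemma Cw_pos: "Cw i w > 0"
  unfolding Cw_def using l_pos by (intro sum_pos) auto

lemma Cw_nz: "Cw i w \<noteq> 0"
  using Cw_pos[of i w] by simp

lemma Zw_pos: "Zw w > 0"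
  unfolding Zw_def using l_pos by (intro sum_pos) (simp_all add: Cw_nz)

lemma Zw_nz: "Zw w \<noteq> 0"
  using Zw_pos[of w] by simp

text \<open>As a single exponential the weight is differentiated and shown continuous through its
  exponent.\<close>

lemma g0_exp: "g0 i j t w = exp (\<beta> * ell i j w + (s - 1) * ln (Cw i w) - ln (Zw w))"
  using Cw_pos[of i w] Zw_pos[of w]
  by (simp add: g0_def powr_def exp_add exp_diff left_diff_distrib mult.commute mult.left_commute)

lemma g02_exp: "g02 i j j' t w = exp (\<beta> * ell i j w + \<beta> * ell i j' w + (s - 2) * ln (Cw i w) - ln (Zw w))"
  using Cw_pos[of i w] Zw_pos[of w] exp_double[of "ln (Cw i w)"]
  by (simp add: g02_def powr_def exp_add exp_diff left_diff_distrib power2_eq_square mult.commute mult.left_commute)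

lemma g0_mult: "g0 i j t w * (exp (\<beta> * ell i j' w) / Cw i w) = g02 i j j' t w"
  by (simp add: g0_def g02_def)

lemma continuous_Cw: "continuous_on S f \<Longrightarrow> continuous_on S (\<lambda>z. Cw i (f z))"
  unfolding Cw_def by (intro continuous_intros)

lemma continuous_Zw: "continuous_on S f \<Longrightarrow> continuous_on S (\<lambda>z. Zw (f z))"
  unfolding Zw_def by (intro continuous_intros continuous_Cw) (simp_all add: Cw_nz)

text \<open>Each factor is the quotient of a nonnegative summand by the whole sum.\<close>

lemma weight_bounds:
  assumes "i \<in> {1..l}" "j \<in> {1..l}"
  shows "\<bar>g0 i j t w\<bar> \<le> 1" "j' \<in> {1..l} \<Longrightarrow> \<bar>g02 i j j' t w\<bar> \<le> 1"
proof -
  have "Cw i w powr s \<le> Zw w" unfolding Zw_def by (rule member_le_sum) (use assms in auto)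
  then have 1: "Cw i w powr s / Zw w \<le> 1" using Zw_pos[of w] by simp
  have 2: "exp (\<beta> * ell i j w) / Cw i w \<le> 1" if "j \<in> {1..l}" for j
  proof -
    have "exp (\<beta> * ell i j w) \<le> Cw i w" unfolding Cw_def by (rule member_le_sum) (use that in auto)
    then show ?thesis using Cw_pos[of i w] by simp
  qed
  have nn: "0 \<le> Cw i w powr s / Zw w" "0 \<le> exp (\<beta> * ell i j w) / Cw i w" for j
    using Zw_pos[of w] Cw_pos[of i w] by simp_all
  show "\<bar>g0 i j t w\<bar> \<le> 1"
  proof -
    have "Cw i w powr s / Zw w * (exp (\<beta> * ell i j w) / Cw i w) \<le> 1"
      by (intro mult_le_one nn 1 2 assms)
    moreover have "0 \<le> Cw i w powr s / Zw w * (exp (\<beta> * ell i j w) / Cw i w)"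
      by (intro nn mult_nonneg_nonneg)
    ultimately show ?thesis unfolding g0_def by linarith
  qed
  show "\<bar>g02 i j j' t w\<bar> \<le> 1" if "j' \<in> {1..l}"
  proof -
    have "Cw i w powr s / Zw w * (exp (\<beta> * ell i j w) / Cw i w) * (exp (\<beta> * ell i j' w) / Cw i w) \<le> 1"
      by (intro mult_le_one nn mult_nonneg_nonneg 1 2 assms that)
    moreover have "0 \<le> Cw i w powr s / Zw w * (exp (\<beta> * ell i j w) / Cw i w) * (exp (\<beta> * ell i j' w) / Cw i w)"
      by (intro nn mult_nonneg_nonneg)
    ultimately show ?thesis unfolding g02_def by linarith
  qed
qed

lemma exp_growth_g0: "i \<in> {1..l} \<Longrightarrow> j \<in> {1..l} \<Longrightarrow> exp_growth (g0 i j)"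
proof (rule exp_growth_bounded[OF _ weight_bounds(1)])
  show "continuous_on ({0..1} \<times> UNIV) (\<lambda>(t, w). g0 i j t w)"
    unfolding g0_exp case_prod_unfold
    by (intro continuous_intros continuous_Cw continuous_Zw) (simp_all add: Cw_nz Zw_nz)
qed

lemma exp_growth_g02: "i \<in> {1..l} \<Longrightarrow> j \<in> {1..l} \<Longrightarrow> j' \<in> {1..l} \<Longrightarrow> exp_growth (g02 i j j')"
proof (rule exp_growth_bounded[OF _ weight_bounds(2)])
  show "continuous_on ({0..1} \<times> UNIV) (\<lambda>(t, w). g02 i j j' t w)"
    unfolding g02_exp case_prod_unfold
    by (intro continuous_intros continuous_Cw continuous_Zw) (simp_all add: Cw_nz Zw_nz)
qed

text \<open>\<open>B\<close> is the sum of the operator norms of all functionals, hence bounds each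
  of them. Then \<open>abs_ln_sum_le\<close> is applied twice, to the inner sum \<open>Cw\<close>
  and to the outer sum of its powers.\<close>

lemma lin_growth_ln_Zw: "lin_growth (\<lambda>t w. ln (Zw w))"
proof -
  define B where "B = (\<Sum>i=1..l. \<Sum>j=1..l. onorm (ell i j))"
  have on: "onorm (ell i j) \<ge> 0" for i j
    using onorm_pos_le[of "ell i j"] linear_ell by (simp add: linear_conv_bounded_linear)
  have ell: "\<bar>ell i j w\<bar> \<le> B * norm w" if "i \<in> {1..l}" "j \<in> {1..l}" for i j w
  proof -
    have "\<bar>ell i j w\<bar> \<le> onorm (ell i j) * norm w"
      using onorm[of "ell i j" w] linear_ell by (simp add: linear_conv_bounded_linear)
    also have "onorm (ell i j) \<le> (\<Sum>j=1..l. onorm (ell i j))"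
      by (rule member_le_sum) (use that on in auto)
    also have "(\<Sum>j=1..l. onorm (ell i j)) \<le> B"
      unfolding B_def by (rule member_le_sum[of i]) (use that on in \<open>auto intro!: sum_nonneg\<close>)
    finally show ?thesis by (simp add: mult_right_mono)
  qed
  have I: "finite {1..l}" "{1..l} \<noteq> {}" using l_pos by auto
  have C: "\<bar>ln (Cw i w)\<bar> \<le> ln l + \<bar>\<beta>\<bar> * (B * norm w)" if i: "i \<in> {1..l}" for i w
    unfolding Cw_def
    using abs_ln_sum_le[OF I, of "\<lambda>j. exp (\<beta> * ell i j w)" "\<bar>\<beta>\<bar> * (B * norm w)"] ell[OF i]
    by (simp add: abs_mult mult_left_mono)
  have Z: "\<bar>ln (Zw w)\<bar> \<le> ln l + \<bar>s\<bar> * (ln l + \<bar>\<beta>\<bar> * (B * norm w))" for w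
    unfolding Zw_def
    using abs_ln_sum_le[OF I, of "\<lambda>i. Cw i w powr s" "\<bar>s\<bar> * (ln l + \<bar>\<beta>\<bar> * (B * norm w))"] C Cw_pos
    by (simp add: abs_mult mult_left_mono ln_powr less_imp_neq[symmetric])
  have B0: "0 \<le> B" unfolding B_def by (intro sum_nonneg on)
  show ?thesis
    unfolding lin_growth_def
  proof (intro exI ballI allI)
    fix t :: real and w :: "(real^'n^'m) \<times> ('n, 'm) block"
    let ?K1 = "ln l + \<bar>s\<bar> * ln l" and ?K2 = "\<bar>s\<bar> * (\<bar>\<beta>\<bar> * B)"
    have "ln (real l) \<ge> 0" using l_pos by simp
    then have k: "0 \<le> ?K1" "0 \<le> ?K2" using B0 by auto
    have "\<bar>ln (Zw w)\<bar> \<le> ?K1 + ?K2 * norm w" using Z[of w] by (simp add: algebra_simps)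
    also have "\<dots> \<le> (?K1 + ?K2) * (1 + norm w)"
      using mult_nonneg_nonneg[OF k(1) norm_ge_zero[of w]] k(2) unfolding distrib_right distrib_left by linarith
    finally show "\<bar>ln (Zw w)\<bar> \<le> (?K1 + ?K2) * (1 + norm w)" .
  qed
qed

lemma exp_growth_ln_Zw: "exp_growth (\<lambda>t w. ln (Zw w))"
proof (rule exp_growth_lin_growth[OF _ lin_growth_ln_Zw])
  show "continuous_on ({0..1} \<times> UNIV) (\<lambda>(t::real, w). ln (Zw w))"
    unfolding case_prod_unfold
    by (intro continuous_intros continuous_Zw) (simp_all add: Zw_nz)
qed

section \<open>Directional derivatives of the logarithm of Z\<close>

definition L1_base :: "_ \<Rightarrow> real \<Rightarrow> _ \<Rightarrow> real" where
  "L1_base b t w = s * \<beta> * (\<Sum>i=1..l. \<Sum>j=1..l. ell i j b * g0 i j t w)"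

text \<open>The second derivative of \<open>Zw\<close> in direction \<open>b\<close>, divided by
  \<open>Zw\<close>. Differentiating the power \<open>s\<close> of \<open>Cw\<close> twice gives the
  first sum, whose two replicas share the outer index \<open>i\<close>; the second derivative of
  \<open>Cw\<close> itself gives the other sum.\<close>

definition Q_base :: "_ \<Rightarrow> real \<Rightarrow> _ \<Rightarrow> real" where
  "Q_base b t w = s * (s - 1) * \<beta>\<^sup>2 * (\<Sum>i=1..l. \<Sum>j=1..l. \<Sum>j'=1..l. (ell i j b * ell i j' b) * g02 i j j' t w)
     + s * \<beta>\<^sup>2 * (\<Sum>i=1..l. \<Sum>j=1..l. (ell i j b)\<^sup>2 * g0 i j t w)"

lemma DERIV_ln_Cw:
  "((\<lambda>h. ln (Cw i (w + h *\<^sub>R b))) has_real_derivative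
     \<beta> * (\<Sum>j=1..l. ell i j b * (exp (\<beta> * ell i j w) / Cw i w))) (at 0)"
proof -
  have "((\<lambda>h. Cw i (w + h *\<^sub>R b)) has_real_derivative (\<Sum>j=1..l. \<beta> * ell i j b * exp (\<beta> * ell i j w))) (at 0)"
    unfolding Cw_def ell_line by (auto intro!: derivative_eq_intros sum.cong)
  moreover have "Cw i (w + 0 *\<^sub>R b) > 0" by (rule Cw_pos)
  ultimately have "((\<lambda>h. ln (Cw i (w + h *\<^sub>R b))) has_real_derivative
      1 / Cw i (w + 0 *\<^sub>R b) * (\<Sum>j=1..l. \<beta> * ell i j b * exp (\<beta> * ell i j w))) (at 0)"
    by (rule DERIV_chain2[OF DERIV_ln_divide, rotated])
  then show ?thesis by (rule DERIV_cong) (simp add: sum_distrib_left sum_divide_distrib mult.assoc)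
qed

lemma DERIV_ln_Zw: "((\<lambda>h. ln (Zw (w + h *\<^sub>R b))) has_real_derivative L1_base b t w) (at 0)"
proof -
  let ?E = "\<lambda>i. \<beta> * (\<Sum>j=1..l. ell i j b * (exp (\<beta> * ell i j w) / Cw i w))"
  have eq: "Zw w' = (\<Sum>i=1..l. exp (s * ln (Cw i w')))" for w'
    unfolding Zw_def using Cw_pos by (intro sum.cong) (auto simp: powr_def less_imp_neq[symmetric])
  have "((\<lambda>h. Zw (w + h *\<^sub>R b)) has_real_derivative (\<Sum>i=1..l. exp (s * ln (Cw i w)) * (s * ?E i))) (at 0)"
    unfolding eq
  proof (intro DERIV_sum)
    fix i
    show "((\<lambda>h. exp (s * ln (Cw i (w + h *\<^sub>R b)))) has_real_derivative exp (s * ln (Cw i w)) * (s * ?E i)) (at 0)"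
      using DERIV_fun_exp[OF DERIV_cmult[OF DERIV_ln_Cw[of i w b], of s]] by simp
  qed
  moreover have "Zw (w + 0 *\<^sub>R b) > 0" by (rule Zw_pos)
  ultimately have "((\<lambda>h. ln (Zw (w + h *\<^sub>R b))) has_real_derivative
      1 / Zw (w + 0 *\<^sub>R b) * (\<Sum>i=1..l. exp (s * ln (Cw i w)) * (s * ?E i))) (at 0)"
    by (rule DERIV_chain2[OF DERIV_ln_divide, rotated])
  then show ?thesis
  proof (rule DERIV_cong)
    have "exp (s * ln (Cw i w)) = Cw i w powr s" for i using Cw_pos[of i w] by (simp add: powr_def)
    then show "1 / Zw (w + 0 *\<^sub>R b) * (\<Sum>i=1..l. exp (s * ln (Cw i w)) * (s * ?E i)) = L1_base b t w"
      by (simp add: L1_base_def g0_def sum_distrib_left sum_divide_distrib ac_simps)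
  qed
qed

text \<open>Logarithmic differentiation of \<open>g0_exp\<close>. The contribution of
  \<open>ln (Cw i w)\<close> draws a second inner index and so turns \<open>g0\<close> into
  \<open>g02\<close>.\<close>

lemma DERIV_g0:
  "((\<lambda>h. g0 i j t (w + h *\<^sub>R b)) has_real_derivative
     g0 i j t w * (\<beta> * ell i j b - L1_base b t w) +
     (s - 1) * \<beta> * (\<Sum>j'=1..l. ell i j' b * g02 i j j' t w)) (at 0)"
proof -
  let ?E = "\<beta> * (\<Sum>j=1..l. ell i j b * (exp (\<beta> * ell i j w) / Cw i w))"
  have "((\<lambda>h. g0 i j t (w + h *\<^sub>R b)) has_real_derivative
      g0 i j t w * (\<beta> * ell i j b + (s - 1) * ?E - L1_base b t w)) (at 0)"
    unfolding g0_exp ell_line by (rule DERIV_ln_Cw DERIV_ln_Zw derivative_eq_intros | simp)+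
  moreover have "g0 i j t w * ?E = \<beta> * (\<Sum>j'=1..l. ell i j' b * g02 i j j' t w)"
    unfolding g0_mult[symmetric] by (simp add: sum_distrib_left ac_simps)
  ultimately show ?thesis by (auto elim!: DERIV_cong simp: algebra_simps)
qed

lemma heat_class_base: "heat_class (\<lambda>t w. ln (Zw w)) (\<lambda>t w. 0) L1_base (\<lambda>b t w. Q_base b t w - (L1_base b t w)\<^sup>2)"
  unfolding heat_class_def
proof (intro conjI ballI allI)
  fix b t w
  show "((\<lambda>h. ln (Zw (w + h *\<^sub>R b))) has_real_derivative L1_base b t w) (at 0)" by (rule DERIV_ln_Zw)
  have "((\<lambda>h. L1_base b t (w + h *\<^sub>R b)) has_real_derivative
     s * \<beta> * (\<Sum>i=1..l. \<Sum>j=1..l. ell i j b * (g0 i j t w * (\<beta> * ell i j b - L1_base b t w) +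
     (s - 1) * \<beta> * (\<Sum>j'=1..l. ell i j' b * g02 i j j' t w)))) (at 0)"
    unfolding L1_base_def[of b t "_ + _"] by (intro DERIV_cmult DERIV_sum DERIV_g0)
  \<comment> \<open>The sum multiplied by \<open>L1_base b t w\<close> is
    \<open>L1_base b t w\<close> again, which produces the square that is subtracted.\<close>
  moreover have "s * \<beta> * (\<Sum>i=1..l. \<Sum>j=1..l. ell i j b * (g0 i j t w * (\<beta> * ell i j b - L1_base b t w) +
     (s - 1) * \<beta> * (\<Sum>j'=1..l. ell i j' b * g02 i j j' t w))) =
     s * \<beta>\<^sup>2 * (\<Sum>i=1..l. \<Sum>j=1..l. (ell i j b)\<^sup>2 * g0 i j t w)
     - L1_base b t w * (s * \<beta> * (\<Sum>i=1..l. \<Sum>j=1..l. ell i j b * g0 i j t w))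
     + s * (s - 1) * \<beta>\<^sup>2 * (\<Sum>i=1..l. \<Sum>j=1..l. \<Sum>j'=1..l. (ell i j b * ell i j' b) * g02 i j j' t w)"
    by (simp add: sum_distrib_left sum.distrib[symmetric] sum_subtractf[symmetric] algebra_simps power2_eq_square)
  ultimately show "((\<lambda>h. L1_base b t (w + h *\<^sub>R b)) has_real_derivative Q_base b t w - (L1_base b t w)\<^sup>2) (at 0)"
    unfolding L1_base_def[symmetric] by (auto elim!: DERIV_cong simp: Q_base_def power2_eq_square)
next
  fix b
  show "exp_growth (L1_base b)" "exp_growth (\<lambda>t w. Q_base b t w - (L1_base b t w)\<^sup>2)"
    unfolding L1_base_def[abs_def] Q_base_def[abs_def] by (intro exp_growth_intros exp_growth_g0 exp_growth_g02 | assumption)+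
qed (auto intro: exp_growth_ln_Zw exp_growth_const)

subsection \<open>The hierarchy of averages\<close>

lemma p_nonneg: "k \<le> r + 1 \<Longrightarrow> 0 \<le> p k"
proof (induction rule: inc_induct)
  case (step k)
  then show ?case using p_decr[of k] by auto
qed (use p_last in simp)

lemma q_nonneg: "k \<le> r + 1 \<Longrightarrow> 0 \<le> q k"
proof (induction rule: inc_induct)
  case (step k)
  then show ?case using q_decr[of k] by auto
qed (use q_last in simp)

text \<open>Vanishing of the last two components singles out the basis directions of G and of the
  scalar u4, the ones scaled by \<open>sqrt t\<close>.\<close>

definition fwd :: "((real^'n^'m) \<times> ('n, 'm) block) set" where
  "fwd = {b. snd (snd b) = 0}"

text \<open>All steps act on the same space: up to step \<open>r\<close> the matrix part is the
  point mass at 0, and step \<open>r + 1\<close> averages over G as well.\<close>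

definition step_law :: "nat \<Rightarrow> ((real^'n^'m) \<times> ('n, 'm) block) measure" where
  "step_law k = (if k \<le> r then return borel 0 else normal_mat 1) \<Otimes>\<^sub>M block_law k"

text \<open>The nested zero tests follow \<open>gaussian_pair\<close> and locate the component to
  which a basis vector belongs.\<close>

definition step_var :: "nat \<Rightarrow> (real^'n^'m) \<times> ('n, 'm) block \<Rightarrow> real" where
  "step_var k = (\<lambda>(a, b). if b = 0 then (if k \<le> r then 0 else 1)
     else (\<lambda>(a, b). if b = 0 then p (k - 1) * q (k - 1) - p k * q k
     else (\<lambda>(a, b). if b = 0 then p (k - 1) - p k else q (k - 1) - q k) b) b)"

text \<open>For \<open>k \<le> r\<close> this is the signed variance of each coordinate still to be
  averaged in steps \<open>k + 1\<close> to \<open>r + 1\<close>; the differences telescope down to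
  the final value 0 of \<open>p\<close> and \<open>q\<close>, and G contributes its variance 1 in
  the last step.\<close>

definition V :: "nat \<Rightarrow> (real^'n^'m) \<times> ('n, 'm) block \<Rightarrow> real" where
  "V k = (\<lambda>(a, b). if b = 0 then 1
     else (\<lambda>(a, b). if b = 0 then p k * q k
     else (\<lambda>(a, b). if b = 0 then - p k else - q k) b) b)"

lemma gaussian_block_law:
  assumes "k \<in> {1..r+1}"
  shows "gaussian (block_law k) (\<lambda>(a, b). if b = 0 then p (k - 1) * q (k - 1) - p k * q k
     else (\<lambda>(a, b). if b = 0 then p (k - 1) - p k else q (k - 1) - q k) b)"
proof -
  have pd: "p k \<le> p (k - 1)" and qd: "q k \<le> q (k - 1)"
    using p_decr[of "k - 1"] q_decr[of "k - 1"] assms by auto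
  then have "p k * q k \<le> p (k - 1) * q (k - 1)"
    using p_nonneg q_nonneg assms by (intro mult_mono) auto
  with pd qd show ?thesis
    unfolding block_law_def by (intro gaussian_pair gaussian_centred_normal gaussian_normal_vec) auto
qed

lemma gaussian_step_law:
  assumes "k \<in> {1..r+1}"
  shows "gaussian (step_law k) (step_var k)"
proof -
  have "gaussian (if k \<le> r then return borel 0 else normal_mat 1 :: (real^'n^'m) measure) (\<lambda>_. if k \<le> r then 0 else 1)"
    by (auto intro: gaussian_return_0 gaussian_normal_mat)
  from gaussian_pair[OF this gaussian_block_law[OF assms]]
  show ?thesis by (simp add: step_law_def step_var_def)
qed

text \<open>The last step is separate: \<open>V (r + 1)\<close> is 1 and not 0 on the directions of
  G, so the difference formula would fail there.\<close>

lemma step_var_fwd: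
  assumes "b \<in> Basis"
  shows "k \<in> {1..r} \<Longrightarrow> (if b \<in> fwd then step_var k b else - step_var k b) = V (k - 1) b - V k b"
    and "(if b \<in> fwd then step_var (r + 1) b else - step_var (r + 1) b) = V r b"
  using assms nonzero_Basis p_last q_last by (auto simp: Basis_prod_def fwd_def step_var_def V_def zero_prod_def)

lemma ell_components:
  "ell i j (a, 0) = a \<bullet> (\<chi> k k'. y j $ k * x i $ k')"
  "ell i j (0, u, 0, 0) = u * (norm (x i) * norm (y j))"
  "ell i j (0, 0, v, 0) = norm (x i) * (y j \<bullet> v)"
  "ell i j (0, 0, 0, h) = norm (y j) * (x i \<bullet> h)"
  by (simp_all add: ell_def inner_matrix_vector zero_prod_def inner_commute)

text \<open>The four kinds of coordinates contribute the four terms of the expanded product. In each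
  vector-valued component the sum over the basis is Parseval's identity.\<close>

lemma sum_V_ell:
  "(\<Sum>b\<in>Basis. V k b * (ell i j b * ell i' j' b)) =
     (p k * norm (x i) * norm (x i') - x i' \<bullet> x i) * (q k * norm (y j) * norm (y j') - y j' \<bullet> y j)"
proof -
  have 1: "(\<Sum>b\<in>Basis. V k (b, 0) * (ell i j (b, 0) * ell i' j' (b, 0))) = (y j \<bullet> y j') * (x i \<bullet> x i')"
  proof -
    have "(\<Sum>b\<in>Basis. V k (b, 0) * (ell i j (b, 0) * ell i' j' (b, 0))) =
        (\<Sum>b\<in>Basis. ((\<chi> k k'. y j $ k * x i $ k') \<bullet> b) * ((\<chi> k k'. y j' $ k * x i' $ k') \<bullet> b))"
      by (simp add: V_def ell_components inner_commute)
    then show ?thesis by (simp add: euclidean_inner[symmetric] inner_outer)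
  qed
  have 2: "(\<Sum>b\<in>Basis. V k (0, b, 0) * (ell i j (0, b, 0) * ell i' j' (0, b, 0))) =
      p k * q k * (norm (x i) * norm (y j)) * (norm (x i') * norm (y j'))"
    by (simp add: V_def ell_components zero_prod_def)
  have 3: "(\<Sum>b\<in>Basis. V k (0, 0, b, 0) * (ell i j (0, 0, b, 0) * ell i' j' (0, 0, b, 0))) =
      - p k * (norm (x i) * norm (x i')) * (y j \<bullet> y j')"
  proof -
    have "(\<Sum>b\<in>Basis. V k (0, 0, b, 0) * (ell i j (0, 0, b, 0) * ell i' j' (0, 0, b, 0))) =
        (\<Sum>b\<in>Basis. (- p k * (norm (x i) * norm (x i'))) * ((y j \<bullet> b) * (y j' \<bullet> b)))"
      by (intro sum.cong) (auto simp: V_def ell_components zero_prod_def nonzero_Basis)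
    then show ?thesis by (simp only: sum_distrib_left[symmetric] euclidean_inner[of "y j" "y j'"])
  qed
  have 4: "(\<Sum>b\<in>Basis. V k (0, 0, 0, b) * (ell i j (0, 0, 0, b) * ell i' j' (0, 0, 0, b))) =
      - q k * (norm (y j) * norm (y j')) * (x i \<bullet> x i')"
  proof -
    have "(\<Sum>b\<in>Basis. V k (0, 0, 0, b) * (ell i j (0, 0, 0, b) * ell i' j' (0, 0, 0, b))) =
        (\<Sum>b\<in>Basis. (- q k * (norm (y j) * norm (y j'))) * ((x i \<bullet> b) * (x i' \<bullet> b)))"
      by (intro sum.cong) (auto simp: V_def ell_components zero_prod_def nonzero_Basis)
    then show ?thesis by (simp only: sum_distrib_left[symmetric] euclidean_inner[of "x i" "x i'"])
  qed
  show ?thesis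
    unfolding sum_Basis_prod[where f="\<lambda>b. V k b * (ell i j b * ell i' j' b)"]
      sum_Basis_prod[where f="\<lambda>b. V k (0, b) * (ell i j (0, b) * ell i' j' (0, b))"]
      sum_Basis_prod[where f="\<lambda>b. V k (0, 0, b) * (ell i j (0, 0, b) * ell i' j' (0, 0, b))"]
      1 2 3 4 inner_commute[of "x i'"] inner_commute[of "y j'"]
    by (simp add: algebra_simps)
qed

section \<open>The recursion for the logarithms and their derivatives\<close>

primrec log_zeta :: "nat \<Rightarrow> real \<Rightarrow> (real^'n^'m) \<times> ('n, 'm) block \<Rightarrow> real" where
  "log_zeta 0 = (\<lambda>t w. ln (Zw w))"
| "log_zeta (Suc k) = (\<lambda>t w. ln (gauss_avg fwd (step_law (Suc k)) (\<lambda>t w. exp (m (Suc k) * log_zeta k t w)) t w) / m (Suc k))"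

text \<open>The operator \<Phi> acting on functions of \<open>t\<close> and \<open>w\<close>:
  \<open>exp (m k * log_zeta (k - 1))\<close> is the power of zeta that serves as its density. The
  link is \<open>\<Phi>_lift_rv\<close>.\<close>

definition Phi :: "nat \<Rightarrow> (real \<Rightarrow> (real^'n^'m) \<times> ('n, 'm) block \<Rightarrow> real) \<Rightarrow> real \<Rightarrow> (real^'n^'m) \<times> ('n, 'm) block \<Rightarrow> real" where
  "Phi k = tilted_avg fwd (step_law k) (m k) (log_zeta (k - 1))"

primrec L1 :: "nat \<Rightarrow> (real^'n^'m) \<times> ('n, 'm) block \<Rightarrow> real \<Rightarrow> (real^'n^'m) \<times> ('n, 'm) block \<Rightarrow> real" where
  "L1 0 = L1_base"
| "L1 (Suc k) = (\<lambda>b. Phi (Suc k) (L1 k b))"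

primrec Q :: "nat \<Rightarrow> (real^'n^'m) \<times> ('n, 'm) block \<Rightarrow> real \<Rightarrow> (real^'n^'m) \<times> ('n, 'm) block \<Rightarrow> real" where
  "Q 0 = Q_base"
| "Q (Suc k) = (\<lambda>b. Phi (Suc k) (\<lambda>t w. Q k b t w - (m k - m (Suc k)) * (L1 k b t w)\<^sup>2))"

definition R :: "nat \<Rightarrow> real \<Rightarrow> (real^'n^'m) \<times> ('n, 'm) block \<Rightarrow> real" where
  "R k t w = (\<Sum>b\<in>Basis. V k b * (L1 k b t w)\<^sup>2)"

text \<open>\<open>ln (Zw w)\<close> has no time derivative of its own, so the start value consists
  of the second-order term alone.\<close>

primrec S :: "nat \<Rightarrow> real \<Rightarrow> (real^'n^'m) \<times> ('n, 'm) block \<Rightarrow> real" where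
  "S 0 = (\<lambda>t w. 1 / 2 * (\<Sum>b\<in>Basis. V 0 b * Q_base b t w))"
| "S (Suc k) = Phi (Suc k) (\<lambda>t w. S k t w - (m k - m (Suc k)) / 2 * R k t w)"

lemma exp_growth_base: "exp_growth (L1_base b)" "exp_growth (Q_base b)"
  unfolding L1_base_def[abs_def] Q_base_def[abs_def] by (intro exp_growth_intros exp_growth_g0 exp_growth_g02 | assumption)+

text \<open>Induction over the averaging steps with all derivatives and growth bounds carried along.
  Storing the time derivative as \<open>S\<close> minus half the \<open>V\<close>-weighted sum of
  \<open>Q\<close> is what makes the step close: the new signed variance is a difference of two
  values of \<open>V\<close>, the old one cancels the stored sum, and the new one rebuilds it at the
  next level.\<close>

lemma hierarchy:
  assumes "k \<le> r"
  shows "heat_class (log_zeta k) (\<lambda>t w. S k t w - 1 / 2 * (\<Sum>b\<in>Basis. V k b * Q k b t w)) (L1 k)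
      (\<lambda>b t w. Q k b t w - m k * (L1 k b t w)\<^sup>2) \<and> lin_growth (log_zeta k) \<and> exp_growth (S k) \<and>
      (\<forall>b\<in>Basis. exp_growth (L1 k b) \<and> exp_growth (Q k b))"
  using assms
proof (induction k)
  case 0
  have "exp_growth (S 0)" unfolding S.simps by (intro exp_growth_intros exp_growth_base)
  then show ?case using heat_class_base lin_growth_ln_Zw exp_growth_base by (simp add: m_0)
next
  case (Suc k)
  then have N: "heat_class (log_zeta k) (\<lambda>t w. S k t w - 1 / 2 * (\<Sum>b\<in>Basis. V k b * Q k b t w)) (L1 k)
      (\<lambda>b t w. Q k b t w - m k * (L1 k b t w)\<^sup>2)" and lg: "lin_growth (log_zeta k)" and S: "exp_growth (S k)"
    and LQ: "\<And>b. b \<in> Basis \<Longrightarrow> exp_growth (L1 k b)" "\<And>b. b \<in> Basis \<Longrightarrow> exp_growth (Q k b)" by auto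
  have k: "Suc k \<in> {1..r}" "Suc k \<in> {1..r+1}" using Suc by auto
  have mk: "m (Suc k) \<noteq> 0" by (rule m_nz[OF k(1)])
  note gauss = gaussian_step_law[OF k(2)]
  have log_zeta: "exp_growth (log_zeta k)" using heat_classD(1)[OF N] .
  have ePhi: "exp_growth (Phi (Suc k) g)" if "exp_growth g" for g
    unfolding Phi_def using exp_growth_tilted_avg[OF gauss log_zeta lg that] by simp
  have eR: "exp_growth (R k)" unfolding R_def[abs_def] by (intro exp_growth_intros LQ)
  let ?D = "\<lambda>b t w. Q k b t w - (m k - m (Suc k)) * (L1 k b t w)\<^sup>2"
  have eD: "b \<in> Basis \<Longrightarrow> exp_growth (?D b)" for b by (intro exp_growth_intros LQ)
  have D: "Q k b t w - m k * (L1 k b t w)\<^sup>2 + m (Suc k) * (L1 k b t w)\<^sup>2 = ?D b t w" for b t w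
    by (simp add: left_diff_distrib)
  let ?T = "\<lambda>t w. S k t w - 1 / 2 * (\<Sum>b\<in>Basis. V k b * Q k b t w)
     + (\<Sum>b\<in>Basis. (if b \<in> fwd then step_var (Suc k) b else - step_var (Suc k) b) / 2 * ?D b t w)"
  have heat_class: "heat_class (log_zeta (Suc k)) (Phi (Suc k) ?T) (L1 (Suc k)) (\<lambda>b t w. Q (Suc k) b t w - m (Suc k) * (L1 (Suc k) b t w)\<^sup>2)"
    using heat_class_tilted_avg(1)[OF gauss N lg mk, where P=fwd] unfolding D by (simp add: Phi_def)
  \<comment> \<open>The old part \<open>V k\<close> cancels the stored \<open>Q\<close> terms and
    leaves the source \<open>R k\<close> with factor \<open>(m k - m (Suc k)) / 2\<close>; the new
    part \<open>V (Suc k)\<close> stays as the sum to be stored next.\<close>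
  have T: "?T t w = (S k t w - (m k - m (Suc k)) / 2 * R k t w) - 1 / 2 * (\<Sum>b\<in>Basis. V (Suc k) b * ?D b t w)" for t w
  proof -
    have "(\<Sum>b\<in>Basis. (if b \<in> fwd then step_var (Suc k) b else - step_var (Suc k) b) / 2 * ?D b t w)
        = (\<Sum>b\<in>Basis. (V k b - V (Suc k) b) / 2 * ?D b t w)"
      using step_var_fwd(1)[OF _ k(1)] by (intro sum.cong) auto
    also have "\<dots> = 1 / 2 * (\<Sum>b\<in>Basis. V k b * Q k b t w) - (m k - m (Suc k)) / 2 * R k t w - 1 / 2 * (\<Sum>b\<in>Basis. V (Suc k) b * ?D b t w)"
      unfolding R_def sum_distrib_left sum_subtractf[symmetric]
      by (intro sum.cong refl) (simp add: field_simps)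
    finally show ?thesis by simp
  qed
  have PT: "Phi (Suc k) ?T t w = S (Suc k) t w - 1 / 2 * (\<Sum>b\<in>Basis. V (Suc k) b * Q (Suc k) b t w)"
    if t: "t \<in> {0..1}" for t w
  proof -
    have log_zeta': "exp_growth (log_zeta (Suc k - 1))" "lin_growth (log_zeta (Suc k - 1))" using log_zeta lg by simp_all
    have e: "exp_growth (\<lambda>t w. S k t w - (m k - m (Suc k)) / 2 * R k t w)" by (intro exp_growth_intros S eR)
    have eV: "exp_growth (\<lambda>t w. V (Suc k) b * ?D b t w)" if "b \<in> Basis" for b using eD[OF that] by (rule exp_growth_cmult)
    have "Phi (Suc k) ?T t w = Phi (Suc k) (\<lambda>t w. S k t w - (m k - m (Suc k)) / 2 * R k t w) t w
        - Phi (Suc k) (\<lambda>t w. 1 / 2 * (\<Sum>b\<in>Basis. V (Suc k) b * ?D b t w)) t w"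
      unfolding T Phi_def by (rule tilted_avg_diff[OF gauss log_zeta' t e]) (intro exp_growth_cmult[OF exp_growth_sum] eV)
    also have "Phi (Suc k) (\<lambda>t w. 1 / 2 * (\<Sum>b\<in>Basis. V (Suc k) b * ?D b t w)) t w
        = 1 / 2 * Phi (Suc k) (\<lambda>t w. \<Sum>b\<in>Basis. V (Suc k) b * ?D b t w) t w"
      unfolding Phi_def by (rule tilted_avg_cmult)
    also have "Phi (Suc k) (\<lambda>t w. \<Sum>b\<in>Basis. V (Suc k) b * ?D b t w) t w
        = (\<Sum>b\<in>Basis. Phi (Suc k) (\<lambda>t w. V (Suc k) b * ?D b t w) t w)"
      unfolding Phi_def by (rule tilted_avg_sum[OF gauss log_zeta' t]) (rule eV)
    finally show ?thesis by (simp add: Phi_def tilted_avg_cmult)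
  qed
  have "exp_growth (S (Suc k))" unfolding S.simps by (intro ePhi exp_growth_intros S eR)
  moreover have "exp_growth (Q (Suc k) b)" "exp_growth (L1 (Suc k) b)" if "b \<in> Basis" for b
    using that by (simp_all add: ePhi eD LQ)
  moreover have "lin_growth (log_zeta (Suc k))" using heat_class_tilted_avg(2)[OF gauss N lg mk, where P=fwd] by simp
  ultimately show ?case using heat_class_cong[OF heat_class PT] by blast
qed

lemma hierarchyD:
  assumes "k \<le> r"
  shows "exp_growth (log_zeta k)" "lin_growth (log_zeta k)" "exp_growth (S k)"
    "b \<in> Basis \<Longrightarrow> exp_growth (L1 k b)" "b \<in> Basis \<Longrightarrow> exp_growth (Q k b)" "exp_growth (R k)"
proof -
  note H = hierarchy[OF assms]
  show 1: "exp_growth (log_zeta k)" "lin_growth (log_zeta k)" "exp_growth (S k)"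
    and 2: "b \<in> Basis \<Longrightarrow> exp_growth (L1 k b)" "b \<in> Basis \<Longrightarrow> exp_growth (Q k b)" for b
    using H heat_classD(1) by blast+
  show "exp_growth (R k)" unfolding R_def[abs_def] by (intro exp_growth_intros 2)
qed

text \<open>The last average is taken without exponential and logarithm. Its signed variances are
  all that remains, namely \<open>V r\<close>, so the second-order terms cancel completely and only
  first derivatives survive in \<open>R r\<close>.\<close>

lemma outer_derivative:
  assumes t: "t \<in> {0..1}"
  shows "((\<lambda>t. gauss_avg fwd (step_law (r + 1)) (log_zeta r) t 0) has_real_derivative
     gauss_avg fwd (step_law (r + 1)) (\<lambda>t w. S r t w - m r / 2 * R r t w) t 0) (at t within {0..1})"
proof -
  let ?Q = "\<lambda>b t w. Q r b t w - m r * (L1 r b t w)\<^sup>2"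
  have N: "heat_class (log_zeta r) (\<lambda>t w. S r t w - 1 / 2 * (\<Sum>b\<in>Basis. V r b * Q r b t w)) (L1 r) ?Q"
    using hierarchy[of r] by blast
  have "S r t w - 1 / 2 * (\<Sum>b\<in>Basis. V r b * Q r b t w) +
      (\<Sum>b\<in>Basis. (if b \<in> fwd then step_var (r + 1) b else - step_var (r + 1) b) / 2 * ?Q b t w)
      = S r t w - m r / 2 * R r t w" for t w
  proof -
    have "(\<Sum>b\<in>Basis. (if b \<in> fwd then step_var (r + 1) b else - step_var (r + 1) b) / 2 * ?Q b t w)
        = (\<Sum>b\<in>Basis. V r b / 2 * ?Q b t w)"
      using step_var_fwd(2) by (intro sum.cong) auto
    also have "\<dots> = 1 / 2 * (\<Sum>b\<in>Basis. V r b * Q r b t w) - m r / 2 * R r t w"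
      unfolding R_def sum_distrib_left sum_subtractf[symmetric]
      by (intro sum.cong refl) (simp add: field_simps)
    finally show ?thesis by simp
  qed
  note eq = this
  have g: "gaussian (step_law (r + 1)) (step_var (r + 1))" by (rule gaussian_step_law) auto
  show ?thesis
    using heat_classD(5)[OF heat_class_gauss_avg[OF g N, of fwd] t, of 0] unfolding eq .
qed

section \<open>Linearity of the averages and unfolding of the recursion\<close>

lemma Phi_hyps:
  assumes "k \<in> {1..r}"
  shows "gaussian (step_law k) (step_var k)" "exp_growth (log_zeta (k - 1))" "lin_growth (log_zeta (k - 1))"
  using assms by (auto intro!: gaussian_step_law hierarchyD)

lemma exp_growth_Phi: "k \<in> {1..r} \<Longrightarrow> exp_growth g \<Longrightarrow> exp_growth (Phi k g)"
  unfolding Phi_def by (rule exp_growth_tilted_avg[OF Phi_hyps])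

lemma Phi_cmult: "Phi k (\<lambda>t w. a * g t w) t w = a * Phi k g t w"
  unfolding Phi_def by (rule tilted_avg_cmult)

lemma Phi_sum:
  assumes "k \<in> {1..r}" "t \<in> {0..1}" "\<And>i. i \<in> I \<Longrightarrow> exp_growth (g i)"
  shows "Phi k (\<lambda>t w. \<Sum>i\<in>I. g i t w) t w = (\<Sum>i\<in>I. Phi k (g i) t w)"
  unfolding Phi_def using assms by (intro tilted_avg_sum[OF Phi_hyps])

lemma Phi_diff:
  assumes "k \<in> {1..r}" "t \<in> {0..1}" "exp_growth f" "exp_growth g"
  shows "Phi k (\<lambda>t w. f t w - g t w) t w = Phi k f t w - Phi k g t w"
  unfolding Phi_def using assms by (intro tilted_avg_diff[OF Phi_hyps])

lemma Phi_cong: "(\<And>w. g t w = g' t w) \<Longrightarrow> Phi k g t w = Phi k g' t w"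
  unfolding Phi_def by (rule tilted_avg_cong)

definition Phi_chain :: "nat \<Rightarrow> nat \<Rightarrow> (real \<Rightarrow> (real^'n^'m) \<times> ('n, 'm) block \<Rightarrow> real) \<Rightarrow> real \<Rightarrow> (real^'n^'m) \<times> ('n, 'm) block \<Rightarrow> real" where
  "Phi_chain b a g = fold Phi [a..<Suc b] g"

lemma Phi_chain_empty: "b < a \<Longrightarrow> Phi_chain b a g = g"
  by (simp add: Phi_chain_def)

lemma Phi_chain_Suc: "a \<le> Suc b \<Longrightarrow> Phi_chain (Suc b) a g = Phi (Suc b) (Phi_chain b a g)"
  by (simp add: Phi_chain_def)

lemma exp_growth_Phi_chain: "a \<ge> 1 \<Longrightarrow> b \<le> r \<Longrightarrow> exp_growth g \<Longrightarrow> exp_growth (Phi_chain b a g)"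
proof (induction b)
  case (Suc b)
  then show ?case by (cases "a \<le> Suc b") (auto simp: Phi_chain_Suc Phi_chain_empty intro: exp_growth_Phi)
qed (simp add: Phi_chain_empty)

lemma Phi_chain_sum:
  assumes t: "t \<in> {0..1}" and a: "a \<ge> 1" and g: "\<And>i. i \<in> I \<Longrightarrow> exp_growth (g i)"
  shows "b \<le> r \<Longrightarrow> Phi_chain b a (\<lambda>t w. \<Sum>i\<in>I. c i * g i t w) t w = (\<Sum>i\<in>I. c i * Phi_chain b a (g i) t w)"
proof (induction b arbitrary: w)
  case 0
  then show ?case using a by (simp add: Phi_chain_empty)
next
  case (Suc b)
  show ?case
  proof (cases "a \<le> Suc b")
    case True
    have b: "Suc b \<in> {1..r}" "b \<le> r" using Suc by auto
    have e: "exp_growth (\<lambda>t w. c i * Phi_chain b a (g i) t w)" if "i \<in> I" for i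
      by (intro exp_growth_cmult exp_growth_Phi_chain a b g that)
    have "Phi_chain (Suc b) a (\<lambda>t w. \<Sum>i\<in>I. c i * g i t w) t w = Phi (Suc b) (\<lambda>t w. \<Sum>i\<in>I. c i * Phi_chain b a (g i) t w) t w"
      unfolding Phi_chain_Suc[OF True] by (rule Phi_cong) (rule Suc.IH[OF b(2)])
    also have "\<dots> = (\<Sum>i\<in>I. Phi (Suc b) (\<lambda>t w. c i * Phi_chain b a (g i) t w) t w)"
      by (rule Phi_sum[OF b(1) t]) (rule e)
    finally show ?thesis by (simp only: Phi_cmult Phi_chain_Suc[OF True])
  qed (simp add: Phi_chain_empty)
qed

text \<open>Step \<open>j\<close> injects a source built from \<open>R (j - 1)\<close>, which is
  then averaged by the operators \<open>j\<close> to \<open>k\<close>; the start value passes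
  through all of them.\<close>

lemma S_expand:
  assumes t: "t \<in> {0..1}"
  shows "k \<le> r \<Longrightarrow> S k t w = Phi_chain k 1 (S 0) t w - (\<Sum>j=1..k. (m (j - 1) - m j) / 2 * Phi_chain k j (R (j - 1)) t w)"
proof (induction k arbitrary: w)
  case 0
  show ?case by (simp add: Phi_chain_empty)
next
  case (Suc k)
  have k: "Suc k \<in> {1..r}" "k \<le> r" using Suc by auto
  let ?c = "\<lambda>j. (m (j - 1) - m j) / 2"
  let ?f = "\<lambda>t w. \<Sum>j=1..k. ?c j * Phi_chain k j (R (j - 1)) t w"
  have eP: "exp_growth (Phi_chain k 1 (S 0))" by (intro exp_growth_Phi_chain hierarchyD k) auto
  have eR: "exp_growth (\<lambda>t w. ?c j * Phi_chain k j (R (j - 1)) t w)" if "j \<in> {1..k}" for j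
    using that k by (intro exp_growth_cmult exp_growth_Phi_chain hierarchyD) auto
  have ef: "exp_growth ?f" by (rule exp_growth_sum) (rule eR)
  have eRk: "exp_growth (\<lambda>t w. ?c (Suc k) * R k t w)" by (intro exp_growth_cmult hierarchyD k)
  have "S (Suc k) t w = Phi (Suc k) (\<lambda>t w. (Phi_chain k 1 (S 0) t w - ?f t w) - ?c (Suc k) * R k t w) t w"
    unfolding S.simps(2) by (rule Phi_cong) (simp only: Suc.IH[OF k(2)] diff_Suc_1)
  also have "\<dots> = Phi (Suc k) (Phi_chain k 1 (S 0)) t w - Phi (Suc k) ?f t w - Phi (Suc k) (\<lambda>t w. ?c (Suc k) * R k t w) t w"
    by (simp only: Phi_diff[OF k(1) t exp_growth_diff[OF eP ef] eRk] Phi_diff[OF k(1) t eP ef])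
  also have "Phi (Suc k) ?f t w = (\<Sum>j=1..k. Phi (Suc k) (\<lambda>t w. ?c j * Phi_chain k j (R (j - 1)) t w) t w)"
    by (rule Phi_sum[OF k(1) t]) (rule eR)
  also have "\<dots> = (\<Sum>j=1..k. ?c j * Phi_chain (Suc k) j (R (j - 1)) t w)"
    by (intro sum.cong refl) (simp only: Phi_cmult, simp add: Phi_chain_Suc)
  also have "Phi (Suc k) (Phi_chain k 1 (S 0)) t w = Phi_chain (Suc k) 1 (S 0) t w" by (simp add: Phi_chain_Suc)
  also have "Phi (Suc k) (\<lambda>t w. ?c (Suc k) * R k t w) t w = ?c (Suc k) * Phi_chain (Suc k) (Suc k) (R k) t w"
    by (simp only: Phi_cmult, simp add: Phi_chain_Suc Phi_chain_empty)
  finally show ?case by simp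
qed

abbreviation (input) idx :: "(nat \<times> nat) set" where
  "idx \<equiv> {1..l} \<times> {1..l}"

lemma sum_idx: "(\<Sum>i=1..l. \<Sum>j=1..l. f i j) = (\<Sum>a\<in>idx. f (fst a) (snd a))"
  by (simp add: sum.cartesian_product case_prod_unfold)

definition gibbs :: "nat \<times> nat \<Rightarrow> real \<Rightarrow> (real^'n^'m) \<times> ('n, 'm) block \<Rightarrow> real" where
  "gibbs a = g0 (fst a) (snd a)"

definition field :: "nat \<times> nat \<Rightarrow> (real^'n^'m) \<times> ('n, 'm) block \<Rightarrow> real" where
  "field a = ell (fst a) (snd a)"

text \<open>The inner product of two fields weighted by the signed variances \<open>V k\<close>, as
  \<open>sum_V_field\<close> shows.\<close>

definition cov :: "nat \<Rightarrow> nat \<times> nat \<Rightarrow> nat \<times> nat \<Rightarrow> real" where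
  "cov k a a' = (p k * norm (x (fst a)) * norm (x (fst a')) - x (fst a') \<bullet> x (fst a)) *
     (q k * norm (y (snd a)) * norm (y (snd a')) - y (snd a') \<bullet> y (snd a))"

lemma sum_V_field: "(\<Sum>b\<in>Basis. V k b * (field a b * field a' b)) = cov k a a'"
  unfolding field_def cov_def by (rule sum_V_ell)

lemma exp_growth_gibbs: "a \<in> idx \<Longrightarrow> exp_growth (gibbs a)"
  unfolding gibbs_def by (auto intro: exp_growth_g0)

text \<open>At the base the gradient of the logarithm is a Gibbs mean of the field's coefficient
  along \<open>b\<close>, and every step averages it linearly.\<close>

lemma L1_expand:
  assumes t: "t \<in> {0..1}"
  shows "k \<le> r \<Longrightarrow> L1 k b t w = s * \<beta> * (\<Sum>a\<in>idx. field a b * Phi_chain k 1 (gibbs a) t w)"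
proof (induction k arbitrary: w)
  case 0
  then show ?case by (simp add: Phi_chain_empty L1_base_def sum_idx gibbs_def field_def del: One_nat_def)
next
  case (Suc k)
  have k: "Suc k \<in> {1..r}" "k \<le> r" using Suc by auto
  have e: "exp_growth (\<lambda>t w. field a b * Phi_chain k 1 (gibbs a) t w)" if "a \<in> idx" for a
    by (intro exp_growth_cmult exp_growth_Phi_chain exp_growth_gibbs k that) simp
  have "L1 (Suc k) b t w = Phi (Suc k) (\<lambda>t w. s * \<beta> * (\<Sum>a\<in>idx. field a b * Phi_chain k 1 (gibbs a) t w)) t w"
    unfolding L1.simps by (rule Phi_cong) (rule Suc.IH[OF k(2)])
  also have "\<dots> = s * \<beta> * Phi (Suc k) (\<lambda>t w. \<Sum>a\<in>idx. field a b * Phi_chain k 1 (gibbs a) t w) t w"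
    by (rule Phi_cmult)
  also have "Phi (Suc k) (\<lambda>t w. \<Sum>a\<in>idx. field a b * Phi_chain k 1 (gibbs a) t w) t w
      = (\<Sum>a\<in>idx. Phi (Suc k) (\<lambda>t w. field a b * Phi_chain k 1 (gibbs a) t w) t w)"
    by (rule Phi_sum[OF k(1) t]) (rule e)
  also have "\<dots> = (\<Sum>a\<in>idx. field a b * Phi_chain (Suc k) 1 (gibbs a) t w)"
    by (intro sum.cong refl) (simp only: Phi_cmult, simp add: Phi_chain_Suc)
  finally show ?case .
qed

text \<open>Squaring the mean produces a second replica with its own pair of indices. This is why
  the measure with subscript \<open>k + 1\<close> multiplies two weights that were averaged
  separately over the first \<open>k\<close> blocks.\<close>

lemma R_expand:
  assumes t: "t \<in> {0..1}" and k: "k \<le> r"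
  shows "R k t w = s\<^sup>2 * \<beta>\<^sup>2 * (\<Sum>z\<in>idx \<times> idx. cov k (fst z) (snd z) * (Phi_chain k 1 (gibbs (fst z)) t w * Phi_chain k 1 (gibbs (snd z)) t w))"
proof -
  let ?g = "\<lambda>a. Phi_chain k 1 (gibbs a) t w"
  have "V k b * (L1 k b t w)\<^sup>2 = s\<^sup>2 * \<beta>\<^sup>2 * (\<Sum>z\<in>idx \<times> idx. V k b * (field (fst z) b * field (snd z) b) * (?g (fst z) * ?g (snd z)))" for b
  proof -
    have "(\<Sum>a\<in>idx. field a b * ?g a)\<^sup>2 = (\<Sum>z\<in>idx \<times> idx. (field (fst z) b * ?g (fst z)) * (field (snd z) b * ?g (snd z)))"
      unfolding power2_eq_square sum_product by (simp add: sum.cartesian_product case_prod_unfold)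
    then show ?thesis unfolding L1_expand[OF t k] power_mult_distrib by (simp add: sum_distrib_left ac_simps)
  qed
  then have "R k t w = s\<^sup>2 * \<beta>\<^sup>2 * (\<Sum>b\<in>Basis. \<Sum>z\<in>idx \<times> idx. V k b * (field (fst z) b * field (snd z) b) * (?g (fst z) * ?g (snd z)))"
    unfolding R_def by (simp only: sum_distrib_left)
  also have "(\<Sum>b\<in>Basis. \<Sum>z\<in>idx \<times> idx. V k b * (field (fst z) b * field (snd z) b) * (?g (fst z) * ?g (snd z)))
      = (\<Sum>z\<in>idx \<times> idx. (\<Sum>b\<in>Basis. V k b * (field (fst z) b * field (snd z) b)) * (?g (fst z) * ?g (snd z)))"
    unfolding sum_distrib_right by (rule sum.swap)
  finally show ?thesis unfolding sum_V_field .
qed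

text \<open>Two overlaps occur: the replicas in \<open>g02\<close> share their first index, hence
  \<open>(fst (fst z), snd z)\<close>, and in the Gibbs sum the pair \<open>a\<close> meets
  itself.\<close>

lemma S_0_expand:
  "S 0 t w = 1 / 2 * (s * (s - 1) * \<beta>\<^sup>2 * (\<Sum>z\<in>idx \<times> {1..l}. cov 0 (fst z) (fst (fst z), snd z) * g02 (fst (fst z)) (snd (fst z)) (snd z) t w)
     + s * \<beta>\<^sup>2 * (\<Sum>a\<in>idx. cov 0 a a * gibbs a t w))"
proof -
  let ?A = "\<lambda>b. \<Sum>z\<in>idx \<times> {1..l}. (V 0 b * (field (fst z) b * field (fst (fst z), snd z) b)) * g02 (fst (fst z)) (snd (fst z)) (snd z) t w"
  let ?B = "\<lambda>b. \<Sum>a\<in>idx. (V 0 b * (field a b * field a b)) * gibbs a t w"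
  have "V 0 b * Q_base b t w = s * (s - 1) * \<beta>\<^sup>2 * ?A b + s * \<beta>\<^sup>2 * ?B b" for b
  proof -
    have "(\<Sum>i=1..l. \<Sum>j=1..l. \<Sum>j'=1..l. (ell i j b * ell i j' b) * g02 i j j' t w)
       = (\<Sum>z\<in>idx \<times> {1..l}. (field (fst z) b * field (fst (fst z), snd z) b) * g02 (fst (fst z)) (snd (fst z)) (snd z) t w)"
      unfolding sum_idx[where f="\<lambda>i j. \<Sum>j'=1..l. (ell i j b * ell i j' b) * g02 i j j' t w"]
      unfolding sum.cartesian_product by (simp add: case_prod_unfold field_def)
    then show ?thesis
      unfolding Q_base_def sum_idx[where f="\<lambda>i j. (ell i j b)\<^sup>2 * g0 i j t w"]
      by (simp add: field_def gibbs_def power2_eq_square distrib_left sum_distrib_left ac_simps)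
  qed
  note eq = this
  have "(\<Sum>b\<in>Basis. V 0 b * Q_base b t w) = s * (s - 1) * \<beta>\<^sup>2 * (\<Sum>b\<in>Basis. ?A b) + s * \<beta>\<^sup>2 * (\<Sum>b\<in>Basis. ?B b)"
    by (simp only: eq sum.distrib sum_distrib_left)
  also have "(\<Sum>b\<in>Basis. ?A b) = (\<Sum>z\<in>idx \<times> {1..l}. cov 0 (fst z) (fst (fst z), snd z) * g02 (fst (fst z)) (snd (fst z)) (snd z) t w)"
    by (subst sum.swap) (simp only: sum_V_field sum_distrib_right[symmetric])
  also have "(\<Sum>b\<in>Basis. ?B b) = (\<Sum>a\<in>idx. cov 0 a a * gibbs a t w)"
    by (subst sum.swap) (simp only: sum_V_field sum_distrib_right[symmetric])
  finally show ?thesis by simp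
qed

subsection \<open>Identification with the random quantities\<close>

lemma interp_fwd:
  "interp fwd t w = (sqrt t *\<^sub>R fst w, sqrt t * fst (snd w), sqrt (1 - t) *\<^sub>R fst (snd (snd w)), sqrt (1 - t) *\<^sub>R snd (snd (snd w)))"
proof (rule euclidean_eqI)
  fix b :: "(real^'n^'m) \<times> ('n, 'm) block" assume "b \<in> Basis"
  then show "interp fwd t w \<bullet> b = (sqrt t *\<^sub>R fst w, sqrt t * fst (snd w), sqrt (1 - t) *\<^sub>R fst (snd (snd w)), sqrt (1 - t) *\<^sub>R snd (snd (snd w))) \<bullet> b"
    unfolding interp_inner[OF \<open>b \<in> Basis\<close>]
    by (auto simp: Basis_prod_def fwd_def inner_prod_def zero_prod_def nonzero_Basis)
qed

text \<open>
  After \<open>k\<close> averaging steps the blocks \<open>1, \<dots>, k\<close> no longer occur, so a function of \<open>w\<close> is evaluated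
  at the sum of the remaining blocks only.
\<close>

definition lift_rv :: "real \<Rightarrow> (real \<Rightarrow> (real^'n^'m) \<times> ('n, 'm) block \<Rightarrow> real) \<Rightarrow> nat \<Rightarrow> ('n, 'm) rv" where
  "lift_rv t g k = (\<lambda>G U. g t (interp fwd t (G, \<Sum>i=Suc k..r+1. U i)))"

lemma A_lift_rv: "A t i j G U = exp (\<beta> * ell i j (interp fwd t (G, \<Sum>i=Suc 0..r+1. U i)))"
proof -
  have "D0 t i j G U = ell i j (interp fwd t (G, \<Sum>i=Suc 0..r+1. U i))"
    by (simp add: D0_def ell_def interp_fwd fst_sum snd_sum scaleR_matrix_vector_assoc[symmetric] ac_simps)
  then show ?thesis by (simp add: A_def)
qed

lemma C_lift_rv: "C t i G U = Cw i (interp fwd t (G, \<Sum>i=Suc 0..r+1. U i))"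
  by (simp add: C_def Cw_def A_lift_rv)

lemma Z_lift_rv: "Z t G U = Zw (interp fwd t (G, \<Sum>i=Suc 0..r+1. U i))"
  by (simp add: Z_def Zw_def C_lift_rv)

lemma \<gamma>0_lift_rv: "\<gamma>0 t i j = lift_rv t (g0 i j) 0"
  by (simp add: fun_eq_iff \<gamma>0_def lift_rv_def g0_def A_lift_rv C_lift_rv Z_lift_rv)

text \<open>Integrating out block \<open>Suc k\<close> is a Gaussian average centred at the scaled
  sum of the later blocks: \<open>interp\<close> is additive, and the point mass in
  \<open>step_law\<close> leaves G untouched.\<close>

lemma EU_lift_rv:
  assumes k: "Suc k \<le> r" and t: "t \<in> {0..1}" and g: "exp_growth g"
  shows "EU (Suc k) (lift_rv t g k) = lift_rv t (gauss_avg fwd (step_law (Suc k)) g) (Suc k)"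
proof (intro ext)
  fix G :: "real^'n^'m" and U :: "nat \<Rightarrow> ('n, 'm) block"
  let ?w = "(G, \<Sum>i=Suc (Suc k)..r+1. U i)"
  have k': "Suc k \<in> {1..r+1}" using k by auto
  \<comment> \<open>The updated block is the first summand, and the later blocks do not see the
    update.\<close>
  have s: "(\<Sum>i=Suc k..r+1. (U(Suc k := u)) i) = u + (\<Sum>i=Suc (Suc k)..r+1. U i)" for u
  proof -
    have "(\<Sum>i=Suc k..r+1. (U(Suc k := u)) i) = (U(Suc k := u)) (Suc k) + (\<Sum>i=Suc (Suc k)..r+1. (U(Suc k := u)) i)"
      using k by (intro sum.atLeast_Suc_atMost) auto
    also have "(\<Sum>i=Suc (Suc k)..r+1. (U(Suc k := u)) i) = (\<Sum>i=Suc (Suc k)..r+1. U i)"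
      by (intro sum.cong) auto
    finally show ?thesis by simp
  qed
  have i: "interp fwd t (G, u + v) = interp fwd t (G, v) + interp fwd t (0, u)" for u v
    by (simp add: interp_add[symmetric] add.commute)
  have step_law_eq: "step_law (Suc k) = return borel 0 \<Otimes>\<^sub>M block_law (Suc k)" using k by (simp add: step_law_def)
  have "lift_rv t (gauss_avg fwd (step_law (Suc k)) g) (Suc k) G U = (\<integral>u. g t (interp fwd t ?w + interp fwd t u) \<partial>step_law (Suc k))"
    by (simp add: lift_rv_def gauss_avg_def)
  also have "\<dots> = (\<integral>u. g t (interp fwd t ?w + interp fwd t (0, u)) \<partial>block_law (Suc k))"
    unfolding step_law_eq
  proof (rule integral_return_pair)
    show "prob_space (block_law (Suc k))" using gaussian_block_law[OF k'] by (simp add: gaussian_def)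
    show "integrable (return borel 0 \<Otimes>\<^sub>M block_law (Suc k)) (\<lambda>u. g t (interp fwd t ?w + interp fwd t u))"
      using gauss_avg_integrable[OF gaussian_step_law[OF k'] g t] unfolding step_law_eq .
    show "continuous_on UNIV (\<lambda>u. g t (interp fwd t ?w + interp fwd t u))"
      by (rule exp_growth_shift(1)[OF g t])
  qed
  also have "\<dots> = EU (Suc k) (lift_rv t g k) G U"
    unfolding EU_def lift_rv_def s i ..
  finally show "EU (Suc k) (lift_rv t g k) G U = lift_rv t (gauss_avg fwd (step_law (Suc k)) g) (Suc k) G U" ..
qed

text \<open>Writing zeta as \<open>exp (m k * log_zeta k)\<close> turns the power
  \<open>m (Suc k) / m k\<close> into a change of the coefficient, since \<open>m k\<close> is
  nonzero.\<close>

lemma \<zeta>_lift_rv: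
  assumes t: "t \<in> {0..1}"
  shows "k \<le> r \<Longrightarrow> \<zeta> t k = lift_rv t (\<lambda>t w. exp (m k * log_zeta k t w)) k"
proof (induction k)
  case 0
  show ?case by (simp add: fun_eq_iff lift_rv_def Z_lift_rv m_0 Zw_pos)
next
  case (Suc k)
  have k: "k \<le> r" "Suc k \<in> {1..r}" "Suc k \<in> {1..r+1}" using Suc by auto
  have mk: "m k \<noteq> 0" using m_0 m_nz[of k] k by (cases k) auto
  have mk': "m (Suc k) \<noteq> 0" using m_nz[OF k(2)] .
  have eq: "(\<lambda>G U. \<zeta> t k G U powr (m (Suc k) / m k)) = lift_rv t (\<lambda>t w. exp (m (Suc k) * log_zeta k t w)) k"
    unfolding Suc.IH[OF k(1)] using mk by (simp add: fun_eq_iff lift_rv_def powr_def)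
  have "\<zeta> t (Suc k) = lift_rv t (gauss_avg fwd (step_law (Suc k)) (\<lambda>t w. exp (m (Suc k) * log_zeta k t w))) (Suc k)"
    unfolding \<zeta>.simps eq using Suc by (intro EU_lift_rv t exp_growth_exp hierarchyD) auto
  also have "\<dots> = lift_rv t (\<lambda>t w. exp (m (Suc k) * log_zeta (Suc k) t w)) (Suc k)"
    using mk' gauss_avg_exp_bounds(1)[OF gaussian_step_law[OF k(3)] hierarchyD(1,2)[OF k(1)] t]
    by (simp add: fun_eq_iff lift_rv_def)
  finally show ?case .
qed

lemma \<Phi>_lift_rv:
  assumes k: "Suc k \<le> r" and t: "t \<in> {0..1}" and g: "exp_growth g"
  shows "\<Phi> t (Suc k) (lift_rv t g k) = lift_rv t (Phi (Suc k) g) (Suc k)"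
proof (intro ext)
  fix G :: "real^'n^'m" and U :: "nat \<Rightarrow> ('n, 'm) block"
  have k': "k \<le> r" "Suc k \<in> {1..r}" "Suc k \<in> {1..r+1}" using k by auto
  have mk: "m k \<noteq> 0" using m_0 m_nz[of k] k by (cases k) auto
  let ?M = "\<lambda>t w. exp (m (Suc k) * log_zeta k t w)"
  have M: "exp_growth ?M" by (intro exp_growth_exp hierarchyD k')
  have F: "\<zeta> t (Suc k) = lift_rv t (gauss_avg fwd (step_law (Suc k)) ?M) (Suc k)"
    using \<zeta>_lift_rv[OF t, of k] k' mk EU_lift_rv[OF k t M] by (simp add: lift_rv_def powr_def)
  \<comment> \<open>The normaliser does not contain block \<open>Suc k\<close>, so it can be taken
    out of the integral over that block.\<close>
  have F_upd: "\<zeta> t (Suc k) G (U(Suc k := u)) = \<zeta> t (Suc k) G U" for u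
  proof -
    have "(\<Sum>i=Suc (Suc k)..r+1. (U(Suc k := u)) i) = (\<Sum>i=Suc (Suc k)..r+1. U i)"
      by (intro sum.cong) auto
    then show ?thesis unfolding F lift_rv_def by (simp only:)
  qed
  have M_eq: "\<zeta> t k G U powr (m (Suc k) / m k) = lift_rv t ?M k G U" for G U
    using \<zeta>_lift_rv[OF t, of k] k' mk by (simp add: lift_rv_def powr_def)
  have "\<Phi> t (Suc k) (lift_rv t g k) G U = (\<integral>u. lift_rv t (\<lambda>t w. ?M t w * g t w) k G (U(Suc k := u)) / \<zeta> t (Suc k) G U \<partial>block_law (Suc k))"
    unfolding \<Phi>_def EU_def F_upd diff_Suc_1 M_eq by (simp add: lift_rv_def)
  also have "\<dots> = EU (Suc k) (lift_rv t (\<lambda>t w. ?M t w * g t w) k) G U / \<zeta> t (Suc k) G U"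
    by (simp add: EU_def)
  also have "\<dots> = lift_rv t (gauss_avg fwd (step_law (Suc k)) (\<lambda>t w. ?M t w * g t w)) (Suc k) G U / \<zeta> t (Suc k) G U"
    by (simp only: EU_lift_rv[OF k t exp_growth_mult[OF M g]])
  finally show "\<Phi> t (Suc k) (lift_rv t g k) G U = lift_rv t (Phi (Suc k) g) (Suc k) G U"
    by (simp only: F lift_rv_def Phi_def tilted_avg_def diff_Suc_1)
qed

lemma \<Phi>_prod_lift_rv:
  assumes t: "t \<in> {0..1}" and g: "exp_growth g"
  shows "a \<le> b \<Longrightarrow> b \<le> r \<Longrightarrow> \<Phi>_prod t b (Suc a) (lift_rv t g a) = lift_rv t (Phi_chain b (Suc a) g) b"
proof (induction b)
  case 0
  then show ?case by (simp add: \<Phi>_prod_def Phi_chain_empty)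
next
  case (Suc b)
  show ?case
  proof (cases "a = Suc b")
    case True
    then show ?thesis by (simp add: \<Phi>_prod_def Phi_chain_empty)
  next
    case False
    then have ab: "a \<le> b" "b \<le> r" "Suc b \<le> r" using Suc.prems by auto
    have "\<Phi>_prod t (Suc b) (Suc a) (lift_rv t g a) = \<Phi> t (Suc b) (\<Phi>_prod t b (Suc a) (lift_rv t g a))"
      using ab by (simp add: \<Phi>_prod_def)
    also have "\<dots> = lift_rv t (Phi (Suc b) (Phi_chain b (Suc a) g)) (Suc b)"
      unfolding Suc.IH[OF ab(1,2)] by (intro \<Phi>_lift_rv t exp_growth_Phi_chain g ab) auto
    finally show ?thesis using ab by (simp add: Phi_chain_Suc)
  qed
qed

text \<open>At level \<open>r\<close> the sum of remaining blocks is block \<open>r + 1\<close>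
  alone, so nothing is left outside the average and the base point is 0.\<close>

lemma E_outer_lift_rv: "E_outer (lift_rv t g r) = gauss_avg fwd (step_law (r + 1)) g t 0"
  by (simp add: E_outer_def lift_rv_def gauss_avg_def step_law_def case_prod_unfold)

lemma gauss_avg_outer_sum:
  assumes "t \<in> {0..1}" "\<And>i. i \<in> I \<Longrightarrow> exp_growth (g i)"
  shows "gauss_avg fwd (step_law (r + 1)) (\<lambda>t w. \<Sum>i\<in>I. g i t w) t w = (\<Sum>i\<in>I. gauss_avg fwd (step_law (r + 1)) (g i) t w)"
  by (rule gauss_avg_sum[OF gaussian_step_law]) (use assms in auto)

lemma \<gamma>_lift_rv:
  assumes t: "t \<in> {0..1}" and k: "k \<in> {1..r+1}" and ij: "a \<in> idx" "a' \<in> idx"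
  shows "\<gamma> t k (fst a) (snd a) (fst a') (snd a') =
     lift_rv t (Phi_chain r k (\<lambda>t w. Phi_chain (k - 1) 1 (gibbs a) t w * Phi_chain (k - 1) 1 (gibbs a') t w)) r"
proof -
  obtain k' where k': "k = Suc k'" "k' \<le> r" using k by (cases k) auto
  have e: "exp_growth (gibbs a)" if "a \<in> idx" for a by (rule exp_growth_gibbs[OF that])
  have 1: "\<Phi>_prod t k' 1 (\<gamma>0 t (fst a) (snd a)) = lift_rv t (Phi_chain k' 1 (gibbs a)) k'" if "a \<in> idx" for a
    using \<Phi>_prod_lift_rv[OF t e[OF that], of 0 k'] k' by (simp add: \<gamma>0_lift_rv gibbs_def)
  have "\<gamma> t k (fst a) (snd a) (fst a') (snd a') =
      \<Phi>_prod t r (Suc k') (lift_rv t (\<lambda>t w. Phi_chain k' 1 (gibbs a) t w * Phi_chain k' 1 (gibbs a') t w) k')"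
    unfolding \<gamma>_def k' diff_Suc_1 1[OF ij(1)] 1[OF ij(2)] by (simp add: lift_rv_def)
  also have "\<dots> = lift_rv t (Phi_chain r (Suc k') (\<lambda>t w. Phi_chain k' 1 (gibbs a) t w * Phi_chain k' 1 (gibbs a') t w)) r"
    by (rule \<Phi>_prod_lift_rv[OF t _ k'(2) order_refl]) (intro exp_growth_mult exp_growth_Phi_chain e ij k', auto)
  finally show ?thesis by (simp add: k')
qed

section \<open>Identification of the terms and assembly of the derivative\<close>

lemma Phi_chain_cong:
  assumes "\<And>w. g t w = g' t w"
  shows "Phi_chain b a g t w = Phi_chain b a g' t w"
proof (induction b arbitrary: w)
  case 0
  then show ?case using assms by (cases a) (auto simp: Phi_chain_def intro: Phi_cong)
next
  case (Suc b)
  show ?case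
  proof (cases "a \<le> Suc b")
    case True
    then show ?thesis using Suc.IH by (simp add: Phi_chain_Suc Phi_cong[of "Phi_chain b a g" t "Phi_chain b a g'"])
  qed (simp add: Phi_chain_empty assms)
qed

lemma gauss_avg_cong: "(\<And>w. g t w = g' t w) \<Longrightarrow> gauss_avg fwd \<mu> g t w = gauss_avg fwd \<mu> g' t w"
  by (simp add: gauss_avg_def)

text \<open>The expansion of \<open>R\<close> carries \<open>s\<^sup>2 * \<beta>\<^sup>2\<close>,
  and \<phi> itself carries \<open>- s\<close>; one factor \<open>s\<close> remains, with the
  opposite sign.\<close>

lemma \<phi>_eq:
  assumes t: "t \<in> {0..1}" and k: "k \<in> {1..r+1}"
  shows "(m (k - 1) - m k) * gauss_avg fwd (step_law (r + 1)) (Phi_chain r k (R (k - 1))) t 0 = - (s * \<beta>\<^sup>2 * \<phi> t k)"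
proof -
  let ?h = "\<lambda>z t w. Phi_chain (k - 1) 1 (gibbs (fst z)) t w * Phi_chain (k - 1) 1 (gibbs (snd z)) t w"
  let ?X = "\<lambda>t w. \<Sum>z\<in>idx \<times> idx. cov (k - 1) (fst z) (snd z) * Phi_chain r k (?h z) t w"
  have k1: "k - 1 \<le> r" "1 \<le> k" using k by auto
  have eh: "exp_growth (?h z)" if "z \<in> idx \<times> idx" for z
    using that k1 by (intro exp_growth_mult exp_growth_Phi_chain exp_growth_gibbs) auto
  have "Phi_chain r k (R (k - 1)) t w = s\<^sup>2 * \<beta>\<^sup>2 * ?X t w" for w
  proof -
    have "Phi_chain r k (R (k - 1)) t w = Phi_chain r k (\<lambda>t w. \<Sum>z\<in>idx \<times> idx. (s\<^sup>2 * \<beta>\<^sup>2 * cov (k - 1) (fst z) (snd z)) * ?h z t w) t w"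
      by (rule Phi_chain_cong) (simp only: R_expand[OF t k1(1)] sum_distrib_left mult.assoc)
    also have "\<dots> = (\<Sum>z\<in>idx \<times> idx. (s\<^sup>2 * \<beta>\<^sup>2 * cov (k - 1) (fst z) (snd z)) * Phi_chain r k (?h z) t w)"
      by (rule Phi_chain_sum[OF t k1(2) _ order_refl]) (rule eh)
    also have "\<dots> = s\<^sup>2 * \<beta>\<^sup>2 * ?X t w" by (simp only: sum_distrib_left mult.assoc)
    finally show ?thesis .
  qed
  note eq = this
  have "gauss_avg fwd (step_law (r + 1)) (Phi_chain r k (R (k - 1))) t 0 = gauss_avg fwd (step_law (r + 1)) (\<lambda>t w. s\<^sup>2 * \<beta>\<^sup>2 * ?X t w) t 0"
    by (rule gauss_avg_cong) (rule eq)
  also have "\<dots> = s\<^sup>2 * \<beta>\<^sup>2 * gauss_avg fwd (step_law (r + 1)) ?X t 0" by (rule gauss_avg_cmult)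
  finally have 1: "gauss_avg fwd (step_law (r + 1)) (Phi_chain r k (R (k - 1))) t 0 = s\<^sup>2 * \<beta>\<^sup>2 * gauss_avg fwd (step_law (r + 1)) ?X t 0" .
  have "(\<lambda>G U. \<Sum>i1=1..l. \<Sum>i2=1..l. \<Sum>p1=1..l. \<Sum>p2=1..l. \<gamma> t k i1 i2 p1 p2 G U *
       ((p (k - 1) * norm (x i1) * norm (x p1) - x p1 \<bullet> x i1)
        * (q (k - 1) * norm (y i2) * norm (y p2) - y p2 \<bullet> y i2))) = lift_rv t ?X r"
  proof (intro ext)
    fix G :: "real^'n^'m" and U :: "nat \<Rightarrow> ('n, 'm) block"
    have "(\<Sum>i1=1..l. \<Sum>i2=1..l. \<Sum>p1=1..l. \<Sum>p2=1..l. \<gamma> t k i1 i2 p1 p2 G U *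
       ((p (k - 1) * norm (x i1) * norm (x p1) - x p1 \<bullet> x i1)
        * (q (k - 1) * norm (y i2) * norm (y p2) - y p2 \<bullet> y i2)))
      = (\<Sum>a\<in>idx. \<Sum>a'\<in>idx. \<gamma> t k (fst a) (snd a) (fst a') (snd a') G U * cov (k - 1) a a')"
      by (simp only: sum_idx cov_def)
    also have "\<dots> = (\<Sum>a\<in>idx. \<Sum>a'\<in>idx. cov (k - 1) a a' * lift_rv t (Phi_chain r k (?h (a, a'))) r G U)"
    proof (intro sum.cong refl)
      fix a a' assume "a \<in> idx" "a' \<in> idx"
      from \<gamma>_lift_rv[OF t k this]
      show "\<gamma> t k (fst a) (snd a) (fst a') (snd a') G U * cov (k - 1) a a' = cov (k - 1) a a' * lift_rv t (Phi_chain r k (?h (a, a'))) r G U"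
        by (simp only: fst_conv snd_conv) (rule mult.commute)
    qed
    also have "\<dots> = lift_rv t ?X r G U"
      unfolding lift_rv_def sum.cartesian_product by (simp add: case_prod_unfold)
    finally show "(\<Sum>i1=1..l. \<Sum>i2=1..l. \<Sum>p1=1..l. \<Sum>p2=1..l. \<gamma> t k i1 i2 p1 p2 G U *
       ((p (k - 1) * norm (x i1) * norm (x p1) - x p1 \<bullet> x i1)
        * (q (k - 1) * norm (y i2) * norm (y p2) - y p2 \<bullet> y i2))) = lift_rv t ?X r G U" .
  qed
  then have 2: "\<phi> t k = - s * (m (k - 1) - m k) * gauss_avg fwd (step_law (r + 1)) ?X t 0"
    by (simp only: \<phi>_def E_outer_lift_rv)
  have "a * (s\<^sup>2 * \<beta>\<^sup>2 * e) = - (s * \<beta>\<^sup>2 * (- s * a * e))" for a e :: real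
    by (simp add: power2_eq_square)
  then show ?thesis unfolding 1 2 .
qed

text \<open>For a pair compared with itself both factors of \<open>cov\<close> reduce to squared
  norms, and their two minus signs cancel.\<close>

lemma \<phi>01_eq:
  assumes t: "t \<in> {0..1}"
  shows "gauss_avg fwd (step_law (r + 1)) (Phi_chain r 1 (\<lambda>t w. \<Sum>a\<in>idx. cov 0 a a * gibbs a t w)) t 0 = \<phi>01 t"
proof -
  let ?X = "\<lambda>t w. \<Sum>a\<in>idx. ((norm (x (fst a)))\<^sup>2 * (norm (y (snd a)))\<^sup>2) * Phi_chain r 1 (gibbs a) t w"
  have c: "cov 0 a a = (1 - p 0) * (1 - q 0) * ((norm (x (fst a)))\<^sup>2 * (norm (y (snd a)))\<^sup>2)" for a
    by (simp add: cov_def power2_norm_eq_inner[symmetric] power2_eq_square algebra_simps)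
  have "Phi_chain r 1 (\<lambda>t w. \<Sum>a\<in>idx. cov 0 a a * gibbs a t w) t w = ((1 - p 0) * (1 - q 0)) * ?X t w" for w
  proof -
    have "Phi_chain r 1 (\<lambda>t w. \<Sum>a\<in>idx. cov 0 a a * gibbs a t w) t w = (\<Sum>a\<in>idx. cov 0 a a * Phi_chain r 1 (gibbs a) t w)"
      by (rule Phi_chain_sum[OF t _ _ order_refl]) (simp, rule exp_growth_gibbs)
    also have "\<dots> = ((1 - p 0) * (1 - q 0)) * ?X t w" by (simp only: c sum_distrib_left mult.assoc)
    finally show ?thesis .
  qed
  note eq = this
  have "gauss_avg fwd (step_law (r + 1)) (Phi_chain r 1 (\<lambda>t w. \<Sum>a\<in>idx. cov 0 a a * gibbs a t w)) t 0 =
      gauss_avg fwd (step_law (r + 1)) (\<lambda>t w. ((1 - p 0) * (1 - q 0)) * ?X t w) t 0"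
    by (rule gauss_avg_cong) (rule eq)
  also have "\<dots> = (1 - p 0) * (1 - q 0) * gauss_avg fwd (step_law (r + 1)) ?X t 0" by (rule gauss_avg_cmult)
  also have "\<dots> = \<phi>01 t"
  proof -
    have g: "\<gamma>01 t (fst a) (snd a) = lift_rv t (Phi_chain r 1 (gibbs a)) r" if "a \<in> idx" for a
      using \<Phi>_prod_lift_rv[OF t exp_growth_gibbs[OF that], of 0 r] by (simp add: \<gamma>01_def \<gamma>0_lift_rv gibbs_def)
    have "(\<Sum>i1=1..l. \<Sum>i2=1..l. \<gamma>01 t i1 i2 G U * ((norm (x i1))\<^sup>2 * (norm (y i2))\<^sup>2)) = lift_rv t ?X r G U" for G U
      unfolding sum_idx lift_rv_def by (intro sum.cong refl) (simp add: g lift_rv_def mult.commute)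
    then show ?thesis unfolding \<phi>01_def by (simp only: E_outer_lift_rv)
  qed
  finally show ?thesis .
qed

text \<open>For a shared first index only the first factor of \<open>cov\<close> reduces, to
  \<open>- (1 - p 0)\<close> times a squared norm. This is the origin of the minus sign in
  \<open>\<phi>02\<close>.\<close>

lemma \<phi>02_eq:
  assumes t: "t \<in> {0..1}"
  shows "(s - 1) * gauss_avg fwd (step_law (r + 1)) (Phi_chain r 1 (\<lambda>t w. \<Sum>z\<in>idx \<times> {1..l}.
      cov 0 (fst z) (fst (fst z), snd z) * g02 (fst (fst z)) (snd (fst z)) (snd z) t w)) t 0 = \<phi>02 t"
proof -
  let ?g = "\<lambda>z. g02 (fst (fst z)) (snd (fst z)) (snd z)"
  let ?n = "\<lambda>z. (norm (x (fst (fst z))))\<^sup>2 * (q 0 * norm (y (snd (fst z))) * norm (y (snd z)) - y (snd z) \<bullet> y (snd (fst z)))"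
  let ?X = "\<lambda>t w. \<Sum>z\<in>idx \<times> {1..l}. ?n z * Phi_chain r 1 (?g z) t w"
  have e: "exp_growth (?g z)" if "z \<in> idx \<times> {1..l}" for z using that by (intro exp_growth_g02) auto
  have c: "cov 0 (fst z) (fst (fst z), snd z) = - (1 - p 0) * ?n z" for z
    by (simp add: cov_def power2_norm_eq_inner[symmetric] power2_eq_square algebra_simps)
  have "Phi_chain r 1 (\<lambda>t w. \<Sum>z\<in>idx \<times> {1..l}. cov 0 (fst z) (fst (fst z), snd z) * ?g z t w) t w = (- (1 - p 0)) * ?X t w" for w
  proof -
    have "Phi_chain r 1 (\<lambda>t w. \<Sum>z\<in>idx \<times> {1..l}. cov 0 (fst z) (fst (fst z), snd z) * ?g z t w) t w
        = (\<Sum>z\<in>idx \<times> {1..l}. cov 0 (fst z) (fst (fst z), snd z) * Phi_chain r 1 (?g z) t w)"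
      by (rule Phi_chain_sum[OF t _ _ order_refl]) (simp, rule e)
    also have "\<dots> = (- (1 - p 0)) * ?X t w" by (simp only: c sum_distrib_left mult.assoc)
    finally show ?thesis .
  qed
  note eq = this
  have "gauss_avg fwd (step_law (r + 1)) (Phi_chain r 1 (\<lambda>t w. \<Sum>z\<in>idx \<times> {1..l}. cov 0 (fst z) (fst (fst z), snd z) * ?g z t w)) t 0 =
      gauss_avg fwd (step_law (r + 1)) (\<lambda>t w. (- (1 - p 0)) * ?X t w) t 0"
    by (rule gauss_avg_cong) (rule eq)
  also have "\<dots> = - (1 - p 0) * gauss_avg fwd (step_law (r + 1)) ?X t 0" by (rule gauss_avg_cmult)
  finally have 1: "gauss_avg fwd (step_law (r + 1)) (Phi_chain r 1 (\<lambda>t w. \<Sum>z\<in>idx \<times> {1..l}. cov 0 (fst z) (fst (fst z), snd z) * ?g z t w)) t 0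
      = - (1 - p 0) * gauss_avg fwd (step_law (r + 1)) ?X t 0" .
  have g: "\<gamma>02 t (fst (fst z)) (snd (fst z)) (snd z) = lift_rv t (Phi_chain r 1 (?g z)) r" if "z \<in> idx \<times> {1..l}" for z
  proof -
    have "\<gamma>02 t (fst (fst z)) (snd (fst z)) (snd z) = \<Phi>_prod t r 1 (lift_rv t (?g z) 0)"
      unfolding \<gamma>02_def by (simp add: lift_rv_def g02_def A_lift_rv C_lift_rv Z_lift_rv)
    then show ?thesis using \<Phi>_prod_lift_rv[OF t e[OF that], of 0 r] by simp
  qed
  have "(\<Sum>i1=1..l. \<Sum>i2=1..l. \<Sum>p2=1..l. \<gamma>02 t i1 i2 p2 G U *
       ((norm (x i1))\<^sup>2 * (q 0 * norm (y i2) * norm (y p2) - y p2 \<bullet> y i2))) = lift_rv t ?X r G U" for G U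
  proof -
    have "(\<Sum>i1=1..l. \<Sum>i2=1..l. \<Sum>p2=1..l. \<gamma>02 t i1 i2 p2 G U *
       ((norm (x i1))\<^sup>2 * (q 0 * norm (y i2) * norm (y p2) - y p2 \<bullet> y i2)))
      = (\<Sum>a\<in>idx. \<Sum>p2=1..l. \<gamma>02 t (fst a) (snd a) p2 G U *
       ((norm (x (fst a)))\<^sup>2 * (q 0 * norm (y (snd a)) * norm (y p2) - y p2 \<bullet> y (snd a))))"
      by (rule sum_idx)
    also have "\<dots> = (\<Sum>z\<in>idx \<times> {1..l}. \<gamma>02 t (fst (fst z)) (snd (fst z)) (snd z) G U * ?n z)"
      unfolding sum.cartesian_product by (simp add: case_prod_unfold)
    also have "\<dots> = (\<Sum>z\<in>idx \<times> {1..l}. ?n z * lift_rv t (Phi_chain r 1 (?g z)) r G U)"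
      by (intro sum.cong refl) (simp only: g mult.commute)
    finally show ?thesis by (simp only: lift_rv_def)
  qed
  then have 2: "\<phi>02 t = - (s - 1) * (1 - p 0) * gauss_avg fwd (step_law (r + 1)) ?X t 0"
    unfolding \<phi>02_def by (simp only: E_outer_lift_rv)
  have "(s - 1) * (- (1 - p 0) * e) = - (s - 1) * (1 - p 0) * e" for e by (simp add: algebra_simps)
  then show ?thesis unfolding 1 2 .
qed

lemma outer_value:
  assumes t: "t \<in> {0..1}"
  shows "gauss_avg fwd (step_law (r + 1)) (\<lambda>t w. S r t w - m r / 2 * R r t w) t 0 =
    s * \<beta>\<^sup>2 / 2 * ((\<Sum>k=1..r+1. \<phi> t k) + \<phi>01 t + \<phi>02 t)"
proof -
  let ?E = "\<lambda>g. gauss_avg fwd (step_law (r + 1)) g t 0"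
  let ?U1 = "\<lambda>t w. \<Sum>a\<in>idx. cov 0 a a * gibbs a t w"
  let ?U2 = "\<lambda>t w. \<Sum>z\<in>idx \<times> {1..l}. cov 0 (fst z) (fst (fst z), snd z) * g02 (fst (fst z)) (snd (fst z)) (snd z) t w"
  let ?c = "\<lambda>j. (m (j - 1) - m j) / 2"
  have g: "gaussian (step_law (r + 1)) (step_var (r + 1))" by (rule gaussian_step_law) auto
  have eU1: "exp_growth ?U1" by (intro exp_growth_sum exp_growth_cmult exp_growth_gibbs)
  have eU2: "exp_growth ?U2" by (intro exp_growth_sum exp_growth_cmult exp_growth_g02) auto
  \<comment> \<open>The two parts of \<open>S 0\<close> are written as a sum over the booleans, so
    that \<open>Phi_chain_sum\<close> and \<open>gauss_avg_outer_sum\<close> apply to them.\<close>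
  have sum_bool: "(\<Sum>b\<in>UNIV. f b) = f False + f True" for f :: "bool \<Rightarrow> real" by (simp add: UNIV_bool)
  let ?cc = "\<lambda>b. if b then s * \<beta>\<^sup>2 / 2 else s * (s - 1) * \<beta>\<^sup>2 / 2" and ?UU = "\<lambda>b. if b then ?U1 else ?U2"
  have eUU: "exp_growth (?UU b)" for b using eU1 eU2 by simp
  have S0: "S 0 t w = (\<Sum>b\<in>UNIV. ?cc b * ?UU b t w)" for w
  proof -
    have "1 / 2 * (s * (s - 1) * \<beta>\<^sup>2 * v + s * \<beta>\<^sup>2 * u) = s * (s - 1) * \<beta>\<^sup>2 / 2 * v + s * \<beta>\<^sup>2 / 2 * u" for u v :: real
      by (simp add: distrib_left)
    then show ?thesis unfolding S_0_expand sum_bool if_True if_False .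
  qed
  have PS: "Phi_chain r 1 (S 0) t w = (\<Sum>b\<in>UNIV. ?cc b * Phi_chain r 1 (?UU b) t w)" for w
  proof -
    have "Phi_chain r 1 (S 0) t w = Phi_chain r 1 (\<lambda>t w. \<Sum>b\<in>UNIV. ?cc b * ?UU b t w) t w"
      by (rule Phi_chain_cong) (rule S0)
    also have "\<dots> = (\<Sum>b\<in>UNIV. ?cc b * Phi_chain r 1 (?UU b) t w)"
      by (rule Phi_chain_sum[OF t _ _ order_refl]) (simp, rule eUU)
    finally show ?thesis .
  qed
  have eP: "exp_growth (\<lambda>t w. ?cc b * Phi_chain r 1 (?UU b) t w)" for b by (intro exp_growth_cmult exp_growth_Phi_chain eUU) auto
  have eR: "exp_growth (\<lambda>t w. ?c j * Phi_chain r j (R (j - 1)) t w)" if "j \<in> {1..r+1}" for j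
    using that by (intro exp_growth_cmult exp_growth_Phi_chain hierarchyD) auto
  \<comment> \<open>The extra term with \<open>R r\<close> is the summand \<open>j = r + 1\<close>:
    there \<open>m (r + 1) = 0\<close>, and the chain from \<open>r + 1\<close> to \<open>r\<close>
    is empty.\<close>
  have "S r t w - m r / 2 * R r t w = (\<Sum>b\<in>UNIV. ?cc b * Phi_chain r 1 (?UU b) t w) - (\<Sum>j=1..r+1. ?c j * Phi_chain r j (R (j - 1)) t w)" for w
    unfolding S_expand[OF t order_refl] PS using m_last by (simp add: Phi_chain_empty)
  note eq = this
  have "?E (\<lambda>t w. S r t w - m r / 2 * R r t w) =
      ?E (\<lambda>t w. (\<Sum>b\<in>UNIV. ?cc b * Phi_chain r 1 (?UU b) t w) - (\<Sum>j=1..r+1. ?c j * Phi_chain r j (R (j - 1)) t w))"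
    by (rule gauss_avg_cong) (rule eq)
  also have "\<dots> = ?E (\<lambda>t w. \<Sum>b\<in>UNIV. ?cc b * Phi_chain r 1 (?UU b) t w) - ?E (\<lambda>t w. \<Sum>j=1..r+1. ?c j * Phi_chain r j (R (j - 1)) t w)"
    by (rule gauss_avg_diff[OF g t exp_growth_sum exp_growth_sum]) (rule eP eR, assumption?)+
  also have "?E (\<lambda>t w. \<Sum>b\<in>UNIV. ?cc b * Phi_chain r 1 (?UU b) t w) = (\<Sum>b\<in>UNIV. ?E (\<lambda>t w. ?cc b * Phi_chain r 1 (?UU b) t w))"
    by (rule gauss_avg_outer_sum[OF t]) (rule eP)
  also have "\<dots> = (\<Sum>b\<in>UNIV. ?cc b * ?E (Phi_chain r 1 (?UU b)))" by (simp only: gauss_avg_cmult)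
  also have "\<dots> = s * \<beta>\<^sup>2 / 2 * ?E (Phi_chain r 1 ?U1) + s * \<beta>\<^sup>2 / 2 * ((s - 1) * ?E (Phi_chain r 1 ?U2))"
    by (simp add: UNIV_bool)
  also have "\<dots> = s * \<beta>\<^sup>2 / 2 * \<phi>01 t + s * \<beta>\<^sup>2 / 2 * \<phi>02 t"
    by (simp only: \<phi>01_eq[OF t] \<phi>02_eq[OF t])
  also have "?E (\<lambda>t w. \<Sum>j=1..r+1. ?c j * Phi_chain r j (R (j - 1)) t w) = (\<Sum>j=1..r+1. ?E (\<lambda>t w. ?c j * Phi_chain r j (R (j - 1)) t w))"
    by (rule gauss_avg_outer_sum[OF t]) (rule eR)
  also have "\<dots> = (\<Sum>j=1..r+1. - (s * \<beta>\<^sup>2 / 2 * \<phi> t j))"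
  proof (intro sum.cong refl)
    fix j assume j: "j \<in> {1..r+1}"
    have "?E (\<lambda>t w. ?c j * Phi_chain r j (R (j - 1)) t w) = ?c j * ?E (Phi_chain r j (R (j - 1)))" by (rule gauss_avg_cmult)
    then show "?E (\<lambda>t w. ?c j * Phi_chain r j (R (j - 1)) t w) = - (s * \<beta>\<^sup>2 / 2 * \<phi> t j)"
      using \<phi>_eq[OF t j] by simp
  qed
  also have "\<dots> = - (s * \<beta>\<^sup>2 / 2 * (\<Sum>j=1..r+1. \<phi> t j))"
    by (simp only: sum_negf sum_distrib_left)
  finally show ?thesis by (simp only: distrib_left minus_minus diff_minus_eq_add ac_simps)
qed

lemma \<psi>_eq:
  assumes t: "t \<in> {0..1}"
  shows "\<psi> t = 1 / (\<beta> * \<bar>s\<bar> * sqrt (real CARD('n))) * gauss_avg fwd (step_law (r + 1)) (log_zeta r) t 0"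
proof -
  have mr: "m r \<noteq> 0" using m_0 m_nz[of r] by (cases r) auto
  have "(\<lambda>G U. 1 / (\<beta> * \<bar>s\<bar> * sqrt (real CARD('n)) * m r) * ln (\<zeta> t r G U)) =
      lift_rv t (\<lambda>t w. 1 / (\<beta> * \<bar>s\<bar> * sqrt (real CARD('n))) * log_zeta r t w) r"
    unfolding \<zeta>_lift_rv[OF t order_refl] using mr by (simp add: lift_rv_def fun_eq_iff)
  then have "\<psi> t = gauss_avg fwd (step_law (r + 1)) (\<lambda>t w. 1 / (\<beta> * \<bar>s\<bar> * sqrt (real CARD('n))) * log_zeta r t w) t 0"
    unfolding \<psi>_def by (simp only: E_outer_lift_rv)
  then show ?thesis by (simp only: gauss_avg_cmult)
qed

lemma \<psi>_derivative:
  assumes t: "t \<in> {0..1}"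
  shows "(\<psi> has_real_derivative sgn s * \<beta> / (2 * sqrt (real CARD('n))) *
    ((\<Sum>k=1..r+1. \<phi> t k) + \<phi>01 t + \<phi>02 t)) (at t within {0..1})"
proof -
  let ?c = "1 / (\<beta> * \<bar>s\<bar> * sqrt (real CARD('n)))"
  let ?X = "(\<Sum>k=1..r+1. \<phi> t k) + \<phi>01 t + \<phi>02 t"
  have "((\<lambda>t. ?c * gauss_avg fwd (step_law (r + 1)) (log_zeta r) t 0) has_real_derivative ?c * (s * \<beta>\<^sup>2 / 2 * ?X)) (at t within {0..1})"
    using DERIV_cmult[OF outer_derivative[OF t], of ?c] unfolding outer_value[OF t] .
  then have "(\<psi> has_real_derivative ?c * (s * \<beta>\<^sup>2 / 2 * ?X)) (at t within {0..1})"
    by (rule has_field_derivative_transform_within[where d=1]) (use t \<psi>_eq in auto)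
  moreover have "?c * (s * \<beta>\<^sup>2 / 2 * ?X) = sgn s * \<beta> / (2 * sqrt (real CARD('n))) * ?X"
    \<comment> \<open>If \<open>s = 0\<close> or \<open>\<beta> = 0\<close>, the prefactor is 1/0,
      which is 0, and the right-hand side vanishes too. Otherwise \<open>s\<close> divided by its
      absolute value is \<open>sgn s\<close>, and one factor \<open>\<beta>\<close> cancels.\<close>
    by (cases "s = 0 \<or> \<beta> = 0") (auto simp: real_sgn_eq power2_eq_square)
  ultimately show ?thesis by simp
qed

end

text \<open>With no vectors at all, \<open>Z = 0\<close> and every quantity is \<open>0\<close> by the conventions \<open>ln 0 = 0\<close>
  and \<open>0 powr a = 0\<close>.\<close>

lemma (in lifted) \<psi>_no_vectors:
  assumes "l = 0" shows "\<psi> t = 0" "\<phi> t k = 0" "\<phi>01 t = 0" "\<phi>02 t = 0"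
proof -
  have e: "{1..l} = {}" using assms by simp
  have "\<zeta> t k = (\<lambda>G U. 0)" for k
  proof (induction k)
    case 0
    show ?case unfolding \<zeta>.simps Z_def e by simp
  next
    case (Suc k)
    then show ?case unfolding \<zeta>.simps EU_def by simp
  qed
  then show "\<psi> t = 0" by (simp add: \<psi>_def E_outer_def case_prod_unfold)
  show "\<phi> t k = 0" unfolding \<phi>_def E_outer_def e by (simp add: case_prod_unfold)
  show "\<phi>01 t = 0" unfolding \<phi>01_def E_outer_def e by (simp add: case_prod_unfold)
  show "\<phi>02 t = 0" unfolding \<phi>02_def E_outer_def e by (simp add: case_prod_unfold)
qed

theorem theorem1:
  fixes r l :: nat
    and x :: "nat \<Rightarrow> real^'n" and y :: "nat \<Rightarrow> real^'m"
    and p q m :: "nat \<Rightarrow> real"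
    and \<beta> s t :: real
  assumes "m 0 = 1" and "m (r + 1) = 0" and "\<And>k. k \<in> {1..r} \<Longrightarrow> m k \<noteq> 0"
    and "p 0 \<le> 1" and "\<And>k. k \<le> r \<Longrightarrow> p (k + 1) \<le> p k" and "p (r + 1) = 0"
    and "q 0 \<le> 1" and "\<And>k. k \<le> r \<Longrightarrow> q (k + 1) \<le> q k" and "q (r + 1) = 0"
    and "\<beta> \<ge> 0"
    and "t \<in> {0..1}"
  shows "(((\<lambda>t. lifted.\<psi> r l x y p q m \<beta> s t) has_real_derivative
            sgn s * \<beta> / (2 * sqrt (real CARD('n))) *
              ((\<Sum>k1=1..r+1. lifted.\<phi> r l x y p q m \<beta> s t k1)
               + lifted.\<phi>01 r l x y p q m \<beta> s t
               + lifted.\<phi>02 r l x y p q m \<beta> s t))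
          (at t within {0..1}))
         \<and> (p 0 = 1 \<and> q 0 = 1 \<longrightarrow>
          ((\<lambda>t. lifted.\<psi> r l x y p q m \<beta> s t) has_real_derivative
            sgn s * \<beta> / (2 * sqrt (real CARD('n))) *
              (\<Sum>k1=1..r+1. lifted.\<phi> r l x y p q m \<beta> s t k1))
          (at t within {0..1}))"
proof -
  have main: "((\<lambda>t. lifted.\<psi> r l x y p q m \<beta> s t) has_real_derivative
      sgn s * \<beta> / (2 * sqrt (real CARD('n))) *
        ((\<Sum>k1=1..r+1. lifted.\<phi> r l x y p q m \<beta> s t k1)
         + lifted.\<phi>01 r l x y p q m \<beta> s t + lifted.\<phi>02 r l x y p q m \<beta> s t)) (at t within {0..1})"
  proof (cases "l = 0")
    case True
    then show ?thesis by (simp add: lifted.\<psi>_no_vectors)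
  next
    case False
    then interpret lifted_assms r l x y p q m \<beta> s using assms by unfold_locales auto
    show ?thesis using \<psi>_derivative[OF assms(11)] .
  qed
  moreover have "lifted.\<phi>01 r l x y p q m \<beta> s t = 0" "lifted.\<phi>02 r l x y p q m \<beta> s t = 0" if "p 0 = 1"
    using that by (simp_all add: lifted.\<phi>01_def lifted.\<phi>02_def)
  ultimately show ?thesis by auto
qed

end
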